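(* Let $K$ be an algebraically closed field of arbitrary characteristic. If $0\neq f\in\langle x,y\rangle\subset K[[x,y]]$ is Newton non-degenerate (NND), then $\mu(f)=\mu_N(f)$.
   Context: $\mu(f)=\dim_K K[[x,y]]/\langle f_x,f_y\rangle\in\mathbb{Z}_{\geq0}\cup\{\infty\}$. Write $f=\sum_\alpha a_\alpha x^{\alpha_1}y^{\alpha_2}$, $\operatorname{supp}(f)=\{\alpha\mid a_\alpha\neq 0\}$. The Newton diagram $\Gamma(f)$ is the union of the compact faces (vertices and edges) of the convex hull of $\bigcup_{\alpha\in\operatorname{supp}(f)}(\alpha+\mathbb{R}_{\geq0}^2)$; $\Gamma_-(f)$ is the union of all segments joining the origin to points of $\Gamma(f)$; $f$ is convenient if $\Gamma(f)$ meets both coordinate axes. For a face $\Delta$ put $\operatorname{in}_\Delta(f)=\sum_{\alpha\in\Delta}a_\alpha x^{\alpha_1}y^{\alpha_2}$. $f$ is NND if for every face $\Delta$ (of any dimension) of $\Gamma(f)$ the partial derivatives of $\operatorname{in}_\Delta(f)$ have no common zero in $(K^* )^2$; convenience is not required. Newton number: if $f$ is convenient, $\mu_N(f)=2V_2(\Gamma_-(f))-V_1(\Gamma_-(f))+1$, where $V_2$ is the area and $V_1$ the sum of the lengths of the intersections with the two coordinate axes. Otherwise $\mu_N(f)=\sup\{\mu_N(f_m)\mid m\geq1\}\in\mathbb{Z}\cup\{\infty\}$, where $f_m=f+x^m+y^m$ and no cancellation is allowed, i.e. the Newton diagram of $f_m$ is formed from the support $\operatorname{supp}(f)\cup\{(m,0),(0,m)\}$.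 *)

theory Defs
  imports
    "HOL-Analysis.Analysis"
    "HOL-Library.Extended_Real"
    "HOL-Computational_Algebra.Polynomial"
    "HOL-Computational_Algebra.Formal_Power_Series"
    "HOL-Algebra.QuotRing"
    "HOL-Algebra.Embedded_Algebras"
    "HOL-Algebra.Algebraic_Closure_Type"
begin

section \<open>Power series in two variables\<close>

text \<open>
  The ring \<open>K[[x,y]]\<close> is represented as \<open>K[[x]][[y]]\<close>, i.e. by the type \<open>'a fps fps\<close> whose
  outer variable is \<open>y\<close> and whose inner variable is \<open>x\<close>. The exponent \<open>(i, j)\<close> stands for the
  monomial \<open>x^i y^j\<close>.
\<close>

definition fps2_coeff :: "'a::zero fps fps \<Rightarrow> nat \<times> nat \<Rightarrow> 'a" where
  "fps2_coeff f \<alpha> = fps_nth (fps_nth f (snd \<alpha>)) (fst \<alpha>)"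

definition fps2_supp :: "'a::zero fps fps \<Rightarrow> (nat \<times> nat) set" where
  "fps2_supp f = {\<alpha>. fps2_coeff f \<alpha> \<noteq> 0}"

definition fps2_X :: "'a::comm_ring_1 fps fps" where
  "fps2_X = fps_const fps_X"

definition fps2_Y :: "'a::comm_ring_1 fps fps" where
  "fps2_Y = fps_X"

definition fps2_const :: "'a::comm_ring_1 \<Rightarrow> 'a fps fps" where
  "fps2_const c = fps_const (fps_const c)"

definition fps2_dx :: "'a::comm_ring_1 fps fps \<Rightarrow> 'a fps fps" where
  "fps2_dx f = Abs_fps (\<lambda>j. fps_deriv (fps_nth f j))"

definition fps2_dy :: "'a::comm_ring_1 fps fps \<Rightarrow> 'a fps fps" where
  "fps2_dy f = fps_deriv f"

definition fps2_ideal :: "'a::comm_ring_1 fps fps set \<Rightarrow> 'a fps fps set" where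
  "fps2_ideal A = genideal ring_of_type_algebra A"

section \<open>The Milnor number\<close>

definition fps2_quot :: "'a::comm_ring_1 fps fps set \<Rightarrow> 'a fps fps set ring" where
  "fps2_quot I = ring_of_type_algebra Quot I"

text \<open>
  The base field is embedded into the quotient as the set of residue classes of the constants;
  if \<open>I\<close> is the unit ideal, the quotient is the zero ring and its dimension is \<open>0\<close>.
\<close>

definition fps2_quot_scalars :: "'a::comm_ring_1 fps fps set \<Rightarrow> 'a fps fps set set" where
  "fps2_quot_scalars I = range (\<lambda>c. I +>\<^bsub>ring_of_type_algebra\<^esub> fps2_const c)"

definition fps2_codim :: "'a::comm_ring_1 fps fps set \<Rightarrow> enat" where
  "fps2_codim I =
    (if ring.finite_dimension (fps2_quot I) (fps2_quot_scalars I) (carrier (fps2_quot I))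
     then enat (ring.dim (fps2_quot I) (fps2_quot_scalars I) (carrier (fps2_quot I)))
     else \<infinity>)"

definition milnor_number :: "'a::comm_ring_1 fps fps \<Rightarrow> enat" where
  "milnor_number f = fps2_codim (fps2_ideal {fps2_dx f, fps2_dy f})"

section \<open>Newton diagrams\<close>

definition real_point :: "nat \<times> nat \<Rightarrow> real \<times> real" where
  "real_point \<alpha> = (real (fst \<alpha>), real (snd \<alpha>))"

definition newton_polyhedron :: "(nat \<times> nat) set \<Rightarrow> (real \<times> real) set" where
  "newton_polyhedron S =
    convex hull (\<Union>\<alpha>\<in>S. {real_point \<alpha> + (s, t) | s t. s \<ge> 0 \<and> t \<ge> 0})"

text \<open>
  The Newton polyhedron of a nonempty set is unbounded and two-dimensional, so its nonempty
  compact faces are exactly its vertices and its compact edges.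
\<close>

definition newton_faces :: "(nat \<times> nat) set \<Rightarrow> (real \<times> real) set set" where
  "newton_faces S = {\<Delta>. \<Delta> face_of newton_polyhedron S \<and> \<Delta> \<noteq> {} \<and> compact \<Delta>}"

definition newton_diagram :: "(nat \<times> nat) set \<Rightarrow> (real \<times> real) set" where
  "newton_diagram S = \<Union> (newton_faces S)"

definition newton_below :: "(nat \<times> nat) set \<Rightarrow> (real \<times> real) set" where
  "newton_below S = (\<Union>p\<in>newton_diagram S. closed_segment 0 p)"

definition convenient :: "(nat \<times> nat) set \<Rightarrow> bool" where
  "convenient S \<longleftrightarrow>
    newton_diagram S \<inter> {p. snd p = 0} \<noteq> {} \<and> newton_diagram S \<inter> {p. fst p = 0} \<noteq> {}"

section \<open>The Newton number\<close>

definition newton_area :: "(nat \<times> nat) set \<Rightarrow> real" where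
  "newton_area S = measure lborel (newton_below S)"

definition newton_axes_length :: "(nat \<times> nat) set \<Rightarrow> real" where
  "newton_axes_length S =
    measure lborel {s. (s, 0) \<in> newton_below S} + measure lborel {t. (0, t) \<in> newton_below S}"

definition convenient_newton_number :: "(nat \<times> nat) set \<Rightarrow> real" where
  "convenient_newton_number S = 2 * newton_area S - newton_axes_length S + 1"

text \<open>
  The Newton number only depends on the support. Replacing \<open>f\<close> by \<open>f + x^m + y^m\<close> without
  cancellation means adding \<open>(m, 0)\<close> and \<open>(0, m)\<close> to the support, which makes it convenient.
\<close>

definition newton_number :: "'a::zero fps fps \<Rightarrow> ereal" where
  "newton_number f =
    (if convenient (fps2_supp f) then ereal (convenient_newton_number (fps2_supp f))
     else (SUP m\<in>{1::nat..}.
             ereal (convenient_newton_number (fps2_supp f \<union> {(m, 0), (0, m)}))))"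

section \<open>Newton non-degeneracy\<close>

text \<open>
  A polynomial in \<open>x, y\<close> is an element of \<open>K[x][y]\<close>, with the same convention as for power series.
  For compact \<open>\<Delta>\<close>, in particular for every element of \<open>newton_faces\<close>, the sum is finite.
\<close>

definition initial_part :: "(real \<times> real) set \<Rightarrow> 'a::comm_ring_1 fps fps \<Rightarrow> 'a poly poly" where
  "initial_part \<Delta> f =
    (\<Sum>\<alpha> | real_point \<alpha> \<in> \<Delta>. Polynomial.monom (Polynomial.monom (fps2_coeff f \<alpha>) (fst \<alpha>)) (snd \<alpha>))"

definition poly2_dx :: "'a::field poly poly \<Rightarrow> 'a poly poly" where
  "poly2_dx p = map_poly pderiv p"

definition poly2_dy :: "'a::field poly poly \<Rightarrow> 'a poly poly" where
  "poly2_dy p = pderiv p"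

definition poly2_eval :: "'a::field poly poly \<Rightarrow> 'a \<Rightarrow> 'a \<Rightarrow> 'a" where
  "poly2_eval p a b = poly (poly p [:b:]) a"

definition newton_nondegenerate :: "'a::field fps fps \<Rightarrow> bool" where
  "newton_nondegenerate f \<longleftrightarrow>
    (\<forall>\<Delta>\<in>newton_faces (fps2_supp f).
      \<not> (\<exists>a b. a \<noteq> 0 \<and> b \<noteq> 0 \<and>
            poly2_eval (poly2_dx (initial_part \<Delta> f)) a b = 0 \<and>
            poly2_eval (poly2_dy (initial_part \<Delta> f)) a b = 0))"

end

theory Submission
  imports Defs
begin

text \<open>
  Let \<open>g = x f\<^sub>x\<close>, \<open>h = y f\<^sub>y\<close>, and let \<open>M\<close> be the Newton filtration of a convenient \<open>f\<close>, scaled to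
  take the value \<open>P\<close> on the Newton diagram. Multiplication by \<open>xy\<close> turns \<open>u f\<^sub>x + v f\<^sub>y\<close> into
  \<open>(yu) g + (xv) h\<close>. On the cone over an edge the leading forms of \<open>g\<close> and \<open>h\<close> are polynomials in one
  variable, which nondegeneracy makes coprime of the right degrees; hence the map
  \<open>(u', v') \<mapsto> u' g + v' h\<close> is injective on the graded pieces of degree less than \<open>P\<close> and surjective
  on those of degree at least \<open>P\<close>. The cones are glued by reducing monomials from the \<open>x\<close>-axis towards
  the \<open>y\<close>-axis. So \<open>\<mu>(f)\<close> is the number of monomials of degree less than \<open>2P\<close> divisible by \<open>xy\<close>, minus
  the numbers of monomials of degree less than \<open>P\<close> divisible by \<open>y\<close> and by \<open>x\<close>. Cutting each cone
  into translates of a fundamental parallelogram identifies this number with the Newton number.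

  If \<open>f\<close> is not convenient and not divisible by the square of a variable, then adding \<open>x^m\<close> and \<open>y^m\<close>,
  for large \<open>m\<close> prime to the characteristic, changes neither nondegeneracy nor the Jacobian ideal, because
  the Milnor numbers of the convenient series so obtained do not depend on \<open>m\<close>. If the square of a
  variable divides \<open>f\<close>, both numbers are infinite.
\<close>

text \<open>The threshold P comes from counting. On the line of level N in the cone over an edge,
  the admissible y-exponents fill an interval of length d N / P, where d is the y-extent of the
  edge, while the leading forms, divided by a power of y, are coprime and one of them has degree d.
  Two coefficient polynomials supported on at most d consecutive exponents admit no relation; once
  the interval holds d exponents, they produce every monomial required. So N < P gives injectivity
  and N \<ge> P surjectivity.

  The obstacle to working cone by cone is that a combination realizing a monomial in one cone has
  further terms of the same level. Its coefficients are kept off the ray on the x-axis side, so such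
  terms can only appear in the next cone; this makes an induction on level and cone index possible.

  For a series that is not convenient no finiteness is known in advance. The eventual Newton number
  is computed first and the exponent of the added power is chosen beyond it, so that the Milnor
  number of the completed series is small compared with that exponent.\<close>

section \<open>Dimension counts modulo a subspace\<close>

text \<open>Each \<open>z\<close> is congruent to some \<open>w z\<close> in \<open>span B\<close>.
  The linear extension \<open>g\<close> of this choice moves vectors of \<open>span Z\<close> only
  by elements of \<open>I\<close>, so its kernel there lies in \<open>span Z \<inter> I\<close>, and
  the usual bound applies to the image. Dimensions of a quotient are thus compared without forming
  the quotient space.\<close>

lemma (in vector_space) independent_mod_card_le:
  assumes B: "finite B" and span: "\<And>w. \<exists>b\<in>span B. w - b \<in> I"
    and I: "subspace I" and Z: "independent Z" "span Z \<inter> I \<subseteq> {0}"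
  shows "finite Z \<and> card Z \<le> card B"
proof -
  interpret vector_space_pair scale scale ..
  obtain w where w: "\<And>z. w z \<in> span B" "\<And>z. z - w z \<in> I"
    using span by metis
  obtain g where g: "Vector_Spaces.linear scale scale g" "\<And>z. z \<in> Z \<Longrightarrow> g z = w z"
    using linear_independent_extend[OF Z(1), of w] by blast
  interpret g: Vector_Spaces.linear scale scale g by (fact g(1))
  have mod: "v - g v \<in> I" if "v \<in> span Z" for v
    using that
  proof (induction rule: span_induct_alt)
    case base
    then show ?case using I by (simp add: subspace_0 g.zero)
  next
    case (step c x y)
    have "g (c *s x + y) = c *s w x + g y"
      using g(2)[OF step(1)] by (simp only: g.add g.scale)
    then have eq: "c *s x + y - g (c *s x + y) = c *s (x - w x) + (y - g y)"
      by (simp add: scale_right_diff_distrib)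
    show ?case
      unfolding eq using I w(2) step by (simp add: subspace_add subspace_scale)
  qed
  have inj: "inj_on g (span Z)"
  proof (rule inj_onI)
    fix u v assume uv: "u \<in> span Z" "v \<in> span Z" "g u = g v"
    have "u - v \<in> span Z" using uv by (simp add: span_diff)
    then have "u - v - g (u - v) \<in> I" by (rule mod)
    then have "u - v \<in> I" using uv by (simp add: g.diff)
    then show "u = v" using Z(2) \<open>u - v \<in> span Z\<close> by auto
  qed
  have "independent (g ` Z)"
    by (rule linear_independent_injective_image[OF g(1) Z(1) inj])
  moreover have "g ` Z \<subseteq> span B" using g(2) w(1) by auto
  ultimately have "finite (g ` Z) \<and> card (g ` Z) \<le> card B"
    using independent_span_bound[OF B] by blast
  moreover have "inj_on g Z" using inj by (rule inj_on_subset) (rule span_superset)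
  ultimately show ?thesis by (simp add: finite_image_iff card_image)
qed

section \<open>Coefficients of power series in two variables\<close>

lemma fps2_eqI: "(\<And>z. fps2_coeff f z = fps2_coeff g z) \<Longrightarrow> f = g"
  by (intro fps_ext) (metis fps2_coeff_def fst_conv snd_conv)

lemma fps2_coeff_add [simp]: "fps2_coeff (f + g) z = fps2_coeff f z + fps2_coeff g z"
  and fps2_coeff_0 [simp]: "fps2_coeff 0 z = 0"
  by (simp_all add: fps2_coeff_def)

lemma fps2_coeff_diff [simp]: "fps2_coeff (f - g :: 'a::comm_ring_1 fps fps) z = fps2_coeff f z - fps2_coeff g z"
  and fps2_coeff_minus [simp]: "fps2_coeff (- f :: 'a::comm_ring_1 fps fps) z = - fps2_coeff f z"
  by (simp_all add: fps2_coeff_def)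

lemma fps2_coeff_sum [simp]:
  "fps2_coeff (\<Sum>a\<in>A. f a :: 'a::comm_ring_1 fps fps) z = (\<Sum>a\<in>A. fps2_coeff (f a) z)"
  by (induction A rule: infinite_finite_induct) auto

lemma fps2_coeff_const_mult [simp]: "fps2_coeff (fps2_const c * f) z = c * fps2_coeff f z"
  by (simp add: fps2_coeff_def fps2_const_def)

lemma fps2_const_hom:
  "fps2_const (a + b) = fps2_const a + fps2_const b" "fps2_const (a * b) = fps2_const a * fps2_const b"
  "fps2_const 0 = 0" "fps2_const 1 = 1"
  by (simp_all add: fps2_const_def flip: fps_const_add fps_const_mult)

interpretation fps2: vector_space "\<lambda>c::'a::field. (*) (fps2_const c)"
  by unfold_locales (simp_all add: fps2_const_hom algebra_simps)

definition fps2_below :: "nat \<times> nat \<Rightarrow> (nat \<times> nat) set" where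
  "fps2_below z = {..fst z} \<times> {..snd z}"

text \<open>Subtraction of naturals is truncated, so this is a difference of exponents only for
  \<open>a \<in> fps2_below z\<close>.\<close>

definition fps2_minus :: "nat \<times> nat \<Rightarrow> nat \<times> nat \<Rightarrow> nat \<times> nat" where
  "fps2_minus z a = (fst z - fst a, snd z - snd a)"

lemma fps2_below_finite [simp]: "finite (fps2_below z)"
  by (simp add: fps2_below_def)

lemma fps2_coeff_mult:
  "fps2_coeff (f * g :: 'a::comm_ring_1 fps fps) z =
     (\<Sum>a\<in>fps2_below z. fps2_coeff f a * fps2_coeff g (fps2_minus z a))"
proof -
  have "fps2_coeff (f * g) z =
      (\<Sum>j\<le>snd z. \<Sum>i\<le>fst z. f $ j $ i * g $ (snd z - j) $ (fst z - i))"
    by (simp add: fps2_coeff_def fps_mult_nth fps_sum_nth atLeast0AtMost)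
  also have "\<dots> = (\<Sum>i\<le>fst z. \<Sum>j\<le>snd z. f $ j $ i * g $ (snd z - j) $ (fst z - i))"
    by (rule sum.swap)
  also have "\<dots> = (\<Sum>a\<in>fps2_below z. fps2_coeff f a * fps2_coeff g (fps2_minus z a))"
    by (simp add: sum.cartesian_product fps2_below_def fps2_coeff_def fps2_minus_def case_prod_beta)
  finally show ?thesis .
qed

definition Abs_fps2 :: "(nat \<times> nat \<Rightarrow> 'a) \<Rightarrow> 'a::zero fps fps" where
  "Abs_fps2 c = Abs_fps (\<lambda>j. Abs_fps (\<lambda>i. c (i, j)))"

lemma fps2_coeff_Abs [simp]: "fps2_coeff (Abs_fps2 c) z = c z"
  by (simp add: Abs_fps2_def fps2_coeff_def)

definition fps2_monom :: "nat \<times> nat \<Rightarrow> 'a::comm_ring_1 fps fps" where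
  "fps2_monom a = Abs_fps2 (\<lambda>z. if z = a then 1 else 0)"

lemma fps2_coeff_monom: "fps2_coeff (fps2_monom a) z = (if z = a then 1 else 0)"
  by (simp add: fps2_monom_def)

lemma fps2_coeff_monom_mult:
  "fps2_coeff (fps2_monom a * g :: 'a::comm_ring_1 fps fps) z =
     (if a \<in> fps2_below z then fps2_coeff g (fps2_minus z a) else 0)"
proof -
  have "fps2_coeff (fps2_monom a * g) z =
      (\<Sum>b\<in>fps2_below z. if b = a then fps2_coeff g (fps2_minus z a) else 0)"
    unfolding fps2_coeff_mult by (intro sum.cong) (auto simp: fps2_coeff_monom)
  then show ?thesis by (simp add: sum.delta)
qed

lemma fps2_X_eq_monom: "fps2_X = fps2_monom (1, 0)"
  by (rule fps2_eqI) (auto simp: fps2_coeff_def fps2_monom_def Abs_fps2_def fps2_X_def prod_eq_iff)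

lemma fps2_Y_eq_monom: "fps2_Y = fps2_monom (0, 1)"
  by (rule fps2_eqI) (auto simp: fps2_coeff_def fps2_monom_def Abs_fps2_def fps2_Y_def prod_eq_iff)

lemma fps2_monom_mult: "fps2_monom a * fps2_monom b = (fps2_monom (a + b) :: 'a::comm_ring_1 fps fps)"
  by (rule fps2_eqI)
     (auto simp: fps2_coeff_monom_mult fps2_coeff_monom fps2_below_def fps2_minus_def prod_eq_iff mem_Times_iff)

lemma fps2_coeff_dx: "fps2_coeff (fps2_dx f) z = of_nat (fst z + 1) * fps2_coeff f (fst z + 1, snd z)"
  by (simp add: fps2_coeff_def fps2_dx_def)

lemma fps2_coeff_dy: "fps2_coeff (fps2_dy f) z = of_nat (snd z + 1) * fps2_coeff f (fst z, snd z + 1)"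
  by (simp add: fps2_coeff_def fps2_dy_def flip: fps_of_nat)

section \<open>Ideals and codimension\<close>

context
  fixes I :: "'a::comm_ring_1 fps fps set"
  assumes I: "ideal I ring_of_type_algebra"
begin

lemma ideal_type_algebra:
  shows "0 \<in> I" "\<And>a b. a \<in> I \<Longrightarrow> b \<in> I \<Longrightarrow> a + b \<in> I" "\<And>a r. a \<in> I \<Longrightarrow> r * a \<in> I"
    "\<And>a. a \<in> I \<Longrightarrow> - a \<in> I" "\<And>a b. a \<in> I \<Longrightarrow> b \<in> I \<Longrightarrow> a - b \<in> I"
proof -
  interpret ideal I "ring_of_type_algebra :: 'a fps fps ring" by (fact I)
  show 0: "0 \<in> I" using additive_subgroup.zero_closed[OF is_additive_subgroup]
    by (simp add: ring_of_type_algebra_def)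
  show add: "\<And>a b. a \<in> I \<Longrightarrow> b \<in> I \<Longrightarrow> a + b \<in> I"
    using additive_subgroup.a_closed[OF is_additive_subgroup]
    by (simp add: ring_of_type_algebra_def)
  show mult: "\<And>a r. a \<in> I \<Longrightarrow> r * a \<in> I"
    using I_l_closed by (simp add: ring_of_type_algebra_def)
  show "\<And>a. a \<in> I \<Longrightarrow> - a \<in> I" using mult[of _ "-1"] by simp
  then show "\<And>a b. a \<in> I \<Longrightarrow> b \<in> I \<Longrightarrow> a - b \<in> I" using add[of _ "- _"] by fastforce
qed

lemma coset_type_algebra:
  "(I +>\<^bsub>ring_of_type_algebra\<^esub> x = I +>\<^bsub>ring_of_type_algebra\<^esub> y) \<longleftrightarrow> x - y \<in> I"
proof -
  have coset: "I +>\<^bsub>ring_of_type_algebra\<^esub> x = (\<lambda>i. i + x) ` I" for x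
    by (auto simp: a_r_coset_def r_coset_def ring_of_type_algebra_def)
  show ?thesis
  proof
    assume "I +>\<^bsub>ring_of_type_algebra\<^esub> x = I +>\<^bsub>ring_of_type_algebra\<^esub> y"
    moreover have "x \<in> (\<lambda>i. i + x) ` I" using ideal_type_algebra(1) by force
    ultimately obtain i where "i \<in> I" "x = i + y" unfolding coset by blast
    then show "x - y \<in> I" by simp
  next
    assume xy: "x - y \<in> I"
    have "i + x \<in> (\<lambda>i. i + y) ` I" if "i \<in> I" for i
      using ideal_type_algebra(2)[OF that xy] by (intro image_eqI[of _ _ "i + (x - y)"]) auto
    moreover have "i + y \<in> (\<lambda>i. i + x) ` I" if "i \<in> I" for i
      using ideal_type_algebra(5)[OF that xy] by (intro image_eqI[of _ _ "i - (x - y)"]) auto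
    ultimately show "I +>\<^bsub>ring_of_type_algebra\<^esub> x = I +>\<^bsub>ring_of_type_algebra\<^esub> y"
      unfolding coset by blast
  qed
qed

lemma quot_type_algebra:
  "carrier (fps2_quot I) = range (\<lambda>x. I +>\<^bsub>ring_of_type_algebra\<^esub> x)"
  "\<zero>\<^bsub>fps2_quot I\<^esub> = I +>\<^bsub>ring_of_type_algebra\<^esub> 0"
  "(I +>\<^bsub>ring_of_type_algebra\<^esub> x) \<otimes>\<^bsub>fps2_quot I\<^esub> (I +>\<^bsub>ring_of_type_algebra\<^esub> y) =
     I +>\<^bsub>ring_of_type_algebra\<^esub> (x * y)"
  "(I +>\<^bsub>ring_of_type_algebra\<^esub> x) \<oplus>\<^bsub>fps2_quot I\<^esub> (I +>\<^bsub>ring_of_type_algebra\<^esub> y) =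
     I +>\<^bsub>ring_of_type_algebra\<^esub> (x + y)"
proof -
  interpret ideal I "ring_of_type_algebra :: 'a fps fps ring" by (fact I)
  show "carrier (fps2_quot I) = range (\<lambda>x. I +>\<^bsub>ring_of_type_algebra\<^esub> x)"
    by (auto simp: fps2_quot_def FactRing_def A_RCOSETS_def RCOSETS_def a_r_coset_def
        ring_of_type_algebra_def)
  have "I = I +>\<^bsub>ring_of_type_algebra\<^esub> 0"
    by (simp add: a_r_coset_def r_coset_def ring_of_type_algebra_def)
  then show "\<zero>\<^bsub>fps2_quot I\<^esub> = I +>\<^bsub>ring_of_type_algebra\<^esub> 0"
    by (simp add: fps2_quot_def FactRing_def)
  show "(I +>\<^bsub>ring_of_type_algebra\<^esub> x) \<otimes>\<^bsub>fps2_quot I\<^esub> (I +>\<^bsub>ring_of_type_algebra\<^esub> y) =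
     I +>\<^bsub>ring_of_type_algebra\<^esub> (x * y)"
    using rcoset_mult_add[of x y] by (simp add: fps2_quot_def FactRing_def ring_of_type_algebra_def)
  show "(I +>\<^bsub>ring_of_type_algebra\<^esub> x) \<oplus>\<^bsub>fps2_quot I\<^esub> (I +>\<^bsub>ring_of_type_algebra\<^esub> y) =
     I +>\<^bsub>ring_of_type_algebra\<^esub> (x + y)"
    using a_rcos_sum[of x y] by (simp add: fps2_quot_def FactRing_def ring_of_type_algebra_def)
qed

lemma ring_fps2_quot: "ring (fps2_quot I)"
  unfolding fps2_quot_def using I by (rule ideal.quotient_is_ring)

end

context
  fixes I :: "'a::field fps fps set"
  assumes I: "ideal I ring_of_type_algebra"
begin

lemma fps2_ideal_subspace: "fps2.subspace I"
  by (rule fps2.subspaceI) (use ideal_type_algebra[OF I] in auto)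

text \<open>\<open>ring.dimension\<close> is defined inductively by line extensions. This identity
  turns such a step into the insertion of one vector into a set \<open>B\<close> of representatives
  in the power series ring.\<close>

lemma line_extension_fps2_quot:
  "ring.line_extension (fps2_quot I) (fps2_quot_scalars I) (I +>\<^bsub>ring_of_type_algebra\<^esub> v)
      ((\<lambda>w. I +>\<^bsub>ring_of_type_algebra\<^esub> w) ` fps2.span B) =
     (\<lambda>w. I +>\<^bsub>ring_of_type_algebra\<^esub> w) ` fps2.span (insert v B)"
proof -
  interpret Q: ring "fps2_quot I" by (rule ring_fps2_quot[OF I])
  have "Q.line_extension (fps2_quot_scalars I) (I +>\<^bsub>ring_of_type_algebra\<^esub> v)
      ((\<lambda>w. I +>\<^bsub>ring_of_type_algebra\<^esub> w) ` fps2.span B) =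
    (\<Union>c. \<Union>b\<in>fps2.span B. {I +>\<^bsub>ring_of_type_algebra\<^esub> (fps2_const c * v + b)})"
    unfolding Q.line_extension_def fps2_quot_scalars_def r_coset_def set_add_def'
    by (auto simp: quot_type_algebra[OF I]) 
  also have "\<dots> = (\<lambda>w. I +>\<^bsub>ring_of_type_algebra\<^esub> w) ` fps2.span (insert v B)"
  proof (intro equalityI subsetI)
    fix s assume "s \<in> (\<Union>c. \<Union>b\<in>fps2.span B. {I +>\<^bsub>ring_of_type_algebra\<^esub> (fps2_const c * v + b)})"
    then obtain c b where "b \<in> fps2.span B" "s = I +>\<^bsub>ring_of_type_algebra\<^esub> (fps2_const c * v + b)"
      by blast
    moreover have "fps2_const c * v + b \<in> fps2.span (insert v B)" if "b \<in> fps2.span B"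
      using that fps2.span_insert[of v B] by (auto intro!: exI[of _ c])
    ultimately show "s \<in> (\<lambda>w. I +>\<^bsub>ring_of_type_algebra\<^esub> w) ` fps2.span (insert v B)" by blast
  next
    fix s assume "s \<in> (\<lambda>w. I +>\<^bsub>ring_of_type_algebra\<^esub> w) ` fps2.span (insert v B)"
    then obtain w where w: "w \<in> fps2.span (insert v B)" "s = I +>\<^bsub>ring_of_type_algebra\<^esub> w" by blast
    obtain c where c: "w - fps2_const c * v \<in> fps2.span B"
      using w(1) unfolding fps2.span_insert by blast
    show "s \<in> (\<Union>c. \<Union>b\<in>fps2.span B. {I +>\<^bsub>ring_of_type_algebra\<^esub> (fps2_const c * v + b)})"
      by (rule UN_I[of c UNIV], simp, rule UN_I[OF c]) (simp add: w(2))
  qed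
  finally show ?thesis .
qed

text \<open>Representatives are carried along the inductive definition of dimension. Their
  independence modulo \<open>I\<close> is expressed by independence of \<open>B\<close> together
  with \<open>span B \<inter> I \<subseteq> {0}\<close>.\<close>

lemma dimension_imp_basis_mod:
  assumes "ring.dimension (fps2_quot I) n (fps2_quot_scalars I) E"
  shows "\<exists>B. finite B \<and> card B = n \<and> fps2.independent B \<and> fps2.span B \<inter> I \<subseteq> {0} \<and>
           E = (\<lambda>w. I +>\<^bsub>ring_of_type_algebra\<^esub> w) ` fps2.span B"
proof -
  interpret Q: ring "fps2_quot I" by (rule ring_fps2_quot[OF I])
  show ?thesis using assms
  proof (induction "fps2_quot_scalars I" E rule: Q.dimension.induct)
    case zero_dim
    then show ?case by (intro exI[of _ "{}"]) (simp add: quot_type_algebra[OF I] fps2.independent_empty)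
  next
    case (Suc_dim v E n)
    then obtain B where B: "finite B" "card B = n" "fps2.independent B" "fps2.span B \<inter> I \<subseteq> {0}"
      "E = (\<lambda>w. I +>\<^bsub>ring_of_type_algebra\<^esub> w) ` fps2.span B" by blast
    obtain x where x: "v = I +>\<^bsub>ring_of_type_algebra\<^esub> x"
      using Suc_dim(1) by (auto simp: quot_type_algebra[OF I])
    have no: "x - b \<notin> I" if "b \<in> fps2.span B" for b
      using Suc_dim(2) that unfolding B(5) x coset_type_algebra[OF I, symmetric] by blast
    have xB: "x \<notin> fps2.span B"
      using no[of x] ideal_type_algebra(1)[OF I] by auto
    have xB': "x \<notin> B" using xB fps2.span_base by blast
    have "w = 0" if w: "w \<in> fps2.span (insert x B)" "w \<in> I" for w
    proof -
      obtain c where c: "w - fps2_const c * x \<in> fps2.span B"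
        using w(1) unfolding fps2.span_insert by blast
      have "c = 0"
      proof (rule ccontr)
        assume "c \<noteq> 0"
        \<comment> \<open>If \<open>c\<close> is nonzero, this element of the old span is congruent
          to \<open>x\<close> modulo \<open>I\<close>, against the choice of
          \<open>x\<close>.\<close>
        define b where "b = fps2_const (- inverse c) * (w - fps2_const c * x)"
        have "b \<in> fps2.span B" unfolding b_def using c by (rule fps2.span_scale)
        moreover have "x - b = fps2_const (inverse c) * w"
          using \<open>c \<noteq> 0\<close> unfolding b_def
          by (intro fps2_eqI) (simp add: mult.assoc, simp add: field_simps)
        ultimately show False
          using no[of b] ideal_type_algebra(3)[OF I w(2)] by simp
      qed
      then have "w \<in> fps2.span B" using c by (simp add: fps2_const_hom)
      then show "w = 0" using w(2) B(4) by auto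
    qed
    then have "fps2.span (insert x B) \<inter> I \<subseteq> {0}" by blast
    moreover have "Q.line_extension (fps2_quot_scalars I) v E =
        (\<lambda>w. I +>\<^bsub>ring_of_type_algebra\<^esub> w) ` fps2.span (insert x B)"
      unfolding B(5) x by (rule line_extension_fps2_quot)
    ultimately show ?case
      using B(1-3) xB xB' by (intro exI[of _ "insert x B"] conjI) (simp_all add: fps2.independent_insert)
  qed
qed

lemma basis_mod_imp_dimension:
  assumes "finite B" "fps2.independent B" "fps2.span B \<inter> I \<subseteq> {0}"
  shows "ring.dimension (fps2_quot I) (card B) (fps2_quot_scalars I)
           ((\<lambda>w. I +>\<^bsub>ring_of_type_algebra\<^esub> w) ` fps2.span B)"
proof -
  interpret Q: ring "fps2_quot I" by (rule ring_fps2_quot[OF I])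
  show ?thesis using assms
  proof (induction B rule: finite_induct)
    case empty
    then show ?case using Q.zero_dim by (simp add: quot_type_algebra[OF I])
  next
    case (insert x B)
    have sub: "fps2.span B \<subseteq> fps2.span (insert x B)" by (intro fps2.span_mono) auto
    have indep: "fps2.independent B" "x \<notin> fps2.span B"
      using insert.prems(1) insert.hyps(2) by (auto simp: fps2.independent_insert)
    have x: "I +>\<^bsub>ring_of_type_algebra\<^esub> x \<notin> (\<lambda>w. I +>\<^bsub>ring_of_type_algebra\<^esub> w) ` fps2.span B"
    proof
      assume "I +>\<^bsub>ring_of_type_algebra\<^esub> x \<in> (\<lambda>w. I +>\<^bsub>ring_of_type_algebra\<^esub> w) ` fps2.span B"
      then obtain b where b: "b \<in> fps2.span B" "x - b \<in> I"
        by (auto simp: coset_type_algebra[OF I])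
      have "x - b \<in> fps2.span (insert x B)"
        using b sub by (intro fps2.span_diff) (auto simp: fps2.span_base)
      then have "x = b" using b(2) insert.prems(2) by auto
      then show False using b(1) indep(2) by simp
    qed
    have "Q.dimension (card B) (fps2_quot_scalars I)
           ((\<lambda>w. I +>\<^bsub>ring_of_type_algebra\<^esub> w) ` fps2.span B)"
      using insert.IH indep(1) insert.prems(2) sub by blast
    from Q.Suc_dim[OF _ x this] show ?case
      using insert.hyps by (simp add: line_extension_fps2_quot quot_type_algebra[OF I])
  qed
qed

lemma carrier_fps2_quot_eq_span:
  "carrier (fps2_quot I) = (\<lambda>w. I +>\<^bsub>ring_of_type_algebra\<^esub> w) ` fps2.span B \<longleftrightarrow>
     (\<forall>w. \<exists>b\<in>fps2.span B. w - b \<in> I)"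
proof -
  have "carrier (fps2_quot I) = (\<lambda>w. I +>\<^bsub>ring_of_type_algebra\<^esub> w) ` fps2.span B \<longleftrightarrow>
      (\<forall>w. (I +>\<^bsub>ring_of_type_algebra\<^esub> w) \<in> (\<lambda>w. I +>\<^bsub>ring_of_type_algebra\<^esub> w) ` fps2.span B)"
    unfolding quot_type_algebra(1)[OF I] by blast
  then show ?thesis by (simp add: image_iff coset_type_algebra[OF I])
qed

text \<open>\<open>ring.dim\<close> is a definite description, so the dimension must be shown to be
  unique as well; this follows by comparing two bases modulo \<open>I\<close> in both
  directions.\<close>

lemma fps2_codim_eq_card:
  assumes B: "finite B" "fps2.independent B" "fps2.span B \<inter> I \<subseteq> {0}"
    and span: "\<And>w. \<exists>b\<in>fps2.span B. w - b \<in> I"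
  shows "fps2_codim I = enat (card B)"
proof -
  interpret Q: ring "fps2_quot I" by (rule ring_fps2_quot[OF I])
  have dim: "Q.dimension (card B) (fps2_quot_scalars I) (carrier (fps2_quot I))"
    using basis_mod_imp_dimension[OF B] carrier_fps2_quot_eq_span[of B] span by simp
  have "n = card B" if n: "Q.dimension n (fps2_quot_scalars I) (carrier (fps2_quot I))" for n
  proof -
    obtain B' where B': "finite B'" "card B' = n" "fps2.independent B'" "fps2.span B' \<inter> I \<subseteq> {0}"
      "\<And>w. \<exists>b\<in>fps2.span B'. w - b \<in> I"
      using dimension_imp_basis_mod[OF n] unfolding carrier_fps2_quot_eq_span by blast
    show ?thesis
      using fps2.independent_mod_card_le[OF B(1) span fps2_ideal_subspace B'(3,4)]
        fps2.independent_mod_card_le[OF B'(1,5) fps2_ideal_subspace B(2,3)] B'(2) by simp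
  qed
  with dim have "Q.dim (fps2_quot_scalars I) (carrier (fps2_quot I)) = card B"
    unfolding Q.dim_def by (rule the_equality)
  then show ?thesis
    using dim by (auto simp: fps2_codim_def Q.finite_dimension_def)
qed

lemma fps2_codim_eq_enat:
  assumes "fps2_codim I = enat n"
  obtains B where "finite B" "card B = n" "\<And>w. \<exists>b\<in>fps2.span B. w - b \<in> I"
proof -
  interpret Q: ring "fps2_quot I" by (rule ring_fps2_quot[OF I])
  obtain m where m: "Q.dimension m (fps2_quot_scalars I) (carrier (fps2_quot I))"
    using assms by (auto simp: fps2_codim_def Q.finite_dimension_def split: if_splits)
  obtain B' where B': "finite B'" "card B' = m" "fps2.independent B'" "fps2.span B' \<inter> I \<subseteq> {0}"
    "\<And>w. \<exists>b\<in>fps2.span B'. w - b \<in> I"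
    using dimension_imp_basis_mod[OF m] unfolding carrier_fps2_quot_eq_span by blast
  then have "fps2_codim I = enat m" using fps2_codim_eq_card[of B'] by simp
  then have "card B' = n" using assms B'(2) by simp
  then show ?thesis using that B' by blast
qed

end

section \<open>Polynomials in one variable\<close>

text \<open>A nonzero element of least degree in the ideal of \<open>G\<close> and \<open>H\<close>
  divides both, by division with remainder. A root of it would be a common root, so over an
  algebraically closed field it is constant.\<close>

lemma no_common_root_bezout:
  fixes G H :: "'a::alg_closed_field poly"
  assumes "\<And>x. poly G x \<noteq> 0 \<or> poly H x \<noteq> 0"
  shows "\<exists>a b. a * G + b * H = 1"
proof -
  define J where "J = {D. D \<noteq> 0 \<and> (\<exists>a b. D = a * G + b * H)}"
  have "G \<in> J \<or> H \<in> J"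
  proof (cases "G = 0")
    case True
    then have "H \<noteq> 0" using assms[of 0] by auto
    moreover have "H = 0 * G + 1 * H" by simp
    ultimately show ?thesis unfolding J_def by blast
  next
    case False
    have "G = 1 * G + 0 * H" by simp
    then show ?thesis using False unfolding J_def by blast
  qed
  then have "J \<noteq> {}" by blast
  then obtain D where D: "D \<in> J" "\<And>E. E \<in> J \<Longrightarrow> Polynomial.degree D \<le> Polynomial.degree E"
    using exists_least_iff[of "\<lambda>n. \<exists>D\<in>J. Polynomial.degree D = n"] by (metis ex_in_conv linorder_not_less)
  obtain a b where ab: "D = a * G + b * H" and D0: "D \<noteq> 0" using D(1) by (auto simp: J_def)
  have dvd: "D dvd P" if P: "P = c * G + d * H" for P c d
  proof (rule ccontr)
    assume "\<not> D dvd P"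
    then have "P mod D \<noteq> 0" by (simp add: mod_eq_0_iff_dvd)
    moreover have "P mod D = (c - (P div D) * a) * G + (d - (P div D) * b) * H"
      using P ab by (simp add: algebra_simps flip: minus_div_mult_eq_mod)
    ultimately have "P mod D \<in> J" unfolding J_def by blast
    from D(2)[OF this] \<open>P mod D \<noteq> 0\<close> D0 show False
      using degree_mod_less[of D P] by auto
  qed
  have "D dvd G" using dvd[of G 1 0] by simp
  moreover have "D dvd H" using dvd[of H 0 1] by simp
  ultimately have "poly D x \<noteq> 0" for x
    using assms[of x] by (auto elim!: dvdE)
  then have "Polynomial.degree D = 0"
    using alg_closed_imp_poly_has_root[of D] by auto
  then obtain c where c: "D = [:c:]" by (rule degree_eq_zeroE)
  with D0 have "c \<noteq> 0" by auto
  have "([:inverse c:] * a) * G + ([:inverse c:] * b) * H = [:inverse c:] * D"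
    unfolding ab by (simp only: distrib_left mult.assoc)
  also have "\<dots> = 1" using \<open>c \<noteq> 0\<close> by (simp add: c one_pCons)
  finally show ?thesis by blast
qed

lemma poly_mult_coeff_top:
  fixes A B :: "'a::comm_semiring_0 poly"
  assumes "\<And>i. i > m \<Longrightarrow> poly.coeff A i = 0" "\<And>i. i > n \<Longrightarrow> poly.coeff B i = 0" "k > m + n"
  shows "poly.coeff (A * B) k = 0"
  unfolding coeff_mult
proof (rule sum.neutral, intro ballI)
  fix i assume "i \<in> {..k}"
  show "poly.coeff A i * poly.coeff B (k - i) = 0"
    using assms(1)[of i] assms(2)[of "k - i"] assms(3) by (cases "i > m") auto
qed

lemma degree_le_coeff: "(\<And>i. i \<ge> n \<Longrightarrow> poly.coeff p i = 0) \<Longrightarrow> p = 0 \<or> Polynomial.degree p < n"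
  by (metis leading_coeff_0_iff not_le_imp_less)

text \<open>\<open>U\<close> is made small by reduction modulo \<open>H\<close>; the degree of
  \<open>V\<close> is then forced by \<open>V * H = W - U * G\<close>. The bound on \<open>e\<close>
  keeps \<open>U * G\<close> in degrees below \<open>m + d\<close>.\<close>

lemma coprime_combination_bounded:
  fixes G H W a b :: "'a::field poly"
  assumes ab: "a * G + b * H = 1" and H: "Polynomial.degree H = d" "H \<noteq> 0"
    and W: "\<And>i. i \<ge> m + d \<Longrightarrow> poly.coeff W i = 0"
    and G: "\<And>i. i > e \<Longrightarrow> poly.coeff G i = 0" and e: "e < m + 1"
  shows "\<exists>U V. U * G + V * H = W \<and> (\<forall>i\<ge>d. poly.coeff U i = 0) \<and> (\<forall>i\<ge>m. poly.coeff V i = 0)"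
proof -
  define U where "U = (a * W) mod H"
  have "a * W - U = (a * W) div H * H" unfolding U_def by (simp add: minus_mod_eq_div_mult)
  moreover have "W - U * G = (b * W) * H + (a * W - U) * G"
    using arg_cong[OF ab, of "\<lambda>x. W * x"] by (simp add: algebra_simps)
  ultimately have "W - U * G = (b * W) * H + ((a * W) div H * H) * G"
    by (simp only:)
  then have "W - U * G = (b * W + (a * W) div H * G) * H"
    by (simp only: distrib_right distrib_left mult_ac)
  then obtain V where V: "W - U * G = V * H" by blast
  have U: "poly.coeff U i = 0" if "i \<ge> d" for i
    using degree_mod_less[of H "a * W"] H that unfolding U_def by (auto intro: coeff_eq_0)
  have "poly.coeff V i = 0" if i: "i \<ge> m" for i
  proof -
    have "poly.coeff (V * H) k = 0" if k: "k \<ge> m + d" for k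
    \<comment> \<open>For \<open>d = 0\<close> the bound \<open>d - 1\<close> used below would be
      truncated; in that case reduction modulo a nonzero constant has made \<open>U\<close>
      zero.\<close>
    proof (cases "d = 0")
      case True
      then have "U = 0" using U by (simp add: poly_eq_iff)
      then show ?thesis using V W k by (metis diff_zero mult_zero_left)
    next
      case False
      have "poly.coeff (U * G) k = 0"
        by (rule poly_mult_coeff_top[of "d - 1" _ e]) (use U G False k e in auto)
      then show ?thesis using W[OF k] by (simp flip: V)
    qed
    then have "V * H = 0 \<or> Polynomial.degree (V * H) < m + d" by (rule degree_le_coeff)
    then have "V = 0 \<or> Polynomial.degree V < m"
      using H degree_mult_eq[of V H] by (cases "V = 0") auto
    then show ?thesis using i by (auto intro: coeff_eq_0)
  qed
  moreover have "U * G + V * H = W" using V by (simp add: algebra_simps flip: V)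
  ultimately show ?thesis using U by blast
qed

lemma poly_eq_monom_mult_shift:
  assumes "\<And>i. i < c \<Longrightarrow> poly.coeff p i = 0"
  shows "p = Polynomial.monom 1 c * poly_shift c (p :: 'a::comm_semiring_1 poly)"
  by (rule poly_eqI) (use assms in \<open>auto simp: coeff_monom_mult coeff_poly_shift\<close>)

lemma supp_monom_mult:
  assumes "poly.coeff (Polynomial.monom 1 lo * U) i \<noteq> (0::'a::comm_semiring_1)" "\<And>i. i \<ge> n \<Longrightarrow> poly.coeff U i = 0"
  shows "lo \<le> i \<and> i < lo + n"
proof -
  have "lo \<le> i" "poly.coeff U (i - lo) \<noteq> 0"
    using assms(1) by (auto simp: coeff_monom_mult split: if_splits)
  then show ?thesis using assms(2)[of "i - lo"] by (cases "n \<le> i - lo") auto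
qed

text \<open>\<open>G\<close> and \<open>H\<close> stand for the leading forms of x f_x and y f_y on
  an edge, with x set to 1, and \<open>c0\<close>, \<open>c1\<close> for the y-coordinates of its
  end points. The conditions at \<open>c0\<close> and \<open>c1\<close> are nondegeneracy at the two
  vertices: after division by the power \<open>c0\<close> of the variable there is no common root at
  0 either, and one of the quotients has full degree \<open>c1 - c0\<close>.\<close>

locale edge_polys =
  fixes G H :: "'a::alg_closed_field poly" and c0 c1 :: nat
  assumes supp_G: "\<And>i. poly.coeff G i \<noteq> 0 \<Longrightarrow> c0 \<le> i \<and> i \<le> c1"
    and supp_H: "\<And>i. poly.coeff H i \<noteq> 0 \<Longrightarrow> c0 \<le> i \<and> i \<le> c1"
    and no_root: "\<And>x. x \<noteq> 0 \<Longrightarrow> poly G x \<noteq> 0 \<or> poly H x \<noteq> 0"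
    and lower: "poly.coeff G c0 \<noteq> 0 \<or> poly.coeff H c0 \<noteq> 0"
    and upper: "poly.coeff G c1 \<noteq> 0 \<or> poly.coeff H c1 \<noteq> 0"
begin

definition "G' = poly_shift c0 G"
definition "H' = poly_shift c0 H"
definition "d = c1 - c0"

lemma le: "c0 \<le> c1" using lower supp_G supp_H by blast

lemma shift: "G = Polynomial.monom 1 c0 * G'" "H = Polynomial.monom 1 c0 * H'"
  unfolding G'_def H'_def by (rule poly_eq_monom_mult_shift; use supp_G supp_H in force)+

lemma coeff_shift: "poly.coeff G' i = poly.coeff G (i + c0)" "poly.coeff H' i = poly.coeff H (i + c0)"
  unfolding G'_def H'_def by (simp_all add: coeff_poly_shift)

lemma coeff_zero: "i > d \<Longrightarrow> poly.coeff G' i = 0" "i > d \<Longrightarrow> poly.coeff H' i = 0"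
proof -
  assume "i > d"
  then have "\<not> i + c0 \<le> c1" by (simp add: d_def)
  then show "poly.coeff G' i = 0" "poly.coeff H' i = 0"
    using supp_G[of "i + c0"] supp_H[of "i + c0"] by (auto simp: coeff_shift)
qed

lemma coeff_d: "poly.coeff G' d = poly.coeff G c1" "poly.coeff H' d = poly.coeff H c1"
  using le by (simp_all add: coeff_shift d_def)

lemma bezout: "\<exists>a b. a * G' + b * H' = 1"
proof (rule no_common_root_bezout)
  fix x show "poly G' x \<noteq> 0 \<or> poly H' x \<noteq> 0"
  proof (cases "x = 0")
    case True
    then show ?thesis using lower coeff_shift[of 0] by (simp add: poly_0_coeff_0)
  next
    case False
    then show ?thesis using no_root[of x] shift by (metis mult_zero_right poly_mult)
  qed
qed

lemma degree_eq_d: "poly.coeff H' d \<noteq> 0 \<Longrightarrow> Polynomial.degree H' = d" "poly.coeff G' d \<noteq> 0 \<Longrightarrow> Polynomial.degree G' = d"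
  using coeff_zero by (metis degree_le le_antisym le_degree)+

lemma monom_add: "Polynomial.monom (1::'a) (i + j) = Polynomial.monom 1 i * Polynomial.monom 1 j"
  by (simp add: mult_monom)

lemma combine:
  "(Polynomial.monom 1 lo * U') * G + (Polynomial.monom 1 lo * V') * H =
     Polynomial.monom 1 (lo + c0) * (U' * G' + V' * H')"
proof -
  define g h where "g = G'" and "h = H'"
  have gh: "G = Polynomial.monom 1 c0 * g" "H = Polynomial.monom 1 c0 * h"
    unfolding g_def h_def by (rule shift)+
  show ?thesis
    unfolding g_def[symmetric] h_def[symmetric] monom_add unfolding gh
    by (simp only: distrib_left mult_ac)
qed

text \<open>Coprimality gives \<open>H' dvd U'\<close> and \<open>G' dvd V'\<close>. Both
  \<open>U'\<close> and \<open>V'\<close> have degree less than \<open>d\<close> unless they vanish,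
  and one of the divisors has degree \<open>d\<close>; so one of the two is zero, and the relation
  then kills the other.\<close>

lemma injective:
  assumes UV: "U * G + V * H = 0"
    and U: "\<And>i. poly.coeff U i \<noteq> 0 \<Longrightarrow> lo \<le> i \<and> i < lo + (c1 - c0)"
    and V: "\<And>i. poly.coeff V i \<noteq> 0 \<Longrightarrow> lo \<le> i \<and> i < lo + (c1 - c0)"
  shows "U = 0 \<and> V = 0"
proof -
  define U' where "U' = poly_shift lo U"
  define V' where "V' = poly_shift lo V"
  have UV': "U = Polynomial.monom 1 lo * U'" "V = Polynomial.monom 1 lo * V'"
    unfolding U'_def V'_def by (rule poly_eq_monom_mult_shift; use U V in force)+
  have "Polynomial.monom 1 (lo + c0) * (U' * G' + V' * H') = 0"
    using UV combine[of lo U' V'] UV' by simp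
  then have eq: "U' * G' + V' * H' = 0" by simp
  have lt: "U' = 0 \<or> Polynomial.degree U' < d" "V' = 0 \<or> Polynomial.degree V' < d"
    by (rule degree_le_coeff; use U V in \<open>force simp: U'_def V'_def coeff_poly_shift d_def\<close>)+
  obtain a b where ab: "a * G' + b * H' = 1" using bezout by blast
  have "H' dvd U'" 
  proof -
    have "U' = U' * (a * G' + b * H')" using ab by simp
    also have "\<dots> = a * (U' * G' + V' * H') + H' * (b * U' - a * V')" by (simp add: algebra_simps)
    also have "\<dots> = H' * (b * U' - a * V')" using eq by simp
    finally show ?thesis by (metis dvd_triv_left)
  qed
  moreover have "G' dvd V'" 
  proof -
    have "V' = V' * (a * G' + b * H')" using ab by simp
    also have "\<dots> = b * (U' * G' + V' * H') + G' * (a * V' - b * U')" by (simp add: algebra_simps)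
    also have "\<dots> = G' * (a * V' - b * U')" using eq by simp
    finally show ?thesis by (metis dvd_triv_left)
  qed
  moreover have "Polynomial.degree H' = d \<and> H' \<noteq> 0 \<or> Polynomial.degree G' = d \<and> G' \<noteq> 0"
    using upper degree_eq_d coeff_d by (metis coeff_0)
  ultimately have "U' = 0 \<and> H' \<noteq> 0 \<or> V' = 0 \<and> G' \<noteq> 0"
    using lt by (metis dvd_imp_degree_le leD)
  then have "U' = 0 \<and> V' = 0" using eq by auto
  then show ?thesis by (simp add: UV')
qed

lemma unshift:
  assumes "U' * G' + V' * H' = Polynomial.monom 1 (r - (lo + c0))" "lo + c0 \<le> r"
  shows "(Polynomial.monom 1 lo * U') * G + (Polynomial.monom 1 lo * V') * H = Polynomial.monom 1 r"
proof -
  show ?thesis unfolding combine using assms by (simp add: mult_monom)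
qed

text \<open>The missing top coefficient of \<open>G\<close> forces \<open>H\<close> to carry the top
  degree and bounds the degree of \<open>G'\<close> by \<open>d - 1\<close>. This allows an interval
  for \<open>V\<close> that is guaranteed to hold only \<open>d - 1\<close> exponents.\<close>

lemma surjective_open:
  assumes G: "poly.coeff G c1 = 0" and lo: "lo + (c1 - c0) \<le> hi' + 1" "lo + (c1 - c0) \<le> hi + 1"
    and r: "lo + c0 \<le> r" "r < hi' + c1" and c: "c0 < c1"
  shows "\<exists>U V. U * G + V * H = Polynomial.monom 1 r \<and>
     (\<forall>i. poly.coeff U i \<noteq> 0 \<longrightarrow> lo \<le> i \<and> i \<le> hi) \<and> (\<forall>i. poly.coeff V i \<noteq> 0 \<longrightarrow> lo \<le> i \<and> i < hi')"
proof -
  have "H' \<noteq> 0" "Polynomial.degree H' = d" using upper G degree_eq_d coeff_d by (metis coeff_0)+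
  obtain a b where ab: "a * G' + b * H' = 1" using bezout by blast
  have "\<exists>U V. U * G' + V * H' = Polynomial.monom 1 (r - (lo + c0)) \<and>
     (\<forall>i\<ge>d. poly.coeff U i = 0) \<and> (\<forall>i\<ge>hi' - lo. poly.coeff V i = 0)"
  proof (rule coprime_combination_bounded[OF ab \<open>Polynomial.degree H' = d\<close> \<open>H' \<noteq> 0\<close>])
    fix i assume "i \<ge> hi' - lo + d"
    then show "poly.coeff (Polynomial.monom (1::'a) (r - (lo + c0))) i = 0"
      using r lo c by (auto simp: d_def)
  next
    fix i assume "i > d - 1"
    then show "poly.coeff G' i = 0"
      using coeff_zero(1)[of i] coeff_d(1) G by (cases "i = d") auto
  next
    show "d - 1 < hi' - lo + 1" using lo c by (auto simp: d_def)
  qed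
  then obtain U V where UV: "U * G' + V * H' = Polynomial.monom 1 (r - (lo + c0))"
    "\<And>i. i \<ge> d \<Longrightarrow> poly.coeff U i = 0" "\<And>i. i \<ge> hi' - lo \<Longrightarrow> poly.coeff V i = 0" by blast
  show ?thesis
  proof (intro exI conjI allI impI)
    show "(Polynomial.monom 1 lo * U) * G + (Polynomial.monom 1 lo * V) * H = Polynomial.monom 1 r"
      by (rule unshift[OF UV(1) r(1)])
    fix i
    show "lo \<le> i" "i \<le> hi" if "poly.coeff (Polynomial.monom 1 lo * U) i \<noteq> 0"
      using supp_monom_mult[where n = d, OF that UV(2)] lo by (auto simp: d_def)
    show "lo \<le> i" "i < hi'" if "poly.coeff (Polynomial.monom 1 lo * V) i \<noteq> 0"
      using supp_monom_mult[where n = "hi' - lo", OF that UV(3)] lo by auto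
  qed
qed

text \<open>The two leading forms are on an equal footing: whichever has full degree serves as the
  modulus in \<open>coprime_combination_bounded\<close>.\<close>

lemma surjective_closed:
  assumes lo: "lo + (c1 - c0) \<le> hi + 1" and r: "lo + c0 \<le> r" "r \<le> hi + c1" and c: "c0 < c1"
  shows "\<exists>U V. U * G + V * H = Polynomial.monom 1 r \<and>
     (\<forall>i. poly.coeff U i \<noteq> 0 \<longrightarrow> lo \<le> i \<and> i \<le> hi) \<and> (\<forall>i. poly.coeff V i \<noteq> 0 \<longrightarrow> lo \<le> i \<and> i \<le> hi)"
proof -
  obtain a b where ab: "a * G' + b * H' = 1" using bezout by blast
  then have ba: "b * H' + a * G' = 1" by (simp add: add.commute)
  define n where "n = hi + 1 - lo"
  have n: "d \<le> n" "n + lo = hi + 1" using lo c by (auto simp: n_def d_def)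
  have dn: "d < n + 1" using n by simp
  have W: "poly.coeff (Polynomial.monom (1::'a) (r - (lo + c0))) i = 0" if "i \<ge> n + d" for i
    using that r n c by (auto simp: d_def)
  have "\<exists>U V. U * G' + V * H' = Polynomial.monom 1 (r - (lo + c0)) \<and>
     (\<forall>i\<ge>n. poly.coeff U i = 0) \<and> (\<forall>i\<ge>n. poly.coeff V i = 0)"
  proof (cases "poly.coeff H c1 = 0")
    case False
    then have "H' \<noteq> 0" "Polynomial.degree H' = d" using degree_eq_d coeff_d by (metis coeff_0)+
    from coprime_combination_bounded[OF ab this(2,1) W coeff_zero(1) dn] n(1)
    obtain U V where "U * G' + V * H' = Polynomial.monom 1 (r - (lo + c0))"
      "\<forall>i\<ge>d. poly.coeff U i = 0" "\<forall>i\<ge>n. poly.coeff V i = 0" by blast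
    then show ?thesis using n(1) by (intro exI[of _ U] exI[of _ V]) auto
  next
    case True
    then have "G' \<noteq> 0" "Polynomial.degree G' = d" using upper degree_eq_d coeff_d by (metis coeff_0)+
    from coprime_combination_bounded[OF ba this(2,1) W coeff_zero(2) dn] n(1)
    obtain V U where "V * H' + U * G' = Polynomial.monom 1 (r - (lo + c0))"
      "\<forall>i\<ge>d. poly.coeff V i = 0" "\<forall>i\<ge>n. poly.coeff U i = 0" by blast
    then show ?thesis using n(1) by (intro exI[of _ U] exI[of _ V]) (auto simp: add.commute)
  qed
  then obtain U V where UV: "U * G' + V * H' = Polynomial.monom 1 (r - (lo + c0))"
    "\<And>i. i \<ge> n \<Longrightarrow> poly.coeff U i = 0" "\<And>i. i \<ge> n \<Longrightarrow> poly.coeff V i = 0" by blast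
  show ?thesis
  proof (intro exI conjI allI impI)
    show "(Polynomial.monom 1 lo * U) * G + (Polynomial.monom 1 lo * V) * H = Polynomial.monom 1 r"
      by (rule unshift[OF UV(1) r(1)])
    fix i
    show "lo \<le> i" "i \<le> hi" if "poly.coeff (Polynomial.monom 1 lo * U) i \<noteq> 0"
      using supp_monom_mult[where n = n, OF that UV(2)] n by auto
    show "lo \<le> i" "i \<le> hi" if "poly.coeff (Polynomial.monom 1 lo * V) i \<noteq> 0"
      using supp_monom_mult[where n = n, OF that UV(3)] n by auto
  qed
qed

end

section \<open>Ideals with two generators and their perturbation\<close>

lemma ideal_fps2_ideal: "ideal (fps2_ideal A) (ring_of_type_algebra :: 'a::comm_ring_1 fps fps ring)"
proof -
  interpret ring "ring_of_type_algebra :: 'a fps fps ring" by (rule ring_from_type_algebra)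
  show ?thesis unfolding fps2_ideal_def
    by (rule genideal_ideal) (simp add: ring_of_type_algebra_def)
qed

lemma fps2_ideal_generators: "A \<subseteq> fps2_ideal (A :: 'a::comm_ring_1 fps fps set)"
proof -
  interpret ring "ring_of_type_algebra :: 'a fps fps ring" by (rule ring_from_type_algebra)
  show ?thesis unfolding fps2_ideal_def
    by (rule genideal_self) (simp add: ring_of_type_algebra_def)
qed

lemma fps2_ideal_minimal:
  assumes "ideal J (ring_of_type_algebra :: 'a::comm_ring_1 fps fps ring)" "A \<subseteq> J"
  shows "fps2_ideal A \<subseteq> J"
proof -
  interpret ring "ring_of_type_algebra :: 'a fps fps ring" by (rule ring_from_type_algebra)
  show ?thesis unfolding fps2_ideal_def
    by (rule genideal_minimal) fact+
qed

lemma fps2_ideal_pair: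
  fixes p q :: "'a::comm_ring_1 fps fps"
  shows "fps2_ideal {p, q} = {u * p + v * q | u v. True}"
proof
  let ?R = "ring_of_type_algebra :: 'a fps fps ring"
  let ?J = "{u * p + v * q | u v. True}"
  note I = ideal_fps2_ideal[of "{p, q}"]
  interpret ring ?R by (rule ring_from_type_algebra)
  have inv: "\<ominus>\<^bsub>?R\<^esub> x = - x" for x
    by (rule add.inv_equality) (auto simp: ring_of_type_algebra_def)
  have "ideal ?J ?R"
  proof (rule idealI[OF ring_axioms])
    show "subgroup ?J (add_monoid ?R)"
    proof (rule add.subgroupI)
      show "?J \<subseteq> carrier ?R" by (simp add: ring_of_type_algebra_def)
      show "?J \<noteq> {}" by blast
      fix a b assume "a \<in> ?J" "b \<in> ?J"
      then obtain u v u' v' where *: "a = u * p + v * q" "b = u' * p + v' * q" by blast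
      have "a + b = (u + u') * p + (v + v') * q" "- a = (- u) * p + (- v) * q"
        unfolding * by (simp_all add: algebra_simps)
      then have "a + b \<in> ?J" "- a \<in> ?J" by blast+
      then show "a \<oplus>\<^bsub>?R\<^esub> b \<in> ?J" "\<ominus>\<^bsub>?R\<^esub> a \<in> ?J"
        unfolding inv by (simp_all add: ring_of_type_algebra_def)
    qed
    fix a x assume "a \<in> ?J"
    then obtain u v where *: "a = u * p + v * q" by blast
    have "x * a = (x * u) * p + (x * v) * q" "a * x = (x * u) * p + (x * v) * q"
      unfolding * by (simp_all add: algebra_simps)
    then have "x * a \<in> ?J" "a * x \<in> ?J" by blast+
    then show "x \<otimes>\<^bsub>?R\<^esub> a \<in> ?J" "a \<otimes>\<^bsub>?R\<^esub> x \<in> ?J"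
      by (simp_all add: ring_of_type_algebra_def)
  qed
  moreover have "p = 1 * p + 0 * q" "q = 0 * p + 1 * q" by simp_all
  then have "{p, q} \<subseteq> ?J" by blast
  ultimately show "fps2_ideal {p, q} \<subseteq> ?J" by (rule fps2_ideal_minimal)
  have "p \<in> fps2_ideal {p, q}" "q \<in> fps2_ideal {p, q}"
    using fps2_ideal_generators[of "{p, q}"] by auto
  then show "?J \<subseteq> fps2_ideal {p, q}"
    using ideal_type_algebra(2,3)[OF I] by blast
qed

lemma fps2_coeff_mult_0: "fps2_coeff (f * g :: 'a::comm_ring_1 fps fps) (0, 0) =
   fps2_coeff f (0, 0) * fps2_coeff g (0, 0)"
  by (simp add: fps2_coeff_def)

lemma fps2_coeff_1: "fps2_coeff (1 :: 'a::comm_ring_1 fps fps) z = (if z = (0, 0) then 1 else 0)"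
  by (auto simp: fps2_coeff_def prod_eq_iff)

lemma fps2_unit:
  assumes "fps2_coeff (w :: 'a::field fps fps) (0, 0) \<noteq> 0"
  obtains w' where "w' * w = 1"
proof -
  have "inverse (w $ 0) * w $ 0 = 1"
    using assms by (intro inverse_mult_eq_1) (simp add: fps2_coeff_def)
  then show ?thesis using fps_left_inverse[of "inverse (w $ 0)" w] that by blast
qed

text \<open>As \<open>z\<close> lies in the maximal ideal, a combination with nonzero constant term
  is a unit; otherwise a factor \<open>z\<close> splits off and \<open>n\<close> drops.\<close>

lemma fps2_power_dvd_span:
  fixes z :: "'a::field fps fps"
  assumes z: "fps2_coeff z (0, 0) = 0"
  shows "w \<in> fps2.span ((\<lambda>i. z ^ i) ` {..n}) \<Longrightarrow> w \<noteq> 0 \<Longrightarrow> w dvd z ^ n"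
proof (induction n arbitrary: w)
  case 0
  then obtain c where "w = fps2_const c" by (auto simp: fps2.span_insert fps2.span_empty)
  moreover have "c \<noteq> 0" using calculation 0 by (auto simp: fps2_const_hom)
  ultimately have "w * fps2_const (inverse c) = 1"
    by (simp flip: fps2_const_hom)
  then show ?case by (metis dvd_triv_left power_0)
next
  case (Suc n)
  have "(\<lambda>i. z ^ i) ` {..Suc n} = insert 1 ((*) z ` ((\<lambda>i. z ^ i) ` {..n}))"
    by (simp add: atMost_Suc_eq_insert_0 image_image)
  then obtain c where c: "w - fps2_const c \<in> fps2.span ((*) z ` ((\<lambda>i. z ^ i) ` {..n}))"
    using Suc.prems(1) by (auto simp: fps2.span_insert)
  have "\<exists>v\<in>fps2.span B. u = z * v" if "u \<in> fps2.span ((*) z ` B)" for u B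
    using that
  proof (induction rule: fps2.span_induct_alt)
    case base
    then show ?case using fps2.span_zero by force
  next
    case (step c x y)
    then obtain x' v where "x' \<in> B" "x = z * x'" "v \<in> fps2.span B" "y = z * v" by blast
    moreover have "fps2_const c * (z * x') + z * v = z * (fps2_const c * x' + v)"
      by (simp add: algebra_simps)
    ultimately show ?case
      by (intro bexI[of _ "fps2_const c * x' + v"] fps2.span_add fps2.span_scale) (auto intro: fps2.span_base)
  qed
  from this[OF c] obtain v where v: "v \<in> fps2.span ((\<lambda>i. z ^ i) ` {..n})"
    "w - fps2_const c = z * v" by blast
  then have w: "w = fps2_const c + z * v" by (simp add: algebra_simps)
  show ?case
  proof (cases "c = 0")
    case True
    then have "w = z * v" using w by (simp add: fps2_const_hom)
    moreover have "v dvd z ^ n" using Suc.IH[OF v(1)] calculation Suc.prems(2) by auto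
    ultimately show ?thesis by simp
  next
    case False
    have "fps2_coeff (fps2_const c) (0, 0) = c" by (simp add: fps2_const_def fps2_coeff_def)
    then have "fps2_coeff w (0, 0) \<noteq> 0" using False by (simp add: w fps2_coeff_mult_0 z)
    then obtain w' where "w' * w = 1" by (rule fps2_unit)
    then have "w dvd 1" by (metis dvd_triv_right)
    then show ?thesis by (meson dvd_trans one_dvd)
  qed
qed

lemma span_monom_coeff:
  assumes "w \<in> fps2.span (fps2_monom ` A :: 'a::field fps fps set)" "z \<notin> A"
  shows "fps2_coeff w z = 0"
  using assms(1)
proof (induction rule: fps2.span_induct_alt)
  case (step c x y)
  then obtain a where "a \<in> A" "x = fps2_monom a" by blast
  then have "fps2_coeff x z = 0" using assms(2) by (auto simp: fps2_coeff_monom)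
  then show ?case using step by simp
qed simp

lemma independent_monom: "fps2.independent (fps2_monom ` A :: 'a::field fps fps set)"
proof
  assume "fps2.dependent (fps2_monom ` A :: 'a fps fps set)"
  then obtain a where a: "a \<in> A" "fps2_monom a \<in> fps2.span (fps2_monom ` A - {fps2_monom a :: 'a fps fps})"
    by (auto simp: fps2.dependent_def)
  have "fps2_monom ` A - {fps2_monom a} \<subseteq> fps2_monom ` (A - {a})" by auto
  then have "fps2_monom a \<in> fps2.span (fps2_monom ` (A - {a}) :: 'a fps fps set)"
    using a(2) fps2.span_mono by blast
  then have "fps2_coeff (fps2_monom a :: 'a fps fps) a = 0" by (rule span_monom_coeff) simp
  then show False by (simp add: fps2_coeff_monom)
qed

lemma inj_monom: "inj (fps2_monom :: _ \<Rightarrow> 'a::field fps fps)"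
  by (rule injI) (metis fps2_coeff_monom zero_neq_one)

lemma fps2_monom_power: "fps2_monom (a, b) ^ n = (fps2_monom (n * a, n * b) :: 'a::comm_ring_1 fps fps)"
proof (induction n)
  case 0
  show ?case by (rule fps2_eqI) (simp add: fps2_coeff_1 fps2_coeff_monom)
qed (simp add: fps2_monom_mult)

text \<open>In a quotient of dimension \<open>n\<close> the powers \<open>1, z, \<dots>, z^n\<close> are dependent, and a relation
  between them is a unit times the lowest power of \<open>z\<close> occurring in it.\<close>

lemma power_mem_ideal_of_codim:
  fixes I :: "'a::field fps fps set"
  assumes I: "ideal I ring_of_type_algebra" and n: "fps2_codim I = enat n"
    and ab: "(a, b) \<noteq> (0, 0)"
  shows "fps2_monom (a, b) ^ n \<in> I"
proof -
  let ?z = "fps2_monom (a, b) :: 'a fps fps"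
  obtain B where B: "finite B" "card B = n" "\<And>w. \<exists>b\<in>fps2.span B. w - b \<in> I"
    using fps2_codim_eq_enat[OF I n] by metis
  have Z: "(\<lambda>i. ?z ^ i) ` {..n} = fps2_monom ` ((\<lambda>i. (i * a, i * b)) ` {..n})"
    by (auto simp: fps2_monom_power)
  have "card ((\<lambda>i. ?z ^ i) ` {..n}) = Suc n"
    unfolding Z image_image using ab
    by (subst card_image) (auto simp: inj_on_def dest: injD[OF inj_monom])
  then have "\<not> fps2.span ((\<lambda>i. ?z ^ i) ` {..n}) \<inter> I \<subseteq> {0}"
    using fps2.independent_mod_card_le[OF B(1,3) fps2_ideal_subspace[OF I], of "(\<lambda>i. ?z ^ i) ` {..n}"]
      independent_monom B(2) unfolding Z by auto
  then obtain w where "w \<in> fps2.span ((\<lambda>i. ?z ^ i) ` {..n})" "w \<in> I" "w \<noteq> 0" by blast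
  moreover have "fps2_coeff ?z (0, 0) = 0" using ab by (simp add: fps2_coeff_monom)
  ultimately have "w dvd ?z ^ n" using fps2_power_dvd_span by blast
  then show ?thesis
    using ideal_type_algebra(3)[OF I \<open>w \<in> I\<close>] by (auto elim!: dvdE simp: mult.commute)
qed

text \<open>A Nakayama argument. The \<open>n\<close>-th power of the monomial lies in the perturbed
  ideal and \<open>k > n\<close>, so the two second generators differ by an element of that ideal
  with coefficients in the maximal ideal, and \<open>1 - s * v\<close> is a unit. The codimension is
  assumed for the perturbed ideal, since in the application that is the one coming from a convenient
  series.\<close>

lemma fps2_ideal_perturb:
  fixes p q :: "'a::field fps fps"
  assumes n: "fps2_codim (fps2_ideal {p, q + c * fps2_monom (a, b) ^ k}) = enat n" and k: "n < k"
    and ab: "(a, b) \<noteq> (0, 0)"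
  shows "fps2_ideal {p, q} = fps2_ideal {p, q + c * fps2_monom (a, b) ^ k}"
proof -
  define z where "z = (fps2_monom (a, b) :: 'a fps fps)"
  define Q where "Q = q + c * z ^ k"
  have cod: "fps2_codim (fps2_ideal {p, Q}) = enat n" using n by (simp add: Q_def z_def)
  note J = ideal_fps2_ideal[of "{p, Q}"] and J' = ideal_fps2_ideal[of "{p, q}"]
  have "z ^ n \<in> fps2_ideal {p, Q}"
    unfolding z_def by (rule power_mem_ideal_of_codim[OF J cod ab])
  then obtain u v where uv: "z ^ n = u * p + v * Q" unfolding fps2_ideal_pair by blast
  define s where "s = c * z ^ (k - n)"
  have "c * z ^ k = s * z ^ n" using k by (simp add: s_def mult.assoc flip: power_add)
  then have "Q - q = s * (u * p + v * Q)" unfolding uv by (simp add: Q_def)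
  then have sq: "(1 - s * v) * Q = s * u * p + q" by (simp add: algebra_simps)
  have "fps2_coeff z (0, 0) = 0" using ab by (simp add: fps2_coeff_monom z_def)
  then have "fps2_coeff s (0, 0) = 0" using k unfolding s_def
    by (cases "k - n") (auto simp: fps2_coeff_mult_0)
  then have "fps2_coeff (1 - s * v) (0, 0) \<noteq> 0" by (simp add: fps2_coeff_mult_0 fps2_coeff_1)
  then obtain t where t: "t * (1 - s * v) = 1" by (rule fps2_unit)
  have "t * (1 - s * v) * Q = t * s * u * p + t * q"
    by (simp only: sq mult.assoc distrib_left)
  then have "Q = t * s * u * p + t * q" unfolding t by simp
  then have 1: "Q \<in> fps2_ideal {p, q}" unfolding fps2_ideal_pair by blast
  have "q = (- s * u) * p + (1 - s * v) * Q" unfolding sq by (simp add: algebra_simps)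
  then have 2: "q \<in> fps2_ideal {p, Q}" unfolding fps2_ideal_pair by blast
  have "p \<in> fps2_ideal {p, q}" "p \<in> fps2_ideal {p, Q}"
    using fps2_ideal_generators by blast+
  with 1 2 have "fps2_ideal {p, q} = fps2_ideal {p, Q}"
    using fps2_ideal_minimal[OF J, of "{p, q}"] fps2_ideal_minimal[OF J', of "{p, Q}"] by blast
  then show ?thesis by (simp add: Q_def z_def)
qed

section \<open>Successive approximation\<close>

text \<open>Monomials are removed level by level of \<open>\<Phi>\<close>, each at the cost of terms
  of higher level. The bound \<open>\<Phi> z \<le> B a\<close> says that the multipliers change at
  \<open>a\<close> only at levels up to \<open>B a\<close>, so their infinite sums make sense
  coefficientwise, without any topology.\<close>

lemma mem_fps2_ideal_by_approximation:
  fixes p q w :: "'a::field fps fps" and \<Phi> B :: "nat \<times> nat \<Rightarrow> nat"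
  assumes fin: "\<And>n. finite {z. R z \<and> \<Phi> z = n}"
    and step: "\<And>z. R z \<Longrightarrow> \<exists>u v. (\<forall>a. fps2_coeff u a \<noteq> 0 \<or> fps2_coeff v a \<noteq> 0 \<longrightarrow> \<Phi> z \<le> B a) \<and>
      (\<forall>a. fps2_coeff (fps2_monom z - (u * p + v * q)) a \<noteq> 0 \<longrightarrow> R a \<and> \<Phi> z < \<Phi> a)"
    and w: "\<And>z. fps2_coeff w z \<noteq> 0 \<Longrightarrow> R z"
  shows "w \<in> fps2_ideal {p, q}"
proof -
  obtain u0 v0 where uv0:
    "\<And>z a. R z \<Longrightarrow> fps2_coeff (u0 z) a \<noteq> 0 \<Longrightarrow> \<Phi> z \<le> B a"
    "\<And>z a. R z \<Longrightarrow> fps2_coeff (v0 z) a \<noteq> 0 \<Longrightarrow> \<Phi> z \<le> B a"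
    "\<And>z a. R z \<Longrightarrow> fps2_coeff (fps2_monom z - (u0 z * p + v0 z * q)) a \<noteq> 0 \<Longrightarrow> R a \<and> \<Phi> z < \<Phi> a"
    using step by metis
  define P where "P n w \<longleftrightarrow> (\<forall>z. fps2_coeff w z \<noteq> 0 \<longrightarrow> R z \<and> n \<le> \<Phi> z)" for n and w :: "'a fps fps"
  define F where "F n = {z. R z \<and> \<Phi> z = n}" for n
  \<comment> \<open>Multipliers that clear the whole level \<open>n\<close> of \<open>w\<close> at
    once; the level is finite by \<open>fin\<close>.\<close>
  define U where "U n w = (\<Sum>z\<in>F n. fps2_const (fps2_coeff w z) * u0 z)" for n w
  define V where "V n w = (\<Sum>z\<in>F n. fps2_const (fps2_coeff w z) * v0 z)" for n w
  define W where "W = rec_nat w (\<lambda>n w. w - (U n w * p + V n w * q))"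
  have W0: "W 0 = w" and WS: "W (Suc n) = W n - (U n (W n) * p + V n (W n) * q)" for n
    by (simp_all add: W_def)
  have UB: "fps2_coeff (U n w) a = 0" "fps2_coeff (V n w) a = 0" if "B a < n" for n w a
  proof -
    have "fps2_coeff (u0 z) a = 0" "fps2_coeff (v0 z) a = 0" if "z \<in> F n" for z
      using uv0(1,2)[of z a] that \<open>B a < n\<close> by (auto simp: F_def)
    then show "fps2_coeff (U n w) a = 0" "fps2_coeff (V n w) a = 0"
      by (simp_all add: U_def V_def)
  qed
  have PS: "P (Suc n) (w - (U n w * p + V n w * q))" if "P n w" for n w
  proof -
    define w1 where "w1 = w - (\<Sum>z\<in>F n. fps2_const (fps2_coeff w z) * fps2_monom z)"
    define w2 where "w2 = (\<Sum>z\<in>F n. fps2_const (fps2_coeff w z) * (fps2_monom z - (u0 z * p + v0 z * q)))"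
    have eq: "w - (U n w * p + V n w * q) = w1 + w2"
      unfolding w1_def w2_def U_def V_def sum_distrib_right
      by (simp add: algebra_simps sum.distrib sum_subtractf)
    have w1: "R a \<and> Suc n \<le> \<Phi> a" if "fps2_coeff w1 a \<noteq> 0" for a
    proof -
      have "finite (F n)" unfolding F_def by (rule fin)
      then have "(\<Sum>z\<in>F n. fps2_coeff w z * (if a = z then 1 else 0)) =
          (if a \<in> F n then fps2_coeff w a else 0)"
        by (simp add: if_distrib sum.delta cong: if_cong)
      then have "fps2_coeff w1 a = (if a \<in> F n then 0 else fps2_coeff w a)"
        by (simp add: w1_def fps2_coeff_monom)
      then have "a \<notin> F n" "fps2_coeff w a \<noteq> 0" using that by (auto split: if_splits)
      then have "R a" "n \<le> \<Phi> a" "\<Phi> a \<noteq> n" using \<open>P n w\<close> unfolding P_def F_def by blast+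
      then show ?thesis by simp
    qed
    have w2: "R a \<and> Suc n \<le> \<Phi> a" if "fps2_coeff w2 a \<noteq> 0" for a
    proof (rule ccontr)
      assume not: "\<not> ?thesis"
      have "fps2_coeff (fps2_const (fps2_coeff w z) * (fps2_monom z - (u0 z * p + v0 z * q))) a = 0"
        if "z \<in> F n" for z
        using uv0(3)[of z a] that not by (auto simp: F_def)
      then have "fps2_coeff w2 a = 0"
        unfolding w2_def fps2_coeff_sum by (intro sum.neutral) blast
      then show False using that by simp
    qed
    have "fps2_coeff w1 a \<noteq> 0 \<or> fps2_coeff w2 a \<noteq> 0" if "fps2_coeff (w1 + w2) a \<noteq> 0" for a
      using that by (auto simp del: fps2_coeff_diff)
    then show ?thesis unfolding P_def eq using w1 w2 by blast
  qed
  have PW: "P n (W n)" for n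
    by (induction n) (use w PS in \<open>auto simp: W0 WS P_def\<close>)
  define u where "u = Abs_fps2 (\<lambda>a. \<Sum>n\<le>B a. fps2_coeff (U n (W n)) a)"
  define v where "v = Abs_fps2 (\<lambda>a. \<Sum>n\<le>B a. fps2_coeff (V n (W n)) a)"
  have W: "W N = w - ((\<Sum>n<N. U n (W n)) * p + (\<Sum>n<N. V n (W n)) * q)" for N
    by (induction N) (simp_all add: W0 WS algebra_simps)
  have "fps2_coeff w z = fps2_coeff (u * p + v * q) z" for z
  proof -
    \<comment> \<open>At this stage the remainder has no coefficient at \<open>z\<close> any more,
      and all coefficients of the multipliers entering the products at \<open>z\<close> are
      final.\<close>
    define N where "N = Suc (Max (insert (\<Phi> z) (B ` fps2_below z)))"
    have BN: "B a < N" if "a \<in> fps2_below z" for a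
      unfolding N_def less_Suc_eq_le using that by (intro Max_ge) auto
    have "fps2_coeff u a = fps2_coeff (\<Sum>n<N. U n (W n)) a"
      "fps2_coeff v a = fps2_coeff (\<Sum>n<N. V n (W n)) a" if "a \<in> fps2_below z" for a
    proof -
      have "{..B a} \<subseteq> {..<N}" using BN[OF that] by auto
      moreover have "\<forall>n\<in>{..<N} - {..B a}. fps2_coeff (U n (W n)) a = 0"
        "\<forall>n\<in>{..<N} - {..B a}. fps2_coeff (V n (W n)) a = 0"
        using UB by (simp_all add: not_le)
      ultimately show "fps2_coeff u a = fps2_coeff (\<Sum>n<N. U n (W n)) a"
        "fps2_coeff v a = fps2_coeff (\<Sum>n<N. V n (W n)) a"
        unfolding u_def v_def fps2_coeff_Abs fps2_coeff_sum
        by (simp_all only: sum.mono_neutral_left finite_lessThan)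
    qed
    then have "fps2_coeff (u * p) z = fps2_coeff ((\<Sum>n<N. U n (W n)) * p) z"
      "fps2_coeff (v * q) z = fps2_coeff ((\<Sum>n<N. V n (W n)) * q) z"
      by (simp_all add: fps2_coeff_mult)
    moreover have "\<Phi> z < N" unfolding N_def less_Suc_eq_le by (intro Max_ge) auto
    then have "fps2_coeff (W N) z = 0" using PW[of N] unfolding P_def by (meson not_le)
    ultimately show ?thesis
      using arg_cong[OF W[of N], of "\<lambda>x. fps2_coeff x z"]
      by (simp del: fps2_coeff_sum)
  qed
  then have "w = u * p + v * q" by (rule fps2_eqI)
  then show ?thesis unfolding fps2_ideal_pair by blast
qed

section \<open>Parts of a series on a line\<close>

definition wt :: "nat \<Rightarrow> nat \<Rightarrow> nat \<times> nat \<Rightarrow> nat" where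
  "wt a b z = a * fst z + b * snd z"

lemma wt_add: "wt a b (z + z') = wt a b z + wt a b z'"
  by (simp add: wt_def algebra_simps)

lemma finite_wt_le: "0 < a \<Longrightarrow> 0 < b \<Longrightarrow> finite {z. wt a b z \<le> N}"
proof (rule finite_subset)
  assume "0 < a" "0 < b"
  then have "fst z \<le> wt a b z" "snd z \<le> wt a b z" for z
    unfolding wt_def by (simp_all add: trans_le_add1 trans_le_add2)
  then have "fst z \<le> N \<and> snd z \<le> N" if "wt a b z \<le> N" for z
    using that order_trans by blast
  then show "{z. wt a b z \<le> N} \<subseteq> {..N} \<times> {..N}"
    by (simp add: subset_iff mem_Times_iff)
qed simp

lemma finite_wt_eq: "0 < a \<Longrightarrow> 0 < b \<Longrightarrow> finite {z. wt a b z = N}"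
  by (rule finite_subset[OF _ finite_wt_le[of a b N]]) auto

lemma wt_eq_snd_inj: "0 < a \<Longrightarrow> wt a b z = wt a b z' \<Longrightarrow> snd z = snd z' \<Longrightarrow> z = z'"
  by (simp add: wt_def prod_eq_iff)

text \<open>On the line \<open>a i + b j = N\<close> a monomial is determined by its \<open>y\<close>-exponent, so nothing is lost
  by setting \<open>x = 1\<close>.\<close>

definition edge_poly :: "nat \<Rightarrow> nat \<Rightarrow> nat \<Rightarrow> 'a::comm_ring_1 fps fps \<Rightarrow> 'a poly" where
  "edge_poly a b N u = (\<Sum>z | wt a b z = N. Polynomial.monom (fps2_coeff u z) (snd z))"

context
  fixes a b :: nat
  assumes ab: "0 < a" "0 < b"
begin

lemma poly_edge_poly: "poly (edge_poly a b N u) x = (\<Sum>z | wt a b z = N. fps2_coeff u z * x ^ snd z)"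
  by (simp add: edge_poly_def poly_sum poly_monom)

lemma coeff_edge_poly:
  assumes "wt a b z = N"
  shows "poly.coeff (edge_poly a b N u) (snd z) = fps2_coeff u z"
proof -
  have "poly.coeff (edge_poly a b N u) (snd z) =
      (\<Sum>z' | wt a b z' = N. if z' = z then fps2_coeff u z else 0)"
    unfolding edge_poly_def coeff_sum coeff_monom
  proof (rule sum.cong[OF refl])
    fix z' assume "z' \<in> {z'. wt a b z' = N}"
    then have "snd z' = snd z \<longleftrightarrow> z' = z"
      using assms wt_eq_snd_inj[OF ab(1), of b z' z] by auto
    then show "(if snd z' = snd z then fps2_coeff u z' else 0) = (if z' = z then fps2_coeff u z else 0)"
      by auto
  qed
  then show ?thesis using assms finite_wt_eq[OF ab] by simp
qed

lemma coeff_edge_poly_nonzero: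
  assumes "poly.coeff (edge_poly a b N u) r \<noteq> 0"
  shows "\<exists>z. wt a b z = N \<and> snd z = r \<and> fps2_coeff u z \<noteq> 0"
proof (rule ccontr)
  assume no: "\<nexists>z. wt a b z = N \<and> snd z = r \<and> fps2_coeff u z \<noteq> 0"
  have "poly.coeff (edge_poly a b N u) r = 0"
    unfolding edge_poly_def coeff_sum coeff_monom by (rule sum.neutral) (use no in auto)
  then show False using assms by simp
qed

text \<open>The bounds on the supports leave only the parts of weight \<open>N\<close> and
  \<open>P\<close> to contribute in weight \<open>N + P\<close>, and there the convolution over
  lattice points becomes one over y-exponents.\<close>

lemma fps2_coeff_mult_eq_edge_poly:
  assumes z: "wt a b z = N + P"
    and u: "\<And>w. fps2_coeff u w \<noteq> 0 \<Longrightarrow> N \<le> wt a b w" and g: "\<And>w. fps2_coeff g w \<noteq> 0 \<Longrightarrow> P \<le> wt a b w"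
  shows "fps2_coeff (u * g) z = poly.coeff (edge_poly a b N u * edge_poly a b P g) (snd z)"
proof -
  define A where "A = {w \<in> fps2_below z. wt a b w = N}"
  have wt_minus: "wt a b w + wt a b (fps2_minus z w) = N + P" if "w \<in> fps2_below z" for w
    using that z wt_add[of a b w "fps2_minus z w"]
    by (auto simp: fps2_below_def fps2_minus_def mem_Times_iff wt_def simp flip: add_mult_distrib2 distrib_left)
  have "fps2_coeff (u * g) z = (\<Sum>w\<in>A. fps2_coeff u w * fps2_coeff g (fps2_minus z w))"
    unfolding fps2_coeff_mult
  proof (rule sum.mono_neutral_right)
    show "\<forall>i\<in>fps2_below z - A. fps2_coeff u i * fps2_coeff g (fps2_minus z i) = 0"
    proof
      fix i assume i: "i \<in> fps2_below z - A"
      then have "wt a b i \<noteq> N" by (auto simp: A_def)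
      then have "\<not> N \<le> wt a b i \<or> \<not> P \<le> wt a b (fps2_minus z i)"
        using wt_minus[of i] i by auto
      then show "fps2_coeff u i * fps2_coeff g (fps2_minus z i) = 0" using u[of i] g[of "fps2_minus z i"] by (metis mult_zero_left mult_zero_right)
    qed
  qed (auto simp: A_def)
  also have "\<dots> = (\<Sum>w\<in>A. poly.coeff (edge_poly a b N u) (snd w) * poly.coeff (edge_poly a b P g) (snd z - snd w))"
  proof (rule sum.cong[OF refl])
    fix w assume w: "w \<in> A"
    then have "wt a b (fps2_minus z w) = P" using wt_minus[of w] by (auto simp: A_def)
    from coeff_edge_poly[OF this, of g] coeff_edge_poly[of w N u] w
    show "fps2_coeff u w * fps2_coeff g (fps2_minus z w) = poly.coeff (edge_poly a b N u) (snd w) * poly.coeff (edge_poly a b P g) (snd z - snd w)"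
      by (simp add: A_def fps2_minus_def)
  qed
  also have "\<dots> = (\<Sum>r\<in>snd ` A. poly.coeff (edge_poly a b N u) r * poly.coeff (edge_poly a b P g) (snd z - r))"
  proof -
    have "inj_on snd A" by (rule inj_onI) (metis (mono_tags, lifting) A_def mem_Collect_eq wt_eq_snd_inj[OF ab(1)])
    then show ?thesis by (simp add: sum.reindex)
  qed
  also have "\<dots> = (\<Sum>r\<le>snd z. poly.coeff (edge_poly a b N u) r * poly.coeff (edge_poly a b P g) (snd z - r))"
  proof (rule sum.mono_neutral_left)
    show "snd ` A \<subseteq> {..snd z}" by (auto simp: A_def fps2_below_def)
    show "\<forall>r\<in>{..snd z} - snd ` A. poly.coeff (edge_poly a b N u) r * poly.coeff (edge_poly a b P g) (snd z - r) = 0"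
    proof (rule ballI, rule ccontr)
      fix r assume r: "r \<in> {..snd z} - snd ` A"
        and nz: "poly.coeff (edge_poly a b N u) r * poly.coeff (edge_poly a b P g) (snd z - r) \<noteq> 0"
      then have "poly.coeff (edge_poly a b N u) r \<noteq> 0" "poly.coeff (edge_poly a b P g) (snd z - r) \<noteq> 0" by auto
      then obtain v w where v: "wt a b v = N" "snd v = r" and w: "wt a b w = P" "snd w = snd z - r"
        using coeff_edge_poly_nonzero by metis
      have "v + w = z" using z v w r by (intro wt_eq_snd_inj[OF ab(1), of b]) (auto simp: wt_add)
      then have "v \<in> A" using v(1) by (auto simp: A_def fps2_below_def mem_Times_iff)
      then show False using r v(2) by blast
    qed
  qed simp
  finally show ?thesis by (simp add: coeff_mult)
qed

text \<open>A polynomial \<open>U\<close> need not come from the line of weight \<open>N\<close>: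
  exponents \<open>s\<close> for which \<open>a\<close> does not divide \<open>N - b * s\<close> are
  lost in the lift. They are invisible in the product at a lattice point \<open>z\<close>, since a
  nonzero partner coefficient of \<open>g\<close> at \<open>w\<close> gives
  \<open>N - b * s = a * (fst z - fst w)\<close>.\<close>

lemma coeff_edge_poly_Abs_mult:
  assumes z: "wt a b z = N + P" and U: "\<And>s. poly.coeff U s \<noteq> 0 \<Longrightarrow> b * s \<le> N"
  shows "poly.coeff (edge_poly a b N (Abs_fps2 (\<lambda>w. if wt a b w = N then poly.coeff U (snd w) else 0)) *
           edge_poly a b P g) (snd z) = poly.coeff (U * edge_poly a b P g) (snd z)"
    (is "poly.coeff (?U * ?G) _ = _")
  unfolding coeff_mult
proof (rule sum.cong[OF refl])
  fix s assume s: "s \<in> {..snd z}"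
  show "poly.coeff ?U s * poly.coeff ?G (snd z - s) = poly.coeff U s * poly.coeff ?G (snd z - s)"
  proof (cases "poly.coeff ?G (snd z - s) = 0 \<or> poly.coeff ?U s = poly.coeff U s")
    case False
    then obtain w where w: "wt a b w = P" "snd w = snd z - s"
      using coeff_edge_poly_nonzero by blast
    have U0: "poly.coeff U s \<noteq> 0"
    proof
      assume 0: "poly.coeff U s = 0"
      then have "poly.coeff ?U s \<noteq> 0" using False by simp
      then obtain v where "snd v = s" "fps2_coeff (Abs_fps2 (\<lambda>w. if wt a b w = N then poly.coeff U (snd w) else 0)) v \<noteq> 0"
        using coeff_edge_poly_nonzero by blast
      then show False using 0 by (auto split: if_splits)
    qed
    have eq: "a * fst z + b * s = N + a * fst w"
    proof -
      have "b * snd w + b * s = b * snd z" using s w(2) by (simp flip: distrib_left)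
      then show ?thesis using z w(1) unfolding wt_def by linarith
    qed
    then have "a * fst w \<le> a * fst z" using U[OF U0] by linarith
    then have le: "fst w \<le> fst z" using ab by simp
    then have "a * (fst z - fst w) + b * s = N" using eq by (simp add: diff_mult_distrib2)
    then have "wt a b (fst z - fst w, s) = N" by (simp add: wt_def)
    from coeff_edge_poly[OF this, of "Abs_fps2 (\<lambda>w. if wt a b w = N then poly.coeff U (snd w) else 0)"] this
    show ?thesis by simp
  qed auto
qed

end

section \<open>Newton fans\<close>

text \<open>The vertices \<open>(vx i, vy i)\<close> of a convenient Newton diagram, from the \<open>x\<close>-axis to the
  \<open>y\<close>-axis. The linear form of the \<open>i\<close>-th edge is scaled to take the same integral value \<open>P\<close> on
  all edges, so that the Newton filtration is the minimum \<open>M\<close> of the linear forms.\<close>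

locale newton_fan =
  fixes k :: nat and vx vy a b :: "nat \<Rightarrow> nat" and P :: nat
  assumes k_pos: "0 < k" and vy_0: "vy 0 = 0" and vx_k: "vx k = 0"
    and vx_dec: "\<And>i. i < k \<Longrightarrow> vx (Suc i) < vx i" and vy_inc: "\<And>i. i < k \<Longrightarrow> vy i < vy (Suc i)"
    and a_pos: "\<And>i. i < k \<Longrightarrow> 0 < a i" and b_pos: "\<And>i. i < k \<Longrightarrow> 0 < b i"
    and edge_start: "\<And>i. i < k \<Longrightarrow> wt (a i) (b i) (vx i, vy i) = P"
    and edge_end: "\<And>i. i < k \<Longrightarrow> wt (a i) (b i) (vx (Suc i), vy (Suc i)) = P"
    and vertex_ge: "\<And>i j. i < k \<Longrightarrow> j \<le> k \<Longrightarrow> P \<le> wt (a i) (b i) (vx j, vy j)"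
    and vertex_eq: "\<And>i j. i < k \<Longrightarrow> j \<le> k \<Longrightarrow> wt (a i) (b i) (vx j, vy j) = P \<Longrightarrow> j = i \<or> j = Suc i"
begin

definition "W i z = wt (a i) (b i) z"
definition "M z = Min ((\<lambda>i. W i z) ` {..<k})"
definition "idx z = (LEAST i. i < k \<and> W i z = M z)"
text \<open>\<open>D i\<close> is the determinant of two successive vertices, twice the area of the
  triangle they span with the origin. \<open>s\<close> and \<open>t\<close> are \<open>D i\<close>
  times the coordinates of \<open>z\<close> in the basis of these vertices, which keeps them
  integral; the cone over the edge is given by \<open>s \<ge> 0\<close> and
  \<open>t \<ge> 0\<close>.\<close>

definition "D i = int (vx i) * int (vy (Suc i)) - int (vx (Suc i)) * int (vy i)"
definition "s i z = int (fst z) * int (vy (Suc i)) - int (vx (Suc i)) * int (snd z)"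
definition "t i z = int (vx i) * int (snd z) - int (vy i) * int (fst z)"

abbreviation "vertex i \<equiv> (vx i, vy i)"

text \<open>As \<open>idx\<close> is the least index attaining the minimum, the points on the ray through a vertex
  belong to the cone on the \<open>x\<close>-axis side of that ray.\<close>

lemma M_le: "i < k \<Longrightarrow> M z \<le> W i z"
  unfolding M_def by (rule Min_le) auto

lemma M_ex: "\<exists>i<k. W i z = M z"
proof -
  have "M z \<in> (\<lambda>i. W i z) ` {..<k}" unfolding M_def by (rule Min_in) (use k_pos in auto)
  then show ?thesis by auto
qed

lemma M_ge: "(\<And>i. i < k \<Longrightarrow> n \<le> W i z) \<Longrightarrow> n \<le> M z"
  using M_ex[of z] by metis

lemma idx: "idx z < k" "W (idx z) z = M z"
  using LeastI_ex[OF M_ex[of z]] unfolding idx_def by auto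

lemma idx_least: "j < idx z \<Longrightarrow> M z < W j z"
  using not_less_Least[of j "\<lambda>i. i < k \<and> W i z = M z"] idx(1)[of z] M_le[of j z]
  unfolding idx_def[symmetric] by (metis less_trans order_le_imp_less_or_eq)

lemma W_add: "W i (z + w) = W i z + W i w"
  unfolding W_def by (rule wt_add)

lemma M_add: "M z + M w \<le> M (z + w)"
  by (rule M_ge) (simp add: W_add add_mono M_le)

lemma vx_pos: "i < k \<Longrightarrow> 0 < vx i"
  using vx_dec[of i] by simp

lemma vy_pos: "i < k \<Longrightarrow> 0 < vy (Suc i)"
  using vy_inc[of i] by simp

lemma D_pos: "i < k \<Longrightarrow> 0 < D i"
proof -
  assume i: "i < k"
  have "vx (Suc i) * vy i < vx i * vy (Suc i)"
    using vx_dec[OF i] vy_inc[OF i] by (intro mult_strict_mono) auto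
  then have "int (vx (Suc i) * vy i) < int (vx i * vy (Suc i))" by (simp only: of_nat_less_iff)
  then show ?thesis by (simp add: D_def)
qed

lemma P_pos: "0 < P"
  using edge_start[of 0] a_pos[of 0] vx_pos[of 0] k_pos by (auto simp: wt_def intro!: Nat.gr0I)

lemma cramer:
  "D i * int (fst z) = s i z * int (vx i) + t i z * int (vx (Suc i))"
  "D i * int (snd z) = s i z * int (vy i) + t i z * int (vy (Suc i))"
  by (simp_all add: D_def s_def t_def algebra_simps)

lemma D_wt: "D i * int (wt c d z) = s i z * int (wt c d (vertex i)) + t i z * int (wt c d (vertex (Suc i)))"
proof -
  have "D i * int (wt c d z) = int c * (D i * int (fst z)) + int d * (D i * int (snd z))"
    by (simp add: wt_def algebra_simps)
  then show ?thesis unfolding cramer by (simp add: wt_def algebra_simps)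
qed

lemma D_W: "i < k \<Longrightarrow> D i * int (W i z) = (s i z + t i z) * int P"
  using D_wt[of i "a i" "b i" z] edge_start[of i] edge_end[of i] by (simp add: W_def algebra_simps)

lemma line_t:
  assumes "i < k"
  shows "D i * (int P * int (snd z) - int (W i z) * int (vy i)) = int P * (int (vy (Suc i)) - int (vy i)) * t i z"
proof -
  have "D i * (int P * int (snd z) - int (W i z) * int (vy i)) =
      int P * (D i * int (snd z)) - D i * int (W i z) * int (vy i)" by (simp add: algebra_simps)
  then show ?thesis unfolding cramer D_W[OF assms] by (simp add: algebra_simps)
qed

lemma line_s:
  assumes "i < k"
  shows "D i * (int (W i z) * int (vy (Suc i)) - int P * int (snd z)) = int P * (int (vy (Suc i)) - int (vy i)) * s i z"
proof -
  have "D i * (int (W i z) * int (vy (Suc i)) - int P * int (snd z)) =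
      D i * int (W i z) * int (vy (Suc i)) - int P * (D i * int (snd z))" by (simp add: algebra_simps)
  then show ?thesis unfolding cramer D_W[OF assms] by (simp add: algebra_simps)
qed

text \<open>On a line of constant \<open>W i\<close> the cone becomes an interval of y-exponents. In
  this form it meets the degree bounds of the edge polynomials.\<close>

lemma line_cone:
  assumes i: "i < k"
  shows "0 \<le> t i z \<longleftrightarrow> W i z * vy i \<le> P * snd z" "0 < t i z \<longleftrightarrow> W i z * vy i < P * snd z"
    "0 \<le> s i z \<longleftrightarrow> P * snd z \<le> W i z * vy (Suc i)" "0 < s i z \<longleftrightarrow> P * snd z < W i z * vy (Suc i)"
proof -
  have pos: "0 < int P * (int (vy (Suc i)) - int (vy i))"
    using P_pos vy_inc[OF i] by simp
  note D = D_pos[OF i]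
  have sgn: "0 \<le> x \<longleftrightarrow> 0 \<le> y" "0 < x \<longleftrightarrow> 0 < y" if "D i * x = int P * (int (vy (Suc i)) - int (vy i)) * y" for x y
    using that D pos by (metis mult_le_cancel_left_pos mult_zero_right, metis mult_less_cancel_left_pos mult_zero_right)
  show "0 \<le> t i z \<longleftrightarrow> W i z * vy i \<le> P * snd z" "0 < t i z \<longleftrightarrow> W i z * vy i < P * snd z"
    using sgn[OF line_t[OF i, of z]] by (simp_all flip: of_nat_mult)
  show "0 \<le> s i z \<longleftrightarrow> P * snd z \<le> W i z * vy (Suc i)" "0 < s i z \<longleftrightarrow> P * snd z < W i z * vy (Suc i)"
    using sgn[OF line_s[OF i, of z]] by (simp_all flip: of_nat_mult)
qed

text \<open>Every form \<open>W j\<close> is at least \<open>P\<close> at the two vertices of the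
  cone, where \<open>W i\<close> equals \<open>P\<close>; nonnegative coordinates carry the
  comparison over to \<open>z\<close>.\<close>

lemma W_eq_M:
  assumes i: "i < k" and st: "0 \<le> s i z" "0 \<le> t i z"
  shows "W i z = M z"
proof (rule antisym)
  show "W i z \<le> M z"
  proof (rule M_ge)
    fix j assume j: "j < k"
    have "(s i z + t i z) * int P \<le> D i * int (W j z)"
      unfolding W_def D_wt distrib_right using st i j
      by (intro add_mono mult_left_mono) (auto simp: vertex_ge)
    then have "D i * int (W i z) \<le> D i * int (W j z)" using D_W[OF i] by simp
    then show "W i z \<le> W j z" using D_pos[OF i] by simp
  qed
qed (rule M_le[OF i])

text \<open>A form of smaller index exceeds \<open>P\<close> strictly at vertex
  \<open>Suc i\<close>, because its edge ends earlier, and \<open>t > 0\<close> makes that vertex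
  count.\<close>

lemma idx_eqI:
  assumes i: "i < k" and st: "0 \<le> s i z" "0 < t i z"
  shows "idx z = i"
proof (rule antisym)
  have W: "W i z = M z" using W_eq_M[OF i] st by simp
  then show "idx z \<le> i" unfolding idx_def using i by (intro Least_le) simp
  show "i \<le> idx z"
  proof (rule ccontr)
    assume "\<not> i \<le> idx z"
    then have j: "idx z < i" by simp
    have "P < wt (a (idx z)) (b (idx z)) (vertex (Suc i))"
      using vertex_ge[of "idx z" "Suc i"] vertex_eq[of "idx z" "Suc i"] j i idx(1)[of z] by fastforce
    then have "(s i z + t i z) * int P < D i * int (W (idx z) z)"
      unfolding W_def D_wt distrib_right using st i idx(1)[of z]
      by (intro add_le_less_mono mult_left_mono mult_strict_left_mono) (auto simp: vertex_ge)
    then have "D i * int (W i z) < D i * int (W (idx z) z)" using D_W[OF i] by simp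
    then show False using W idx(2) by simp
  qed
qed

text \<open>\<open>W (Suc i)\<close> and \<open>W i\<close> agree at the common vertex and differ at
  vertex \<open>i\<close>, so \<open>D i * (W (Suc i) z - W i z)\<close> is a positive multiple of
  \<open>s i z\<close>. For the last cone the boundary is the y-axis itself.\<close>

lemma s_nonneg:
  assumes i: "i < k" and W: "W i z = M z"
  shows "0 \<le> s i z"
proof (cases "Suc i = k")
  case True
  then show ?thesis using vx_k by (simp add: s_def)
next
  case False
  then have j: "Suc i < k" using i by simp
  have "int P < int (wt (a (Suc i)) (b (Suc i)) (vertex i))"
    using vertex_ge[OF j, of i] vertex_eq[OF j, of i] i by fastforce
  moreover have "D i * int (W i z) \<le> D i * int (W (Suc i) z)"
    using D_pos[OF i] W M_le[OF j, of z] by simp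
  then have "0 \<le> s i z * (int (wt (a (Suc i)) (b (Suc i)) (vertex i)) - int P)"
    unfolding D_W[OF i] unfolding W_def D_wt edge_start[OF j] by (simp add: algebra_simps)
  ultimately show ?thesis by (simp add: zero_le_mult_iff)
qed

lemma t_nonneg:
  assumes i: "i < k" and W: "W i z = M z"
  shows "0 \<le> t i z"
proof (cases i)
  case 0
  then show ?thesis using vy_0 by (simp add: t_def)
next
  case (Suc j)
  then have j: "j < k" using i by simp
  have "int P < int (wt (a j) (b j) (vertex (Suc i)))"
    using vertex_ge[OF j, of "Suc i"] vertex_eq[OF j, of "Suc i"] i Suc by fastforce
  moreover have "D i * int (W i z) \<le> D i * int (W j z)"
    using D_pos[OF i] W M_le[OF j, of z] by simp
  then have "0 \<le> t i z * (int (wt (a j) (b j) (vertex (Suc i))) - int P)"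
    unfolding D_W[OF i] unfolding W_def D_wt Suc edge_end[OF j] by (simp add: algebra_simps)
  ultimately show ?thesis by (simp add: zero_le_mult_iff)
qed

text \<open>Strictness comes from taking the least index: on the ray through vertex
  \<open>idx z\<close> the preceding form would attain the minimum as well.\<close>

lemma t_idx_pos:
  assumes z: "0 < snd z"
  shows "0 < t (idx z) z"
proof (cases "idx z")
  case 0
  then show ?thesis using vy_0 vx_pos[of 0] k_pos z by (simp add: t_def)
next
  case (Suc j)
  have i: "idx z < k" by (rule idx)
  then have j: "j < k" using Suc by simp
  have "int P \<le> int (wt (a j) (b j) (vertex (Suc (idx z))))"
    using vertex_ge[OF j, of "Suc (idx z)"] i by simp
  moreover have "D (idx z) * int (W (idx z) z) < D (idx z) * int (W j z)"
    using D_pos[OF i] idx(2)[of z] idx_least[of j z] Suc by simp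
  then have "0 < t (idx z) z * (int (wt (a j) (b j) (vertex (Suc (idx z)))) - int P)"
    unfolding D_W[OF i] unfolding W_def D_wt Suc edge_end[OF j] by (simp add: algebra_simps)
  ultimately show ?thesis by (simp add: zero_less_mult_iff)
qed

lemma idx_eq_iff:
  assumes "0 < snd z" "i < k"
  shows "idx z = i \<longleftrightarrow> 0 < t i z \<and> 0 \<le> s i z"
  using idx_eqI[OF assms(2), of z] t_idx_pos[OF assms(1)] s_nonneg[OF idx(1), OF idx(2), of z] by metis

lemma finite_M_less: "finite {z. M z < n}"
proof (rule finite_subset)
  show "{z. M z < n} \<subseteq> (\<Union>i<k. {z. wt (a i) (b i) z \<le> n})"
  proof
    fix z assume "z \<in> {z. M z < n}"
    then show "z \<in> (\<Union>i<k. {z. wt (a i) (b i) z \<le> n})"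
      using idx[of z] by (auto intro!: bexI[of _ "idx z"] simp: W_def)
  qed
  show "finite (\<Union>i<k. {z. wt (a i) (b i) z \<le> n})"
    using finite_wt_le a_pos b_pos by simp
qed

end

section \<open>Two facts on independent families\<close>

text \<open>The linear map that fixes \<open>A\<close> and kills \<open>B\<close> is the identity on
  one span and zero on the other.\<close>

lemma (in vector_space) span_disjoint_independent:
  assumes "independent (A \<union> B)" "A \<inter> B = {}"
  shows "span A \<inter> span B \<subseteq> {0}"
proof
  interpret vector_space_pair scale scale ..
  fix w assume w: "w \<in> span A \<inter> span B"
  obtain g where g: "Vector_Spaces.linear scale scale g" "\<And>v. v \<in> A \<union> B \<Longrightarrow> g v = (if v \<in> A then v else 0)"
    using linear_independent_extend[OF assms(1), of "\<lambda>v. if v \<in> A then v else 0"] by blast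
  have "g w = w"
    by (rule linear_eq_on[OF g(1) linear_ident, of w A]) (use w g(2) in auto)
  moreover have "g w = 0"
    by (rule linear_eq_on[OF g(1) linear_zero, of w B]) (use w g(2) assms(2) in auto)
  ultimately show "w \<in> {0}" by simp
qed

lemma (in vector_space) independent_image_of_family:
  assumes fin: "finite A" and F: "\<And>c. (\<Sum>x\<in>A. scale (c x) (F x)) = 0 \<Longrightarrow> \<forall>x\<in>A. c x = 0"
  shows "inj_on F A \<and> independent (F ` A)"
proof
  show inj: "inj_on F A"
  proof (rule inj_onI, rule ccontr)
    fix x y assume xy: "x \<in> A" "y \<in> A" "F x = F y" "x \<noteq> y"
    define c where "c z = (if z = x then 1 else if z = y then - 1 else (0::'a))" for z
    have "(\<Sum>z\<in>A. scale (c z) (F z)) = (\<Sum>z\<in>{x, y}. scale (c z) (F z))"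
      by (rule sum.mono_neutral_right) (use fin xy in \<open>auto simp: c_def\<close>)
    also have "\<dots> = 0" using xy by (simp add: c_def)
    finally show False using F[of c] xy(1) by (auto simp: c_def)
  qed
  show "independent (F ` A)"
  proof
    assume "dependent (F ` A)"
    then obtain u v where u: "v \<in> F ` A" "u v \<noteq> 0" "(\<Sum>v\<in>F ` A. scale (u v) v) = 0"
      using dependent_finite[of "F ` A"] fin by auto
    then have "(\<Sum>x\<in>A. scale (u (F x)) (F x)) = 0" by (simp add: sum.reindex[OF inj])
    then show False using F[of "u \<circ> F"] u(1,2) by auto
  qed
qed

section \<open>The Milnor algebra of a nondegenerate convenient series\<close>

text \<open>Multiplying the derivative by its variable undoes the shift of exponents, so that the
  support stays within that of \<open>f\<close> and the same weights apply.\<close>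

definition fps2_xdx :: "'a::comm_ring_1 fps fps \<Rightarrow> 'a fps fps" where
  "fps2_xdx f = fps2_monom (1, 0) * fps2_dx f"

definition fps2_ydy :: "'a::comm_ring_1 fps fps \<Rightarrow> 'a fps fps" where
  "fps2_ydy f = fps2_monom (0, 1) * fps2_dy f"

lemma fps2_coeff_xdx: "fps2_coeff (fps2_xdx f) z = of_nat (fst z) * fps2_coeff f z"
  by (cases z) (auto simp: fps2_xdx_def fps2_coeff_monom_mult fps2_coeff_dx fps2_below_def fps2_minus_def Suc_le_eq)

lemma fps2_coeff_ydy: "fps2_coeff (fps2_ydy f) z = of_nat (snd z) * fps2_coeff f z"
  by (cases z) (auto simp: fps2_ydy_def fps2_coeff_monom_mult fps2_coeff_dy fps2_below_def fps2_minus_def Suc_le_eq)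

lemma fps2_coeff_mult_nonzero:
  assumes "fps2_coeff (f * g :: 'a::comm_ring_1 fps fps) z \<noteq> 0"
  obtains x y where "z = x + y" "fps2_coeff f x \<noteq> 0" "fps2_coeff g y \<noteq> 0"
proof -
  obtain x where "x \<in> fps2_below z" "fps2_coeff f x * fps2_coeff g (fps2_minus z x) \<noteq> 0"
    using assms unfolding fps2_coeff_mult by (rule sum.not_neutral_contains_not_neutral)
  moreover have "z = x + fps2_minus z x" if "x \<in> fps2_below z"
    using that by (auto simp: fps2_below_def fps2_minus_def prod_eq_iff)
  ultimately show ?thesis
    using that[of x "fps2_minus z x"] by (metis mult_zero_left mult_zero_right)
qed

text \<open>\<open>supp_edge\<close> says that points of the support on the line of an edge lie on
  the edge itself. The edge condition is stated on the slice x = 1 of the torus, which is what the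
  one-variable edge polynomials see.\<close>

locale kouchnirenko = newton_fan k vx vy a b P
  for k vx vy a b P +
  fixes f :: "'k::alg_closed_field fps fps"
  assumes supp_ge: "\<And>i z. fps2_coeff f z \<noteq> 0 \<Longrightarrow> i < k \<Longrightarrow> P \<le> W i z"
    and supp_edge: "\<And>i z. fps2_coeff f z \<noteq> 0 \<Longrightarrow> i < k \<Longrightarrow> W i z = P \<Longrightarrow> vy i \<le> snd z \<and> snd z \<le> vy (Suc i)"
    and edge_nondeg: "\<And>i x. i < k \<Longrightarrow> x \<noteq> 0 \<Longrightarrow>
      poly (edge_poly (a i) (b i) P (fps2_xdx f)) x \<noteq> 0 \<or> poly (edge_poly (a i) (b i) P (fps2_ydy f)) x \<noteq> 0"
    and vertex_nondeg: "\<And>i. i \<le> k \<Longrightarrow>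
      fps2_coeff (fps2_xdx f) (vertex i) \<noteq> 0 \<or> fps2_coeff (fps2_ydy f) (vertex i) \<noteq> 0"
begin

definition "g = fps2_xdx f"
definition "h = fps2_ydy f"
definition "G i = edge_poly (a i) (b i) P g"
definition "H i = edge_poly (a i) (b i) P h"

lemma supp_gh: "fps2_coeff g z \<noteq> 0 \<or> fps2_coeff h z \<noteq> 0 \<Longrightarrow> fps2_coeff f z \<noteq> 0"
  by (auto simp: g_def h_def fps2_coeff_xdx fps2_coeff_ydy)

lemma supp_gh_ge: "fps2_coeff g z \<noteq> 0 \<or> fps2_coeff h z \<noteq> 0 \<Longrightarrow> i < k \<Longrightarrow> P \<le> W i z"
  using supp_gh supp_ge by blast

lemma supp_gh_M: "fps2_coeff g z \<noteq> 0 \<or> fps2_coeff h z \<noteq> 0 \<Longrightarrow> P \<le> M z"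
  using supp_gh_ge M_ge by blast

lemma edge_polys: "i < k \<Longrightarrow> edge_polys (G i) (H i) (vy i) (vy (Suc i))"
proof -
  assume i: "i < k"
  have supp: "vy i \<le> r \<and> r \<le> vy (Suc i)"
    if "poly.coeff (G i) r \<noteq> 0 \<or> poly.coeff (H i) r \<noteq> 0" for r
  proof -
    obtain z where "wt (a i) (b i) z = P" "snd z = r" "fps2_coeff g z \<noteq> 0 \<or> fps2_coeff h z \<noteq> 0"
      using \<open>poly.coeff (G i) r \<noteq> 0 \<or> poly.coeff (H i) r \<noteq> 0\<close> coeff_edge_poly_nonzero[OF a_pos[OF i] b_pos[OF i]]
      unfolding G_def H_def by metis
    then show ?thesis using supp_edge[OF supp_gh i, of z] by (auto simp: W_def)
  qed
  have vertex: "poly.coeff (G i) (vy j) \<noteq> 0 \<or> poly.coeff (H i) (vy j) \<noteq> 0"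
    if j: "j = i \<or> j = Suc i" for j
  proof -
    have "wt (a i) (b i) (vertex j) = P" using edge_start[OF i] edge_end[OF i] j by auto
    from coeff_edge_poly[OF a_pos[OF i] b_pos[OF i] this]
    have "poly.coeff (edge_poly (a i) (b i) P u) (vy j) = fps2_coeff u (vertex j)" for u :: "'k fps fps"
      by simp
    then show ?thesis using vertex_nondeg[of j] j i unfolding G_def H_def g_def h_def by auto
  qed
  show ?thesis
    by unfold_locales (use supp vertex edge_nondeg[OF i] in \<open>auto simp: G_def H_def g_def h_def\<close>)
qed

lemma coeff_combination:
  assumes i: "i < k" and z: "W i z = N + P"
    and uv: "\<And>w. fps2_coeff u w \<noteq> 0 \<Longrightarrow> N \<le> W i w" "\<And>w. fps2_coeff v w \<noteq> 0 \<Longrightarrow> N \<le> W i w"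
  shows "fps2_coeff (u * g + v * h) z =
    poly.coeff (edge_poly (a i) (b i) N u * G i + edge_poly (a i) (b i) N v * H i) (snd z)"
  using fps2_coeff_mult_eq_edge_poly[OF a_pos[OF i] b_pos[OF i], of z N P u g]
    fps2_coeff_mult_eq_edge_poly[OF a_pos[OF i] b_pos[OF i], of z N P v h]
    z uv supp_gh_ge[OF _ i] by (simp add: W_def G_def H_def)

text \<open>A term of least level \<open>N < P\<close> singles out a cone. There the leading forms
  of \<open>u\<close> and \<open>v\<close> satisfy a relation in level \<open>N + P < 2 * P\<close>,
  while the interval of y-exponents open to them is shorter than the edge; this contradicts
  injectivity.\<close>

lemma no_low_syzygies:
  assumes u: "\<And>z. fps2_coeff u z \<noteq> 0 \<Longrightarrow> M z < P" and v: "\<And>z. fps2_coeff v z \<noteq> 0 \<Longrightarrow> M z < P"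
    and zero: "\<And>z. M z < 2 * P \<Longrightarrow> fps2_coeff (u * g + v * h) z = 0"
  shows "u = 0 \<and> v = 0"
proof (rule ccontr)
  assume "\<not> (u = 0 \<and> v = 0)"
  then obtain z0 where "fps2_coeff u z0 \<noteq> 0 \<or> fps2_coeff v z0 \<noteq> 0"
    using fps2_eqI[of u 0] fps2_eqI[of v 0] by auto
  then obtain z where z: "fps2_coeff u z \<noteq> 0 \<or> fps2_coeff v z \<noteq> 0"
    and min: "\<And>w. fps2_coeff u w \<noteq> 0 \<or> fps2_coeff v w \<noteq> 0 \<Longrightarrow> M z \<le> M w"
    using ex_has_least_nat[of "\<lambda>z. fps2_coeff u z \<noteq> 0 \<or> fps2_coeff v z \<noteq> 0" z0 M] by blast
  define i where "i = idx z"
  define N where "N = M z"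
  have i: "i < k" and WN: "W i z = N" using idx by (simp_all add: i_def N_def)
  have NP: "N < P" using z u v unfolding N_def by blast
  have uN: "\<And>w. fps2_coeff u w \<noteq> 0 \<Longrightarrow> N \<le> W i w" and vN: "\<And>w. fps2_coeff v w \<noteq> 0 \<Longrightarrow> N \<le> W i w"
    using min M_le[OF i] order_trans unfolding N_def by blast+
  define U where "U = edge_poly (a i) (b i) N u"
  define V where "V = edge_poly (a i) (b i) N v"
  note ab = a_pos[OF i] b_pos[OF i]
  have "poly.coeff (U * G i + V * H i) r = 0" for r
  proof (rule ccontr)
    assume nz: "poly.coeff (U * G i + V * H i) r \<noteq> 0"
    have ex: "\<exists>w. wt (a i) (b i) w = N + P \<and> snd w = r"
      if "poly.coeff (edge_poly (a i) (b i) N u' * edge_poly (a i) (b i) P g') r \<noteq> 0" for u' g' :: "'k fps fps"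
    proof -
      obtain s where "s \<le> r" "poly.coeff (edge_poly (a i) (b i) N u') s \<noteq> 0"
        "poly.coeff (edge_poly (a i) (b i) P g') (r - s) \<noteq> 0"
        using \<open>poly.coeff (edge_poly (a i) (b i) N u' * edge_poly (a i) (b i) P g') r \<noteq> 0\<close> unfolding coeff_mult
        by (elim sum.not_neutral_contains_not_neutral) auto
      then obtain w1 w2 where "wt (a i) (b i) w1 = N" "snd w1 = s" "wt (a i) (b i) w2 = P" "snd w2 = r - s"
        using coeff_edge_poly_nonzero[OF ab] by metis
      then show ?thesis using \<open>s \<le> r\<close> by (intro exI[of _ "w1 + w2"]) (simp add: wt_add)
    qed
    obtain w where w: "wt (a i) (b i) w = N + P" "snd w = r"
      using nz ex unfolding U_def V_def G_def H_def by (metis add.right_neutral coeff_add)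
    have "fps2_coeff (u * g + v * h) w = poly.coeff (U * G i + V * H i) r"
      unfolding U_def V_def w(2)[symmetric]
      by (rule coeff_combination[OF i _ uN vN]) (simp_all add: w W_def)
    moreover have "M w < 2 * P" using M_le[OF i, of w] w(1) NP by (simp add: W_def)
    ultimately show False using zero nz by simp
  qed
  then have eq: "U * G i + V * H i = 0" by (simp add: poly_eq_iff)
  \<comment> \<open>\<open>N * vy i / P\<close> rounded up, the first y-exponent on this line that
    belongs to the cone.\<close>
  define lo where "lo = (N * vy i + (P - 1)) div P"
  have range: "lo \<le> r \<and> r < lo + (vy (Suc i) - vy i)"
    if "poly.coeff U r \<noteq> 0 \<or> poly.coeff V r \<noteq> 0" for r
  proof -
    obtain w where w: "W i w = N" "snd w = r" "fps2_coeff u w \<noteq> 0 \<or> fps2_coeff v w \<noteq> 0"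
    proof -
      obtain u' where u': "u' = u \<or> u' = v" "poly.coeff (edge_poly (a i) (b i) N u') r \<noteq> 0"
        using \<open>poly.coeff U r \<noteq> 0 \<or> poly.coeff V r \<noteq> 0\<close> unfolding U_def V_def by blast
      show ?thesis using coeff_edge_poly_nonzero[OF ab u'(2)] u'(1) that unfolding W_def by blast
    qed
    \<comment> \<open>By minimality of \<open>N\<close> a term on the line cannot have a smaller
      level, so it lies in the cone over edge \<open>i\<close> and not merely on the line.\<close>
    have "M w = N" using min[OF w(3)] M_le[OF i, of w] w(1) unfolding N_def by simp
    then have "W i w = M w" using w(1) by simp
    then have st: "N * vy i \<le> P * r" "P * r \<le> N * vy (Suc i)"
      using s_nonneg[OF i, of w] t_nonneg[OF i, of w] line_cone[OF i, of w] w(1,2) by auto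
    have "lo \<le> r"
    proof -
      have "lo \<le> (P * r + (P - 1)) div P" unfolding lo_def using st(1) by (intro div_le_mono) simp
      also have "\<dots> = r" by (rule div_nat_eqI) (use P_pos in auto)
      finally show ?thesis .
    qed
    have "N * vy i \<le> P * lo"
    proof -
      have "N * vy i + (P - 1) = P * lo + (N * vy i + (P - 1)) mod P" unfolding lo_def by simp
      moreover have "(N * vy i + (P - 1)) mod P \<le> P - 1" using P_pos by (simp add: less_eq_Suc_le[symmetric] flip: less_Suc_eq_le)
      ultimately show ?thesis by linarith
    qed
    moreover have "N * (vy (Suc i) - vy i) < P * (vy (Suc i) - vy i)"
      using NP vy_inc[OF i] by simp
    moreover have "N * vy (Suc i) = N * vy i + N * (vy (Suc i) - vy i)"
      using vy_inc[OF i] by (simp flip: distrib_left)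
    ultimately have "P * r < P * lo + P * (vy (Suc i) - vy i)" using st(2) by linarith
    then have "P * r < P * (lo + (vy (Suc i) - vy i))" by (simp add: distrib_left)
    then show ?thesis using \<open>lo \<le> r\<close> by simp
  qed
  have "U = 0 \<and> V = 0"
    by (rule edge_polys.injective[where lo = lo, OF edge_polys[OF i] eq]) (use range in auto)
  then show False
    using z coeff_edge_poly[OF ab, of z N] WN unfolding U_def V_def W_def by (metis coeff_0)
qed

text \<open>In the last cone \<open>v\<close> must not involve pure powers of \<open>y\<close>. This costs one coefficient, which is
  regained because the leading form of \<open>g\<close> vanishes at the vertex on the \<open>y\<close>-axis.\<close>

lemma monom_reduction:
  assumes z: "0 < fst z" "0 < snd z" and Mz: "2 * P \<le> M z"
  shows "\<exists>u v. (\<forall>w. fps2_coeff u w \<noteq> 0 \<longrightarrow> 0 < snd w \<and> M w + P = M z) \<and>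
     (\<forall>w. fps2_coeff v w \<noteq> 0 \<longrightarrow> 0 < fst w \<and> M w + P = M z) \<and>
     (\<forall>w. fps2_coeff (fps2_monom z - (u * g + v * h)) w \<noteq> 0 \<longrightarrow>
        M z < M w \<or> M z = M w \<and> idx z < idx w)"
proof -
  define i where "i = idx z"
  define N where "N = M z - P"
  define r where "r = snd z"
  have i: "i < k" and Wz: "W i z = N + P" and Mz': "M z = N + P" and NP: "P \<le> N"
    using idx[of z] Mz by (simp_all add: i_def N_def)
  note ab = a_pos[OF i] b_pos[OF i]
  interpret E: edge_polys "G i" "H i" "vy i" "vy (Suc i)" by (rule edge_polys[OF i])
  have Pp: "0 < P" by (rule P_pos)
  have t: "(N + P) * vy i < P * r" and s: "P * r \<le> (N + P) * vy (Suc i)"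
    using line_cone[OF i, of z] t_idx_pos[OF z(2)] s_nonneg[OF i, of z] Wz Mz' by (auto simp: i_def r_def)
  \<comment> \<open>\<open>lo\<close> is the first exponent strictly beyond the ray through vertex
    \<open>i\<close>, \<open>hi\<close> the last one up to and including the ray through vertex
    \<open>Suc i\<close>, and \<open>hi'\<close> is a strict bound for those before that
    ray.\<close>
  define lo where "lo = N * vy i div P + 1"
  define hi where "hi = N * vy (Suc i) div P"
  define hi' where "hi' = (N * vy (Suc i) + (P - 1)) div P"
  have lo_iff: "lo \<le> y \<longleftrightarrow> N * vy i < P * y" for y
    using Pp by (simp add: lo_def div_less_iff_less_mult mult.commute less_eq_Suc_le[symmetric] Suc_le_eq)
  have hi_iff: "y \<le> hi \<longleftrightarrow> P * y \<le> N * vy (Suc i)" for y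
    using Pp by (simp add: hi_def less_eq_div_iff_mult_less_eq mult.commute)
  have hi'_iff: "y < hi' \<longleftrightarrow> P * y < N * vy (Suc i)" for y
  proof -
    have "y < hi' \<longleftrightarrow> Suc y \<le> (N * vy (Suc i) + (P - 1)) div P" by (simp add: hi'_def Suc_le_eq)
    also have "\<dots> \<longleftrightarrow> Suc y * P \<le> N * vy (Suc i) + (P - 1)"
      using Pp by (simp add: less_eq_div_iff_mult_less_eq)
    also have "\<dots> \<longleftrightarrow> P * y < N * vy (Suc i)" using Pp by (auto simp: mult.commute)
    finally show ?thesis .
  qed
  have inc: "vy i < vy (Suc i)" by (rule vy_inc[OF i])
  \<comment> \<open>Here \<open>2 * P \<le> M z\<close> enters: as \<open>N \<ge> P\<close>, the
    interval is at least as long as the edge.\<close>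
  have lo_hi: "lo + (vy (Suc i) - vy i) \<le> hi + 1"
  proof -
    have "N * vy i + (vy (Suc i) - vy i) * P \<le> N * vy i + N * (vy (Suc i) - vy i)"
      using NP by (simp add: mult.commute)
    also have "\<dots> = N * vy (Suc i)" using inc by (simp flip: distrib_left)
    finally have "(N * vy i + (vy (Suc i) - vy i) * P) div P \<le> hi"
      unfolding hi_def by (rule div_le_mono)
    then show ?thesis using Pp by (simp add: lo_def)
  qed
  have "hi \<le> hi'" unfolding hi_def hi'_def by (rule div_le_mono) simp
  have lo_r: "lo + vy i \<le> r"
  proof -
    have "P * vy i \<le> P * r" using t unfolding distrib_right by linarith
    then have "vy i \<le> r" using Pp by simp
    moreover have "lo \<le> r - vy i" unfolding lo_iff using t \<open>vy i \<le> r\<close>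
      by (simp add: diff_mult_distrib2 distrib_right)
    ultimately show ?thesis by simp
  qed
  have r_hi: "r \<le> hi + vy (Suc i)"
  proof (cases "vy (Suc i) \<le> r")
    case True
    then have "r - vy (Suc i) \<le> hi" unfolding hi_iff using s
      by (simp add: diff_mult_distrib2 distrib_right)
    then show ?thesis by simp
  qed simp
  have "\<exists>U V. U * G i + V * H i = Polynomial.monom 1 r \<and>
     (\<forall>y. poly.coeff U y \<noteq> 0 \<longrightarrow> lo \<le> y \<and> y \<le> hi) \<and>
     (\<forall>y. poly.coeff V y \<noteq> 0 \<longrightarrow> lo \<le> y \<and> y \<le> hi \<and> (Suc i = k \<longrightarrow> y < hi'))"
  proof (cases "Suc i = k")
    case False
    then show ?thesis using E.surjective_closed[OF lo_hi lo_r r_hi inc] by blast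
  next
    case True
    have "fps2_coeff g (vertex (Suc i)) = 0"
      using vx_k True by (simp add: g_def fps2_coeff_xdx)
    moreover have "wt (a i) (b i) (vertex (Suc i)) = P" by (rule edge_end[OF i])
    ultimately have G0: "poly.coeff (G i) (vy (Suc i)) = 0"
      unfolding G_def using coeff_edge_poly[OF ab, of "vertex (Suc i)" P g] by simp
    have "0 < s i z" using True vx_k z(1) vy_pos[OF i] by (simp add: s_def)
    then have s': "P * r < (N + P) * vy (Suc i)" using line_cone(4)[OF i, of z] Wz by (simp add: r_def)
    have r': "r < hi' + vy (Suc i)"
    proof (cases "vy (Suc i) \<le> r")
      case True
      then have "P * vy (Suc i) \<le> P * r" by simp
      then have "r - vy (Suc i) < hi'" unfolding hi'_iff diff_mult_distrib2 using s'
        unfolding distrib_right by linarith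
      then show ?thesis using True by simp
    next
      case False
      then show ?thesis by simp
    qed
    have "lo + (vy (Suc i) - vy i) \<le> hi' + 1" using lo_hi \<open>hi \<le> hi'\<close> by simp
    from E.surjective_open[OF G0 this lo_hi lo_r r' inc]
    obtain U V where UV: "U * G i + V * H i = Polynomial.monom 1 r"
      "\<forall>y. poly.coeff U y \<noteq> 0 \<longrightarrow> lo \<le> y \<and> y \<le> hi" "\<forall>y. poly.coeff V y \<noteq> 0 \<longrightarrow> lo \<le> y \<and> y < hi'" by blast
    have "y \<le> hi" if "y < hi'" for y using that unfolding hi_iff hi'_iff by simp
    then show ?thesis using UV by blast
  qed
  then obtain U V where UV: "U * G i + V * H i = Polynomial.monom 1 r"
    and U: "\<And>y. poly.coeff U y \<noteq> 0 \<Longrightarrow> lo \<le> y \<and> y \<le> hi"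
    and V: "\<And>y. poly.coeff V y \<noteq> 0 \<Longrightarrow> lo \<le> y \<and> y \<le> hi \<and> (Suc i = k \<longrightarrow> y < hi')" by blast
  define u where "u = Abs_fps2 (\<lambda>w. if wt (a i) (b i) w = N then poly.coeff U (snd w) else 0)"
  define v where "v = Abs_fps2 (\<lambda>w. if wt (a i) (b i) w = N then poly.coeff V (snd w) else 0)"
  have uv: "W i w = N \<and> lo \<le> snd w \<and> snd w \<le> hi" if "fps2_coeff u w \<noteq> 0 \<or> fps2_coeff v w \<noteq> 0" for w
    using that U[of "snd w"] V[of "snd w"] by (auto simp: u_def v_def W_def split: if_splits)
  have cone: "0 < t i w \<and> 0 \<le> s i w \<and> M w = N" if "fps2_coeff u w \<noteq> 0 \<or> fps2_coeff v w \<noteq> 0" for w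
  proof -
    have "0 < t i w" "0 \<le> s i w"
      using uv[OF that] line_cone[OF i, of w] lo_iff[of "snd w"] hi_iff[of "snd w"] by auto
    then show ?thesis using W_eq_M[OF i, of w] uv[OF that] by simp
  qed
  have u_snd: "0 < snd w" if "fps2_coeff u w \<noteq> 0" for w
  proof -
    have "0 \<le> s i w * int (vy i)" "0 < t i w * int (vy (Suc i))" using cone[of w] that vy_pos[OF i] by simp_all
    then have "0 < D i * int (snd w)" unfolding cramer by simp
    then show ?thesis using D_pos[OF i] by (simp add: zero_less_mult_iff)
  qed
  have v_fst: "0 < fst w" if "fps2_coeff v w \<noteq> 0" for w
  proof -
    have "0 < s i w * int (vx i) + t i w * int (vx (Suc i))"
    proof (cases "Suc i = k")
      case False
      then have "0 < vx (Suc i)" using i vx_pos[of "Suc i"] by simp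
      then show ?thesis using cone[of w] that by (intro add_nonneg_pos) auto
    next
      case True
      have "poly.coeff V (snd w) \<noteq> 0" using that by (auto simp: v_def split: if_splits)
      then have "P * snd w < N * vy (Suc i)" using V True unfolding hi'_iff by blast
      then have "0 < s i w" using line_cone(4)[OF i, of w] uv[of w] that by simp
      then show ?thesis using vx_pos[OF i] cone[of w] that by (intro add_pos_nonneg) auto
    qed
    then have "0 < D i * int (fst w)" unfolding cramer .
    then show ?thesis using D_pos[OF i] by (simp add: zero_less_mult_iff)
  qed
  have vyP: "b i * vy (Suc i) \<le> P" using edge_end[OF i] by (simp add: wt_def)
  \<comment> \<open>The condition under which \<open>coeff_edge_poly_Abs_mult\<close> permits the
    lift to the line of weight \<open>N\<close>.\<close>
  have bN: "b i * y \<le> N" if "y \<le> hi" for y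
  proof -
    have "P * (b i * y) \<le> b i * (N * vy (Suc i))" using that unfolding hi_iff by simp
    also have "\<dots> = N * (b i * vy (Suc i))" by simp
    also have "\<dots> \<le> N * P" using vyP by simp
    finally show ?thesis using Pp by (simp add: mult.commute)
  qed
  have on_line: "fps2_coeff (u * g + v * h) w = (if w = z then 1 else 0)" if w: "W i w = N + P" for w
  proof -
    have "fps2_coeff (u * g + v * h) w =
        poly.coeff (edge_poly (a i) (b i) N u * G i + edge_poly (a i) (b i) N v * H i) (snd w)"
      by (rule coeff_combination[OF i w]) (use uv in auto)
    also have "\<dots> = poly.coeff (U * G i + V * H i) (snd w)"
      unfolding coeff_add G_def H_def u_def v_def
      by (intro arg_cong2[of _ _ _ _ "(+)"] coeff_edge_poly_Abs_mult[OF ab])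
         (use w U V bN in \<open>auto simp: W_def\<close>)
    also have "\<dots> = (if snd w = r then 1 else 0)" by (simp add: UV eq_commute)
    also have "snd w = r \<longleftrightarrow> w = z"
      using wt_eq_snd_inj[OF ab(1), of "b i" w z] w Wz unfolding W_def r_def by auto
    finally show ?thesis .
  qed
  have rest: "M z < M w \<or> M z = M w \<and> idx z < idx w"
    if nz: "fps2_coeff (fps2_monom z - (u * g + v * h)) w \<noteq> 0" for w
  proof -
    have Ww: "W i w \<noteq> N + P" using nz on_line[of w] by (auto simp: fps2_coeff_monom)
    then have "w \<noteq> z" using Wz by auto
    then have "fps2_coeff (u * g) w \<noteq> 0 \<or> fps2_coeff (v * h) w \<noteq> 0"
      using nz by (auto simp: fps2_coeff_monom)
    then obtain x y where xy: "w = x + y" "fps2_coeff u x \<noteq> 0 \<or> fps2_coeff v x \<noteq> 0"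
      "fps2_coeff g y \<noteq> 0 \<or> fps2_coeff h y \<noteq> 0"
      by (metis fps2_coeff_mult_nonzero)
    have x: "0 < t i x" "0 \<le> s i x" "M x = N" "W i x = N" using cone[OF xy(2)] uv[OF xy(2)] by auto
    have y: "P \<le> M y" "\<And>j. j < k \<Longrightarrow> P \<le> W j y" using supp_gh_M[OF xy(3)] supp_gh_ge[OF xy(3)] by auto
    have ge: "M z \<le> M w" using M_add[of x y] x(3) y(1) unfolding xy(1) Mz' by simp
    show ?thesis
    proof (cases "M w = M z")
      case False
      then show ?thesis using ge by simp
    next
      case True
      define j where "j = idx w"
      have j: "j < k" "W j w = N + P" using idx[of w] True Mz' by (simp_all add: j_def)
      have "W j x = N" using j(2) y(2)[OF j(1)] M_le[OF j(1), of x] x(3) unfolding xy(1) W_add by simp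
      \<comment> \<open>\<open>D i * (W j x - W i x)\<close> is a sum of two nonnegative terms in
        the coordinates of \<open>x\<close>. As \<open>t i x > 0\<close>, its vanishing puts vertex
        \<open>Suc i\<close> on edge \<open>j\<close>. Cone \<open>i\<close> is excluded because the
        combination is exact on its line, so a term that keeps the level moves to the next
        cone.\<close>
      then have "D i * int (W j x) = D i * int (W i x)" using x(4) by simp
      then have "s i x * (int (wt (a j) (b j) (vertex i)) - int P) +
          t i x * (int (wt (a j) (b j) (vertex (Suc i))) - int P) = 0"
        unfolding D_W[OF i] unfolding W_def D_wt by (simp add: algebra_simps)
      moreover have "0 \<le> s i x * (int (wt (a j) (b j) (vertex i)) - int P)"
        using x(2) vertex_ge[OF j(1), of i] i by simp
      moreover have "0 \<le> int (wt (a j) (b j) (vertex (Suc i))) - int P"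
        using vertex_ge[OF j(1), of "Suc i"] i by simp
      ultimately have "\<not> 0 < int (wt (a j) (b j) (vertex (Suc i))) - int P"
        using mult_pos_pos[OF x(1)] by fastforce
      then have "wt (a j) (b j) (vertex (Suc i)) = P"
        using vertex_ge[OF j(1), of "Suc i"] i by simp
      then have "j = i \<or> j = Suc i" using vertex_eq[OF j(1), of "Suc i"] i by auto
      moreover have "j \<noteq> i" using Ww j(2) by auto
      ultimately show ?thesis using True by (simp add: i_def j_def)
    qed
  qed
  show ?thesis
    using u_snd v_fst cone rest unfolding Mz' by (intro exI[of _ u] exI[of _ v]) metis
qed

end

section \<open>The dimension of the Milnor algebra\<close>

context kouchnirenko
begin

text \<open>\<open>T\<close> is cut out by the level after multiplication by xy, \<open>U1\<close>
  and \<open>U2\<close> by the levels after multiplication by y and by x, the factors that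
  \<open>xy_combination\<close> attaches to the two multipliers.\<close>

definition "T = {z. M (z + (1, 1)) < 2 * P}"
definition "U1 = {z. M (z + (0, 1)) < P}"
definition "U2 = {z. M (z + (1, 0)) < P}"

lemma M_mono: "M z \<le> M (z + w)"
  using M_add[of z w] by simp

lemma finite_T: "finite T" and finite_U1: "finite U1" and finite_U2: "finite U2"
  unfolding T_def U1_def U2_def
  by (rule finite_subset[OF _ finite_M_less]; use M_mono le_less_trans in blast)+

definition trunc :: "(nat \<times> nat) set \<Rightarrow> 'k fps fps \<Rightarrow> 'k fps fps" where
  "trunc A w = Abs_fps2 (\<lambda>z. if z \<in> A then fps2_coeff w z else 0)"

lemma trunc_eq_sum: "finite A \<Longrightarrow> trunc A w = (\<Sum>z\<in>A. fps2_const (fps2_coeff w z) * fps2_monom z)"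
  by (rule fps2_eqI) (simp add: trunc_def fps2_coeff_monom if_distrib sum.delta cong: if_cong)

lemma trunc_linear: "trunc A (v + w) = trunc A v + trunc A w" "trunc A (fps2_const c * w) = fps2_const c * trunc A w"
  by (rule fps2_eqI; simp add: trunc_def)+

lemma trunc_sum: "trunc A (\<Sum>x\<in>B. F x) = (\<Sum>x\<in>B. trunc A (F x))"
  by (rule fps2_eqI) (simp add: trunc_def)

lemma xy_shift: "fps2_coeff (fps2_monom (1, 1) * w) (z + (1, 1)) = fps2_coeff w z"
  by (simp add: fps2_coeff_monom_mult fps2_below_def fps2_minus_def)

lemma xy_combination:
  "fps2_monom (1, 1) * (u * fps2_dx f + v * fps2_dy f) =
     (fps2_monom (0, 1) * u) * g + (fps2_monom (1, 0) * v) * h"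
proof -
  have "fps2_monom (1, 1) = (fps2_monom (0, 1) * fps2_monom (1, 0) :: 'k fps fps)"
    by (simp add: fps2_monom_mult)
  then show ?thesis by (simp add: g_def h_def fps2_xdx_def fps2_ydy_def algebra_simps)
qed

lemma supp_dx: "fps2_coeff (fps2_dx f) z \<noteq> 0 \<Longrightarrow> P \<le> M (z + (1, 0))"
  using supp_ge[of "z + (1, 0)"] by (intro M_ge) (cases z, auto simp: fps2_coeff_dx)

lemma supp_dy: "fps2_coeff (fps2_dy f) z \<noteq> 0 \<Longrightarrow> P \<le> M (z + (0, 1))"
  using supp_ge[of "z + (0, 1)"] by (intro M_ge) (cases z, auto simp: fps2_coeff_dy)

abbreviation "J \<equiv> fps2_ideal {fps2_dx f, fps2_dy f}"

lemma high_mem_J: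
  assumes w: "\<And>z. fps2_coeff w z \<noteq> 0 \<Longrightarrow> z \<notin> T"
  shows "w \<in> J"
\<comment> \<open>As \<open>idx\<close> is less than \<open>k\<close>, the number
  \<open>k * M + idx\<close> orders pairs of level and cone lexicographically. In \<open>B\<close>
  the summand \<open>P\<close> is the difference of level between a monomial and its multipliers,
  and the final \<open>k\<close> absorbs the cone index.\<close>
proof (rule mem_fps2_ideal_by_approximation[where R = "\<lambda>z. z \<notin> T"
      and \<Phi> = "\<lambda>z. k * M (z + (1, 1)) + idx (z + (1, 1))" and B = "\<lambda>z. k * (M (z + (1, 1)) + P) + k"])
  fix n
  have "M z \<le> n" if "k * M (z + (1, 1)) + idx (z + (1, 1)) = n" for z
  proof -
    have "M z \<le> M (z + (1, 1))" by (rule M_mono)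
    also have "\<dots> \<le> k * M (z + (1, 1))" using k_pos by simp
    finally show ?thesis using that by simp
  qed
  then have "{z. z \<notin> T \<and> k * M (z + (1, 1)) + idx (z + (1, 1)) = n} \<subseteq> {z. M z < Suc n}"
    by (auto simp: less_Suc_eq_le)
  then show "finite {z. z \<notin> T \<and> k * M (z + (1, 1)) + idx (z + (1, 1)) = n}"
    by (rule finite_subset[OF _ finite_M_less])
next
  fix z assume "z \<notin> T"
  define z' where "z' = z + (1, 1)"
  have z': "0 < fst z'" "0 < snd z'" "2 * P \<le> M z'" using \<open>z \<notin> T\<close> by (auto simp: z'_def T_def)
  obtain u' v' where u': "\<And>w. fps2_coeff u' w \<noteq> 0 \<Longrightarrow> 0 < snd w \<and> M w + P = M z'"
    and v': "\<And>w. fps2_coeff v' w \<noteq> 0 \<Longrightarrow> 0 < fst w \<and> M w + P = M z'"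
    and uv': "\<And>w. fps2_coeff (fps2_monom z' - (u' * g + v' * h)) w \<noteq> 0 \<Longrightarrow>
        M z' < M w \<or> M z' = M w \<and> idx z' < idx w"
    using monom_reduction[OF z'] by blast
  \<comment> \<open>\<open>u'\<close> is divisible by y and \<open>v'\<close> by x, so the
    multipliers of \<open>g\<close> and \<open>h\<close> descend to multipliers of the partial
    derivatives.\<close>
  define u where "u = Abs_fps2 (\<lambda>w. fps2_coeff u' (w + (0, 1)))"
  define v where "v = Abs_fps2 (\<lambda>w. fps2_coeff v' (w + (1, 0)))"
  have uu: "u' = fps2_monom (0, 1) * u"
  proof (rule fps2_eqI)
    fix w show "fps2_coeff u' w = fps2_coeff (fps2_monom (0, 1) * u) w"
      using u'[of w] by (cases w) (auto simp: u_def fps2_coeff_monom_mult fps2_below_def fps2_minus_def Suc_le_eq)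
  qed
  have vv: "v' = fps2_monom (1, 0) * v"
  proof (rule fps2_eqI)
    fix w show "fps2_coeff v' w = fps2_coeff (fps2_monom (1, 0) * v) w"
      using v'[of w] by (cases w) (auto simp: v_def fps2_coeff_monom_mult fps2_below_def fps2_minus_def Suc_le_eq)
  qed
  have eq: "fps2_monom z' - (u' * g + v' * h) =
      fps2_monom (1, 1) * (fps2_monom z - (u * fps2_dx f + v * fps2_dy f))"
    unfolding uu vv right_diff_distrib xy_combination fps2_monom_mult z'_def by (simp add: add.commute)
  show "\<exists>u v. (\<forall>a. fps2_coeff u a \<noteq> 0 \<or> fps2_coeff v a \<noteq> 0 \<longrightarrow>
                k * M (z + (1, 1)) + idx (z + (1, 1)) \<le> k * (M (a + (1, 1)) + P) + k) \<and>
         (\<forall>a. fps2_coeff (fps2_monom z - (u * fps2_dx f + v * fps2_dy f)) a \<noteq> 0 \<longrightarrow>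
              a \<notin> T \<and> k * M (z + (1, 1)) + idx (z + (1, 1)) < k * M (a + (1, 1)) + idx (a + (1, 1)))"
  proof (rule exI[of _ u], rule exI[of _ v], intro conjI allI impI)
    fix a assume a: "fps2_coeff u a \<noteq> 0 \<or> fps2_coeff v a \<noteq> 0"
    have "M z' \<le> M (a + (1, 1)) + P"
    proof (cases "fps2_coeff u a = 0")
      case False
      then have "M (a + (0, 1)) + P = M z'" using u'[of "a + (0, 1)"] by (simp add: u_def)
      moreover have "M (a + (0, 1)) \<le> M (a + (0, 1) + (1, 0))" by (rule M_mono)
      ultimately show ?thesis by (simp add: add.assoc)
    next
      case True
      then have "M (a + (1, 0)) + P = M z'" using v'[of "a + (1, 0)"] a by (simp add: v_def)
      moreover have "M (a + (1, 0)) \<le> M (a + (1, 0) + (0, 1))" by (rule M_mono)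
      ultimately show ?thesis by (simp add: add.assoc)
    qed
    then have "k * M z' \<le> k * (M (a + (1, 1)) + P)" by simp
    then show "k * M (z + (1, 1)) + idx (z + (1, 1)) \<le> k * (M (a + (1, 1)) + P) + k"
      using idx(1)[of z'] unfolding z'_def by linarith
  next
    fix a assume a: "fps2_coeff (fps2_monom z - (u * fps2_dx f + v * fps2_dy f)) a \<noteq> 0"
    then have "fps2_coeff (fps2_monom z' - (u' * g + v' * h)) (a + (1, 1)) \<noteq> 0"
      unfolding eq xy_shift .
    then have lt: "M z' < M (a + (1, 1)) \<or> M z' = M (a + (1, 1)) \<and> idx z' < idx (a + (1, 1))" by (rule uv')
    then show "a \<notin> T" using z'(3) by (auto simp: T_def)
    have "k * Suc (M z') \<le> k * M (a + (1, 1))" if "M z' < M (a + (1, 1))"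
      using that by (intro mult_le_mono2) simp
    then show "k * M (z + (1, 1)) + idx (z + (1, 1)) < k * M (a + (1, 1)) + idx (a + (1, 1))"
      using lt idx(1)[of z'] unfolding z'_def[symmetric] by auto
  qed
qed (use w in blast)

text \<open>Levels add up: at least \<open>P\<close> from \<open>u\<close> shifted by y and at least
  \<open>P\<close> from the derivative shifted by x put the product outside
  \<open>T\<close>.\<close>

lemma trunc_mult_dx:
  assumes "\<And>z. fps2_coeff u z \<noteq> 0 \<Longrightarrow> z \<notin> U1"
  shows "trunc T (u * fps2_dx f) = 0"
proof (rule fps2_eqI)
  fix z
  have "z \<notin> T" if nz: "fps2_coeff (u * fps2_dx f) z \<noteq> 0"
  proof -
    obtain x y where xy: "z = x + y" "fps2_coeff u x \<noteq> 0" "fps2_coeff (fps2_dx f) y \<noteq> 0"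
      using nz by (rule fps2_coeff_mult_nonzero)
    have "P \<le> M (x + (0, 1))" using assms[OF xy(2)] by (simp add: U1_def)
    moreover have "z + (1, 1) = (x + (0, 1)) + (y + (1, 0))" by (simp add: xy(1) prod_eq_iff)
    ultimately show ?thesis using M_add[of "x + (0, 1)" "y + (1, 0)"] supp_dx[OF xy(3)]
      by (simp add: T_def)
  qed
  then show "fps2_coeff (trunc T (u * fps2_dx f)) z = fps2_coeff 0 z" by (auto simp: trunc_def)
qed

lemma trunc_mult_dy:
  assumes "\<And>z. fps2_coeff u z \<noteq> 0 \<Longrightarrow> z \<notin> U2"
  shows "trunc T (u * fps2_dy f) = 0"
proof (rule fps2_eqI)
  fix z
  have "z \<notin> T" if nz: "fps2_coeff (u * fps2_dy f) z \<noteq> 0"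
  proof -
    obtain x y where xy: "z = x + y" "fps2_coeff u x \<noteq> 0" "fps2_coeff (fps2_dy f) y \<noteq> 0"
      using nz by (rule fps2_coeff_mult_nonzero)
    have "P \<le> M (x + (1, 0))" using assms[OF xy(2)] by (simp add: U2_def)
    moreover have "z + (1, 1) = (x + (1, 0)) + (y + (0, 1))" by (simp add: xy(1) prod_eq_iff)
    ultimately show ?thesis using M_add[of "x + (1, 0)" "y + (0, 1)"] supp_dy[OF xy(3)]
      by (simp add: T_def)
  qed
  then show "fps2_coeff (trunc T (u * fps2_dy f)) z = fps2_coeff 0 z" by (auto simp: trunc_def)
qed

definition gens :: "nat \<times> nat + nat \<times> nat \<Rightarrow> 'k fps fps" where
  "gens x = trunc T (case x of Inl z \<Rightarrow> fps2_monom z * fps2_dx f | Inr z \<Rightarrow> fps2_monom z * fps2_dy f)"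

text \<open>Multiplied by xy, a linear relation becomes a relation between \<open>g\<close> and
  \<open>h\<close> up to level \<open>2 * P\<close> with multipliers of level below
  \<open>P\<close>, to which \<open>no_low_syzygies\<close> applies.\<close>

lemma gens_independent:
  "inj_on gens (Sum_Type.Plus U1 U2) \<and> fps2.independent (gens ` (Sum_Type.Plus U1 U2))"
proof (rule fps2.independent_image_of_family)
  show "finite (Sum_Type.Plus U1 U2)" using finite_U1 finite_U2 by simp
  fix c assume c: "(\<Sum>x\<in>Sum_Type.Plus U1 U2. fps2_const (c x) * gens x) = 0"
  define u where "u = (\<Sum>z\<in>U1. fps2_const (c (Inl z)) * fps2_monom z)"
  define v where "v = (\<Sum>z\<in>U2. fps2_const (c (Inr z)) * fps2_monom z)"
  have cu: "fps2_coeff u z = (if z \<in> U1 then c (Inl z) else 0)" for z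
    using finite_U1 by (simp add: u_def fps2_coeff_monom if_distrib sum.delta cong: if_cong)
  have cv: "fps2_coeff v z = (if z \<in> U2 then c (Inr z) else 0)" for z
    using finite_U2 by (simp add: v_def fps2_coeff_monom if_distrib sum.delta cong: if_cong)
  have "trunc T (u * fps2_dx f + v * fps2_dy f) = (\<Sum>x\<in>Sum_Type.Plus U1 U2. fps2_const (c x) * gens x)"
    using finite_U1 finite_U2
    by (simp add: u_def v_def sum_distrib_right mult.assoc trunc_linear trunc_sum sum.Plus gens_def)
  then have 0: "trunc T (u * fps2_dx f + v * fps2_dy f) = 0" using c by simp
  have 00: "fps2_coeff (u * fps2_dx f + v * fps2_dy f) z = 0" if "z \<in> T" for z
    using arg_cong[OF 0, of "\<lambda>w. fps2_coeff w z"] that by (simp add: trunc_def)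
  have "fps2_monom (0, 1) * u = 0 \<and> fps2_monom (1, 0) * v = 0"
  proof (rule no_low_syzygies)
    fix z assume "fps2_coeff (fps2_monom (0, 1) * u) z \<noteq> 0"
    then have "1 \<le> snd z" "fps2_minus z (0, 1) \<in> U1"
      by (auto simp: fps2_coeff_monom_mult cu fps2_below_def split: if_splits)
    moreover have "fps2_minus z (0, 1) + (0, 1) = z" using calculation(1)
      by (simp add: fps2_minus_def prod_eq_iff)
    ultimately show "M z < P" by (simp add: U1_def)
  next
    fix z assume "fps2_coeff (fps2_monom (1, 0) * v) z \<noteq> 0"
    then have "1 \<le> fst z" "fps2_minus z (1, 0) \<in> U2"
      by (auto simp: fps2_coeff_monom_mult cv fps2_below_def split: if_splits)
    moreover have "fps2_minus z (1, 0) + (1, 0) = z" using calculation(1)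
      by (simp add: fps2_minus_def prod_eq_iff)
    ultimately show "M z < P" by (simp add: U2_def)
  next
    fix z assume z: "M z < 2 * P"
    show "fps2_coeff (fps2_monom (0, 1) * u * g + fps2_monom (1, 0) * v * h) z = 0"
    proof (cases "(1, 1) \<in> fps2_below z")
      case True
      then have "fps2_minus z (1, 1) + (1, 1) = z"
        by (simp add: fps2_below_def fps2_minus_def prod_eq_iff)
      then have "fps2_minus z (1, 1) \<in> T" using z by (simp add: T_def)
      from 00[OF this] show ?thesis
        unfolding xy_combination[symmetric] fps2_coeff_monom_mult by simp
    next
      case False
      then show ?thesis unfolding xy_combination[symmetric] fps2_coeff_monom_mult by simp
    qed
  qed
  moreover have "fps2_monom a \<noteq> (0 :: 'k fps fps)" for a
    using fps2_coeff_monom[of a a] by (metis fps2_coeff_0 zero_neq_one)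
  ultimately have "u = 0" "v = 0" by auto
  then have "c (Inl z) = 0" if "z \<in> U1" for z using cu[of z] that by simp
  moreover have "c (Inr z) = 0" if "z \<in> U2" for z using cv[of z] that \<open>v = 0\<close> by simp
  ultimately show "\<forall>x\<in>Sum_Type.Plus U1 U2. c x = 0" by auto
qed

text \<open>Modulo the ideal everything reduces to the span of the monomials in \<open>T\<close>,
  and within that span the ideal is the span of the independent family \<open>gens\<close>.
  Extending this family to a basis and removing it again leaves a basis \<open>C\<close> of the
  Milnor algebra.\<close>

theorem milnor_number_eq_card:
  "milnor_number f = enat (card T - (card U1 + card U2)) \<and> card U1 + card U2 \<le> card T"
proof -
  define E where "E = (fps2_monom ` T :: 'k fps fps set)"
  define I1 where "I1 = gens ` (Sum_Type.Plus U1 U2)"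
  have I: "ideal J ring_of_type_algebra" by (rule ideal_fps2_ideal)
  have fE: "finite E" and iE: "fps2.independent E" using finite_T independent_monom by (auto simp: E_def)
  have cE: "card E = card T" unfolding E_def by (rule card_image) (rule inj_on_subset[OF inj_monom], simp)
  have trunc_E: "trunc T w \<in> fps2.span E" for w
    unfolding trunc_eq_sum[OF finite_T] E_def
    by (intro fps2.span_sum fps2.span_scale fps2.span_base) auto
  have E_trunc: "trunc T w = w" if "w \<in> fps2.span E" for w
    by (rule fps2_eqI) (use span_monom_coeff[of w T] that in \<open>auto simp: trunc_def E_def\<close>)
  have I1E: "I1 \<subseteq> fps2.span E" using trunc_E by (auto simp: I1_def gens_def)
  have cI1: "card I1 = card U1 + card U2" and iI1: "fps2.independent I1" and fI1: "finite I1"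
    using gens_independent finite_U1 finite_U2 by (auto simp: I1_def card_image card_Plus)
  obtain B where B: "I1 \<subseteq> B" "B \<subseteq> fps2.span E" "fps2.independent B" "fps2.span E \<subseteq> fps2.span B"
    using fps2.maximal_independent_subset_extend[OF I1E iI1] by blast
  have fB: "finite B" using fps2.independent_span_bound[OF fE B(3,2)] by simp
  have cB: "card B = card T"
    using fps2.basis_card_eq_dim[OF B(2,4,3)] fps2.dim_span_eq_card_independent[OF iE] cE by simp
  define C where "C = B - I1"
  have CE: "C \<subseteq> fps2.span E" using B(2) by (auto simp: C_def)
  have cC: "card C = card T - (card U1 + card U2)"
    using cB cI1 B(1) fI1 by (simp add: C_def card_Diff_subset)
  have le: "card U1 + card U2 \<le> card T" using card_mono[OF fB B(1)] cB cI1 by simp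
  have sub_J: "trunc T w \<in> J \<longleftrightarrow> w \<in> J" for w
  proof -
    have "w - trunc T w \<in> J" by (rule high_mem_J) (auto simp: trunc_def split: if_splits)
    then show ?thesis
      using ideal_type_algebra(2,5)[OF I, of "w - trunc T w" "trunc T w"]
        ideal_type_algebra(5)[OF I, of w "w - trunc T w"] by auto
  qed
  have gens_J: "I1 \<subseteq> J"
  proof -
    have "fps2_dx f \<in> J" "fps2_dy f \<in> J" using fps2_ideal_generators[of "{fps2_dx f, fps2_dy f}"] by auto
    then show ?thesis
      using ideal_type_algebra(3)[OF I] sub_J by (auto simp: I1_def gens_def split: sum.split)
  qed
  have C_J: "fps2.span C \<inter> J \<subseteq> {0}"
  proof
    fix w assume w: "w \<in> fps2.span C \<inter> J"
    then obtain u v where uv: "w = u * fps2_dx f + v * fps2_dy f" by (auto simp: fps2_ideal_pair)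
    have "w \<in> fps2.span E" using w fps2.span_mono[OF CE] unfolding fps2.span_span by auto
    then have "w = trunc T (u * fps2_dx f + v * fps2_dy f)" using E_trunc uv by simp
    \<comment> \<open>Parts of the multipliers outside \<open>U1\<close> and \<open>U2\<close> do
      not survive the truncation, which leaves a combination of the finitely many
      \<open>gens\<close>.\<close>
    also have "\<dots> = trunc T (trunc U1 u * fps2_dx f) + trunc T ((u - trunc U1 u) * fps2_dx f) +
        (trunc T (trunc U2 v * fps2_dy f) + trunc T ((v - trunc U2 v) * fps2_dy f))"
      by (simp only: left_diff_distrib flip: trunc_linear(1)) simp
    also have "trunc T ((u - trunc U1 u) * fps2_dx f) = 0"
      by (rule trunc_mult_dx) (auto simp: trunc_def split: if_splits)
    also have "trunc T ((v - trunc U2 v) * fps2_dy f) = 0"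
      by (rule trunc_mult_dy) (auto simp: trunc_def split: if_splits)
    also have "trunc T (trunc U1 u * fps2_dx f) = (\<Sum>z\<in>U1. fps2_const (fps2_coeff u z) * gens (Inl z))"
      by (simp add: trunc_eq_sum[OF finite_U1] sum_distrib_right mult.assoc trunc_linear trunc_sum gens_def)
    also have "trunc T (trunc U2 v * fps2_dy f) = (\<Sum>z\<in>U2. fps2_const (fps2_coeff v z) * gens (Inr z))"
      by (simp add: trunc_eq_sum[OF finite_U2] sum_distrib_right mult.assoc trunc_linear trunc_sum gens_def)
    finally have "w = (\<Sum>z\<in>U1. fps2_const (fps2_coeff u z) * gens (Inl z)) +
        (\<Sum>z\<in>U2. fps2_const (fps2_coeff v z) * gens (Inr z))" by simp
    moreover have "\<dots> \<in> fps2.span I1" unfolding I1_def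
      by (intro fps2.span_add fps2.span_sum fps2.span_scale fps2.span_base) auto
    moreover have "fps2.span C \<inter> fps2.span I1 \<subseteq> {0}"
      by (rule fps2.span_disjoint_independent) (use B in \<open>auto simp: C_def Un_absorb2\<close>)
    ultimately show "w \<in> {0}" using w by auto
  qed
  have span: "\<exists>c\<in>fps2.span C. w - c \<in> J" for w
  proof -
    have "B = C \<union> I1" using B(1) by (auto simp: C_def)
    moreover have "trunc T w \<in> fps2.span B" using trunc_E B(4) by auto
    ultimately obtain c e where ce: "trunc T w = c + e" "c \<in> fps2.span C" "e \<in> fps2.span I1"
      by (auto simp: fps2.span_Un)
    have "e \<in> J" using ce(3) fps2.span_minimal[OF gens_J fps2_ideal_subspace[OF I]] by auto
    moreover have "w - trunc T w \<in> J" by (rule high_mem_J) (auto simp: trunc_def split: if_splits)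
    moreover have "w - c = (w - trunc T w) + e" using ce(1) by simp
    ultimately show ?thesis using ideal_type_algebra(2)[OF I] ce(2) by metis
  qed
  have "fps2_codim J = enat (card C)"
    by (rule fps2_codim_eq_card[OF I _ _ C_J span])
       (use fB B(3) fps2.independent_mono[of B C] in \<open>auto simp: C_def\<close>)
  then show ?thesis using cC le by (simp add: milnor_number_def)
qed

end

section \<open>Counting lattice points\<close>

text \<open>Write p = c p' with p' primitive and complete p' by r to a basis of the lattice. At the
  point l p' + \<mu> r the two linear forms take the values c \<mu> and l \<delta> + \<mu> e. So
  \<mu> runs through \<delta> values and, for each of them, l through c consecutive integers, which
  makes c \<delta> = d points.\<close>

lemma card_parallelogram:
  fixes p1 p2 q1 q2 :: int
  defines "d \<equiv> p1 * q2 - q1 * p2"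
  assumes d: "0 < d"
  shows "finite {(x, y). 0 < p1 * y - p2 * x \<and> p1 * y - p2 * x \<le> d \<and> 0 \<le> x * q2 - q1 * y \<and> x * q2 - q1 * y < d}
    \<and> int (card {(x, y). 0 < p1 * y - p2 * x \<and> p1 * y - p2 * x \<le> d \<and> 0 \<le> x * q2 - q1 * y \<and> x * q2 - q1 * y < d}) = d"
    (is "finite ?S \<and> _")
proof -
  define c where "c = gcd p1 p2"
  have "p1 \<noteq> 0 \<or> p2 \<noteq> 0" using d by (auto simp: d_def)
  then have c: "0 < c" by (simp add: c_def)
  define p1' p2' where "p1' = p1 div c" and "p2' = p2 div c"
  have p: "p1 = c * p1'" "p2 = c * p2'" by (simp_all add: p1'_def p2'_def c_def)
  obtain u v where uv: "u * p1 + v * p2 = c" using bezout_int[of p1 p2] unfolding c_def by auto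
  define r1 r2 where "r1 = - v" and "r2 = u"
  have "c * (p1' * r2 - p2' * r1) = c * 1" using uv by (simp add: p r1_def r2_def algebra_simps)
  then have uni: "p1' * r2 - p2' * r1 = 1" using c by simp
  define \<delta> e where "\<delta> = p1' * q2 - q1 * p2'" and "e = r1 * q2 - q1 * r2"
  have d\<delta>: "d = c * \<delta>" by (simp add: d_def \<delta>_def p algebra_simps)
  then have \<delta>: "0 < \<delta>" using d c by (simp add: zero_less_mult_iff)
  define F where "F = (\<lambda>(\<mu>, l). (l * p1' + \<mu> * r1, l * p2' + \<mu> * r2))"
  \<comment> \<open>\<open>-(\<mu> * e div \<delta>)\<close> is the least \<open>l\<close> with
    \<open>0 \<le> l * \<delta> + \<mu> * e\<close>, and \<open>c\<close> further steps raise that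
    value by \<open>d\<close>.\<close>
  define L where "L = Sigma {0<..\<delta>} (\<lambda>\<mu>. {-(\<mu> * e div \<delta>)..<-(\<mu> * e div \<delta>) + c})"
  have t: "p1 * (l * p2' + \<mu> * r2) - p2 * (l * p1' + \<mu> * r1) = c * \<mu>" for l \<mu>
  proof -
    have "p1 * (l * p2' + \<mu> * r2) - p2 * (l * p1' + \<mu> * r1) = c * \<mu> * (p1' * r2 - p2' * r1)"
      unfolding p by (simp add: algebra_simps)
    then show ?thesis by (simp add: uni)
  qed
  have s: "(l * p1' + \<mu> * r1) * q2 - q1 * (l * p2' + \<mu> * r2) = l * \<delta> + \<mu> * e" for l \<mu>
    by (simp add: \<delta>_def e_def algebra_simps)
  have in_S: "F (\<mu>, l) \<in> ?S \<longleftrightarrow> (\<mu>, l) \<in> L" for \<mu> l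
  proof -
    have nonneg: "0 \<le> m * \<delta> + \<mu> * e \<longleftrightarrow> -(\<mu> * e div \<delta>) \<le> m" for m
    proof -
      have "-(\<mu> * e div \<delta>) \<le> m \<longleftrightarrow> - m \<le> \<mu> * e div \<delta>" by linarith
      also have "\<dots> \<longleftrightarrow> - m * \<delta> \<le> \<mu> * e" 
      proof
        assume "- m \<le> \<mu> * e div \<delta>"
        then have "- m * \<delta> \<le> \<mu> * e div \<delta> * \<delta>" using \<delta> by (intro mult_right_mono) auto
        also have "\<dots> \<le> \<mu> * e" using \<delta> pos_mod_sign[of \<delta> "\<mu> * e"] div_mult_mod_eq[of "\<mu> * e" \<delta>] by linarith
        finally show "- m * \<delta> \<le> \<mu> * e" .
      next
        assume "- m * \<delta> \<le> \<mu> * e"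
        from zdiv_mono1[OF this \<delta>] show "- m \<le> \<mu> * e div \<delta>"
          using \<delta> nonzero_mult_div_cancel_right[of \<delta> "- m"] by simp
      qed
      finally show ?thesis by (simp add: algebra_simps) linarith
    qed
    have 1: "0 < c * \<mu> \<and> c * \<mu> \<le> d \<longleftrightarrow> \<mu> \<in> {0<..\<delta>}"
      using c by (simp add: d\<delta> zero_less_mult_iff)
    have "l * \<delta> + \<mu> * e < d \<longleftrightarrow> \<not> 0 \<le> (l - c) * \<delta> + \<mu> * e"
      unfolding d\<delta> by (simp add: algebra_simps) linarith
    then have "0 \<le> l * \<delta> + \<mu> * e \<and> l * \<delta> + \<mu> * e < d \<longleftrightarrow> l \<in> {-(\<mu> * e div \<delta>)..<-(\<mu> * e div \<delta>) + c}"
      unfolding nonneg by auto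
    moreover have "F (\<mu>, l) \<in> ?S \<longleftrightarrow> (0 < c * \<mu> \<and> c * \<mu> \<le> d) \<and> (0 \<le> l * \<delta> + \<mu> * e \<and> l * \<delta> + \<mu> * e < d)"
      by (simp only: F_def mem_Collect_eq case_prod_conv t s conj_assoc)
    ultimately show ?thesis unfolding 1 by (simp only: L_def mem_Sigma_iff)
  qed
  have inj: "inj F"
  proof (rule injI)
    fix x y assume xy: "F x = F y"
    obtain \<mu> l \<mu>' l' where x: "x = (\<mu>, l)" and y: "y = (\<mu>', l')" by (metis surj_pair)
    have 1: "l * p1' + \<mu> * r1 = l' * p1' + \<mu>' * r1" and 2: "l * p2' + \<mu> * r2 = l' * p2' + \<mu>' * r2"
      using xy by (auto simp: F_def x y)
    have "c * \<mu> = c * \<mu>'" unfolding t[symmetric, of _ l] unfolding 1 2 t ..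
    moreover have "l * \<delta> + \<mu> * e = l' * \<delta> + \<mu>' * e" unfolding s[symmetric] 1 2 ..
    ultimately show "x = y" using c \<delta> by (simp add: x y)
  qed
  have surj: "\<exists>\<mu> l. F (\<mu>, l) = (x, y)" for x y
  proof (intro exI)
    have "(x * r2 - y * r1) * p1' + (p1' * y - p2' * x) * r1 = x * (p1' * r2 - p2' * r1)"
      "(x * r2 - y * r1) * p2' + (p1' * y - p2' * x) * r2 = y * (p1' * r2 - p2' * r1)"
      by (simp_all add: algebra_simps)
    then show "F (p1' * y - p2' * x, x * r2 - y * r1) = (x, y)" by (simp add: F_def uni)
  qed
  have S: "?S = F ` L"
  proof (intro equalityI subsetI)
    fix z assume z: "z \<in> ?S"
    obtain \<mu> l where "F (\<mu>, l) = z" using surj by (metis surj_pair)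
    then show "z \<in> F ` L" using in_S[of \<mu> l] z by force
  next
    fix z assume "z \<in> F ` L"
    then show "z \<in> ?S" using in_S by force
  qed
  have fin: "finite L" by (simp add: L_def)
  have "int (card ?S) = int (card L)" unfolding S using inj by (simp add: card_image inj_on_subset)
  also have "int (card L) = d" unfolding L_def using c \<delta> by (simp add: card_SigmaI d\<delta>)
  finally show ?thesis using fin S by simp
qed

context newton_fan
begin

lemma st_add: "s i (z + w) = s i z + s i w" "t i (z + w) = t i z + t i w"
  by (simp_all add: s_def t_def algebra_simps)

lemma st_vertex: "s i (vertex i) = D i" "t i (vertex i) = 0" "s i (vertex (Suc i)) = 0" "t i (vertex (Suc i)) = D i"
  by (simp_all add: s_def t_def D_def)

text \<open>A half-open triangle, scaled by \<open>n\<close>: the ray \<open>t = 0\<close> is left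
  out, so that neighbouring triangles do not overlap and none of them meets the x-axis.\<close>

definition cone_points :: "nat \<Rightarrow> int \<Rightarrow> (nat \<times> nat) set" where
  "cone_points i n = {z. 0 < t i z \<and> 0 \<le> s i z \<and> s i z + t i z < n * D i}"

lemma cone_points_eq: "i < k \<Longrightarrow> cone_points i (int n) = {z. 0 < snd z \<and> M z < n * P \<and> idx z = i}"
proof (intro equalityI subsetI)
  have M: "s i z + t i z < int n * D i \<longleftrightarrow> M z < n * P" if i: "i < k" and "W i z = M z" for z
  proof -
    have "s i z + t i z < int n * D i \<longleftrightarrow> (s i z + t i z) * int P < int n * D i * int P"
      using P_pos by simp
    also have "\<dots> \<longleftrightarrow> D i * int (W i z) < D i * (int n * int P)" unfolding D_W[OF i] by (simp add: mult_ac)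
    also have "\<dots> \<longleftrightarrow> int (W i z) < int (n * P)" using D_pos[OF i] by simp
    finally show ?thesis using that(2) by (simp only: of_nat_less_iff)
  qed
  fix z assume i: "i < k"
  { assume z: "z \<in> cone_points i (int n)"
    then have st: "0 < t i z" "0 \<le> s i z" by (auto simp: cone_points_def)
    have "0 \<le> s i z * int (vy i)" "0 < t i z * int (vy (Suc i))" using st vy_pos[OF i] by simp_all
    then have "0 < D i * int (snd z)" unfolding cramer by simp
    then have "0 < snd z" using D_pos[OF i] by (simp add: zero_less_mult_iff)
    moreover have "idx z = i" using idx_eqI[OF i] st by simp
    ultimately show "z \<in> {z. 0 < snd z \<and> M z < n * P \<and> idx z = i}"
      using M[OF i, of z] idx(2)[of z] z by (auto simp: cone_points_def) }
  { assume "z \<in> {z. 0 < snd z \<and> M z < n * P \<and> idx z = i}"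
    then show "z \<in> cone_points i (int n)"
      using idx_eq_iff[of z i] M[OF i, of z] idx(2)[of z] i by (auto simp: cone_points_def) }
qed

text \<open>The parallelogram lies in the first quadrant, so counting over the integers and over the
  naturals gives the same number.\<close>

lemma fundamental_points:
  assumes i: "i < k"
  shows "int (card {z. 0 < t i z \<and> t i z \<le> D i \<and> 0 \<le> s i z \<and> s i z < D i}) = D i"
proof -
  let ?A = "{z. 0 < t i z \<and> t i z \<le> D i \<and> 0 \<le> s i z \<and> s i z < D i}"
  let ?S = "{(x, y). 0 < int (vx i) * y - int (vy i) * x \<and> int (vx i) * y - int (vy i) * x \<le> D i \<and>
      0 \<le> x * int (vy (Suc i)) - int (vx (Suc i)) * y \<and> x * int (vy (Suc i)) - int (vx (Suc i)) * y < D i}"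
  let ?e = "\<lambda>z::nat \<times> nat. (int (fst z), int (snd z))"
  have "?S = ?e ` ?A"
  proof (intro equalityI subsetI)
    fix z assume z: "z \<in> ?S"
    obtain x y where xy: "z = (x, y)" by (metis surj_pair)
    define s' t' where "s' = x * int (vy (Suc i)) - int (vx (Suc i)) * y" and "t' = int (vx i) * y - int (vy i) * x"
    have st: "0 < t'" "t' \<le> D i" "0 \<le> s'" "s' < D i" using z by (auto simp: xy s'_def t'_def)
    have "D i * x = s' * int (vx i) + t' * int (vx (Suc i))" "D i * y = s' * int (vy i) + t' * int (vy (Suc i))"
      by (simp_all add: s'_def t'_def D_def algebra_simps)
    then have "0 \<le> D i * x" "0 \<le> D i * y" using st by simp_all
    then have "0 \<le> x" "0 \<le> y" using D_pos[OF i] by (simp_all add: zero_le_mult_iff)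
    then have z': "z = ?e (nat x, nat y)" by (simp add: xy)
    moreover have "(nat x, nat y) \<in> ?A" using z \<open>0 \<le> x\<close> \<open>0 \<le> y\<close> by (auto simp: xy s_def t_def)
    ultimately show "z \<in> ?e ` ?A" by blast
  next
    fix z assume "z \<in> ?e ` ?A"
    then show "z \<in> ?S" by (auto simp: s_def t_def)
  qed
  moreover have "inj_on ?e ?A" by (rule inj_onI) (simp add: prod_eq_iff)
  ultimately have "card ?S = card ?A" by (simp add: card_image)
  then show ?thesis
    using card_parallelogram[of "int (vx i)" "int (vy (Suc i))" "int (vx (Suc i))" "int (vy i)"] D_pos[OF i]
    unfolding D_def[symmetric] by simp
qed

lemma finite_cone_points: "i < k \<Longrightarrow> finite (cone_points i (int n))"
  by (rule finite_subset[OF _ finite_M_less[of "n * P"]]) (auto simp: cone_points_eq)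

text \<open>The doubled triangle is the disjoint union of the fundamental parallelogram and the
  translates of the triangle by its two vertices.\<close>

lemma card_cone_points:
  assumes i: "i < k"
  shows "int (card (cone_points i 2)) = 2 * int (card (cone_points i 1)) + D i"
proof -
  let ?A = "{z. 0 < t i z \<and> t i z \<le> D i \<and> 0 \<le> s i z \<and> s i z < D i}"
  let ?B = "(\<lambda>z. z + vertex i) ` cone_points i 1"
  let ?C = "(\<lambda>z. z + vertex (Suc i)) ` cone_points i 1"
  \<comment> \<open>Translating back by the vertex does not leave the first quadrant.\<close>
  have sub: "\<exists>w. z = w + vertex j" if "j = i \<and> D i \<le> s i z \<and> 0 < t i z \<or> j = Suc i \<and> 0 \<le> s i z \<and> D i < t i z" for z j
  proof -
    have "D i * int (c j) \<le> s i z * int (c i) + t i z * int (c (Suc i))" for c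
    proof (cases "j = i \<and> D i \<le> s i z \<and> 0 < t i z")
      case True
      then have "D i * int (c i) \<le> s i z * int (c i)" "0 \<le> t i z * int (c (Suc i))"
        by (simp_all add: mult_right_mono)
      then have "D i * int (c i) \<le> s i z * int (c i) + t i z * int (c (Suc i))" by linarith
      then show ?thesis using True by simp
    next
      case False
      then have "j = Suc i" "0 \<le> s i z" "D i < t i z" using that by auto
      then have "D i * int (c (Suc i)) \<le> t i z * int (c (Suc i))" "0 \<le> s i z * int (c i)"
        by (simp_all add: mult_right_mono)
      then have "D i * int (c (Suc i)) \<le> s i z * int (c i) + t i z * int (c (Suc i))" by linarith
      then show ?thesis using \<open>j = Suc i\<close> by simp
    qed
    then have "D i * int (vx j) \<le> D i * int (fst z)" "D i * int (vy j) \<le> D i * int (snd z)"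
      unfolding cramer by blast+
    then have "vx j \<le> fst z" "vy j \<le> snd z" using D_pos[OF i] by simp_all
    then show ?thesis by (intro exI[of _ "(fst z - vx j, snd z - vy j)"]) (simp add: prod_eq_iff)
  qed
  have B: "?B = {z. 0 < t i z \<and> D i \<le> s i z \<and> s i z + t i z < 2 * D i}"
  proof (intro equalityI subsetI)
    fix z assume z: "z \<in> {z. 0 < t i z \<and> D i \<le> s i z \<and> s i z + t i z < 2 * D i}"
    then obtain w where "z = w + vertex i" using sub[of i z] by auto
    then show "z \<in> ?B" using z by (intro image_eqI[of _ _ w]) (auto simp: cone_points_def st_add st_vertex)
  next
    fix z assume "z \<in> ?B"
    then obtain w where "w \<in> cone_points i 1" "z = w + vertex i" by blast
    then show "z \<in> {z. 0 < t i z \<and> D i \<le> s i z \<and> s i z + t i z < 2 * D i}"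
      by (simp add: cone_points_def st_add st_vertex)
  qed
  have C: "?C = {z. D i < t i z \<and> 0 \<le> s i z \<and> s i z + t i z < 2 * D i}"
  proof (intro equalityI subsetI)
    fix z assume z: "z \<in> {z. D i < t i z \<and> 0 \<le> s i z \<and> s i z + t i z < 2 * D i}"
    then obtain w where "z = w + vertex (Suc i)" using sub[of "Suc i" z] by auto
    then show "z \<in> ?C" using z by (intro image_eqI[of _ _ w]) (auto simp: cone_points_def st_add st_vertex)
  next
    fix z assume "z \<in> ?C"
    then obtain w where "w \<in> cone_points i 1" "z = w + vertex (Suc i)" by blast
    then show "z \<in> {z. D i < t i z \<and> 0 \<le> s i z \<and> s i z + t i z < 2 * D i}"
      by (simp add: cone_points_def st_add st_vertex)
  qed
  have 2: "cone_points i 2 = ?A \<union> (?B \<union> ?C)"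
    unfolding B C using D_pos[OF i] by (auto simp: cone_points_def)
  have fin: "finite (cone_points i 2)" "finite (cone_points i 1)"
    using finite_cone_points[OF i, of 2] finite_cone_points[OF i, of 1] by simp_all
  have "card (cone_points i 2) = card ?A + card (?B \<union> ?C)"
    unfolding 2 by (rule card_Un_disjoint) (use fin[unfolded 2] in \<open>auto simp: B C\<close>)
  also have "card (?B \<union> ?C) = card ?B + card ?C"
  proof (rule card_Un_disjoint)
    show "finite ?B" "finite ?C" using fin(2) by simp_all
    show "?B \<inter> ?C = {}" unfolding B C by auto
  qed
  also have "card ?B = card (cone_points i 1)" by (rule card_image) (simp add: inj_on_def)
  also have "card ?C = card (cone_points i 1)" by (rule card_image) (simp add: inj_on_def)
  finally show ?thesis using fundamental_points[OF i] by simp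
qed

lemma card_below:
  "int (card {z. 0 < snd z \<and> M z < 2 * P}) = 2 * int (card {z. 0 < snd z \<and> M z < P}) + (\<Sum>i<k. D i)"
proof -
  have eq: "{z. 0 < snd z \<and> M z < n * P} = (\<Union>i<k. cone_points i (int n))" for n
    using idx by (auto simp: cone_points_eq)
  have card: "card {z. 0 < snd z \<and> M z < n * P} = (\<Sum>i<k. card (cone_points i (int n)))" for n
    unfolding eq by (rule card_UN_disjoint) (use finite_cone_points in \<open>auto simp: cone_points_eq\<close>)
  show ?thesis using card[of 1] card[of 2] by (simp add: card_cone_points sum.distrib sum_distrib_left)
qed

lemma M_y_axis: "M (0, y) < n * P \<longleftrightarrow> y < n * vy k"
proof -
  obtain j where j: "k = Suc j" "j < k" using k_pos by (cases k) auto
  have "W j (0, y) = M (0, y)" by (rule W_eq_M[OF j(2)]) (use j vx_k in \<open>simp_all add: s_def t_def\<close>)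
  moreover have "P = b j * vy k" using edge_end[OF j(2)] vx_k by (simp add: wt_def flip: j(1))
  ultimately show ?thesis using b_pos[OF j(2)] by (simp add: W_def wt_def flip: \<open>W j (0, y) = M (0, y)\<close>) 
qed

lemma M_x_axis: "M (x, 0) < n * P \<longleftrightarrow> x < n * vx 0"
proof -
  have "W 0 (x, 0) = M (x, 0)" by (rule W_eq_M[OF k_pos]) (use vy_0 in \<open>simp_all add: s_def t_def\<close>)
  moreover have "P = a 0 * vx 0" using edge_start[OF k_pos] vy_0 by (simp add: wt_def)
  ultimately show ?thesis using a_pos[OF k_pos] by (simp add: W_def wt_def flip: \<open>W 0 (x, 0) = M (x, 0)\<close>)
qed

text \<open>Let q n be the number of points with both coordinates positive and level below
  \<open>n * P\<close>. Counting the y-axis separately turns \<open>card_below\<close> into q 2 = 2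
  q 1 - 1 plus the sum of the \<open>D i\<close>, while the two sets on the right have q 1 + vy k -
  1 and q 1 + vx 0 - 1 elements.\<close>

theorem card_newton_number:
  "int (card {z. M (z + (1, 1)) < 2 * P}) =
     int (card {z. M (z + (0, 1)) < P}) + int (card {z. M (z + (1, 0)) < P}) +
     ((\<Sum>i<k. D i) - int (vx 0) - int (vy k) + 1)"
proof -
  have shift: "card {z. R (z + w)} = card {z. fst w \<le> fst z \<and> snd w \<le> snd z \<and> R z}" for R and w :: "nat \<times> nat"
  proof -
    have "{z. fst w \<le> fst z \<and> snd w \<le> snd z \<and> R z} = (\<lambda>z. z + w) ` {z. R (z + w)}"
    proof (intro equalityI subsetI)
      fix z assume z: "z \<in> {z. fst w \<le> fst z \<and> snd w \<le> snd z \<and> R z}"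
      then have "z = (fst z - fst w, snd z - snd w) + w" by (simp add: prod_eq_iff)
      with z show "z \<in> (\<lambda>z. z + w) ` {z. R (z + w)}"
        by (metis (mono_tags, lifting) image_eqI mem_Collect_eq)
    qed auto
    then show ?thesis by (simp add: card_image inj_on_def)
  qed
  define Q where "Q n = {z. 0 < fst z \<and> 0 < snd z \<and> M z < n * P}" for n
  have finQ: "finite (Q n)" for n unfolding Q_def by (rule finite_subset[OF _ finite_M_less[of "n * P"]]) auto
  have vk: "0 < vy k" using vy_pos[of "k - 1"] k_pos by simp
  have A: "card {z. 0 < snd z \<and> M z < n * P} = card (Q n) + (n * vy k - 1)" for n
  proof -
    have "{z. 0 < snd z \<and> M z < n * P} = Q n \<union> Pair 0 ` {0<..<n * vy k}"
      using M_y_axis[of _ n] by (force simp: Q_def)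
    also have "card \<dots> = card (Q n) + card (Pair (0::nat) ` {0<..<n * vy k})"
      by (rule card_Un_disjoint) (use finQ in \<open>auto simp: Q_def\<close>)
    also have "card (Pair (0::nat) ` {0<..<n * vy k}) = n * vy k - 1"
      by (simp add: card_image inj_on_def)
    finally show ?thesis .
  qed
  have B: "card {z. 0 < fst z \<and> M z < P} = card (Q 1) + (vx 0 - 1)"
  proof -
    have "{z. 0 < fst z \<and> M z < P} = Q 1 \<union> (\<lambda>x. (x, 0)) ` {0<..<vx 0}"
      using M_x_axis[of _ 1] by (force simp: Q_def)
    also have "card \<dots> = card (Q 1) + card ((\<lambda>x. (x, 0::nat)) ` {0<..<vx 0})"
      by (rule card_Un_disjoint) (use finQ[of 1] in \<open>auto simp: Q_def\<close>)
    also have "card ((\<lambda>x. (x, 0::nat)) ` {0<..<vx 0}) = vx 0 - 1"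
      by (simp add: card_image inj_on_def)
    finally show ?thesis .
  qed
  have 1: "card {z. M (z + (1, 1)) < 2 * P} = card (Q 2)"
    using shift[of "\<lambda>z. M z < 2 * P" "(1, 1)"] by (simp add: Q_def Suc_le_eq)
  have 2: "card {z. M (z + (0, 1)) < P} = card {z. 0 < snd z \<and> M z < P}"
    using shift[of "\<lambda>z. M z < P" "(0, 1)"] by (simp add: Suc_le_eq)
  have 3: "card {z. M (z + (1, 0)) < P} = card {z. 0 < fst z \<and> M z < P}"
    using shift[of "\<lambda>z. M z < P" "(1, 0)"] by (simp add: Suc_le_eq)
  show ?thesis unfolding 1 2 3 using A[of 1] A[of 2] B card_below vk vx_pos[OF k_pos] by simp
qed

end

section \<open>Newton polyhedra\<close>

lemma newton_polyhedron_convex: "convex (newton_polyhedron S)"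
  by (simp add: newton_polyhedron_def)

lemma newton_polyhedron_base:
  assumes "z \<in> S" "0 \<le> s" "0 \<le> t"
  shows "real_point z + (s, t) \<in> newton_polyhedron S"
  unfolding newton_polyhedron_def by (rule hull_inc) (use assms in blast)

lemma newton_polyhedron_point: "z \<in> S \<Longrightarrow> real_point z \<in> newton_polyhedron S"
  using newton_polyhedron_base[of z S 0 0] by (simp flip: zero_prod_def)

lemma newton_polyhedron_minimal:
  assumes "convex C" "\<And>z s t. z \<in> S \<Longrightarrow> 0 \<le> s \<Longrightarrow> 0 \<le> t \<Longrightarrow> real_point z + (s, t) \<in> C"
  shows "newton_polyhedron S \<subseteq> C"
  unfolding newton_polyhedron_def by (rule hull_minimal) (use assms in auto)

lemma newton_polyhedron_upward:
  assumes p: "p \<in> newton_polyhedron S" and st: "0 \<le> s" "0 \<le> t"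
  shows "p + (s, t) \<in> newton_polyhedron S"
proof -
  have "convex {p. p + (s, t) \<in> newton_polyhedron S}"
  proof -
    have "{p. p + (s, t) \<in> newton_polyhedron S} = (\<lambda>p. p - (s, t)) ` newton_polyhedron S"
      by (auto intro!: image_eqI[of _ _ "_ + (s, t)"])
    then show ?thesis using newton_polyhedron_convex by (simp add: convex_translation_subtract)
  qed
  then have "newton_polyhedron S \<subseteq> {p. p + (s, t) \<in> newton_polyhedron S}"
  proof (rule newton_polyhedron_minimal)
    fix z s' t' assume "z \<in> S" "0 \<le> (s' :: real)" "0 \<le> (t' :: real)"
    then have "real_point z + (s' + s, t' + t) \<in> newton_polyhedron S"
      using st by (intro newton_polyhedron_base) auto
    then show "real_point z + (s', t') \<in> {p. p + (s, t) \<in> newton_polyhedron S}"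
      by (simp add: add.assoc)
  qed
  then show ?thesis using p by auto
qed

lemma newton_polyhedron_halfspace:
  assumes "0 \<le> a" "0 \<le> b" "\<And>z. z \<in> S \<Longrightarrow> c \<le> a * real (fst z) + b * real (snd z)" "p \<in> newton_polyhedron S"
  shows "c \<le> a * fst p + b * snd p"
proof -
  have "convex {p. inner (a, b) p \<ge> c}" by (rule convex_halfspace_ge)
  then have "newton_polyhedron S \<subseteq> {p. inner (a, b) p \<ge> c}"
  proof (rule newton_polyhedron_minimal)
    fix z s t assume z: "z \<in> S" "0 \<le> (s::real)" "0 \<le> (t::real)"
    have "0 \<le> a * s" "0 \<le> b * t" using z assms(1,2) by auto
    then show "real_point z + (s, t) \<in> {p. c \<le> inner (a, b) p}"
      using assms(3)[OF z(1)] by (simp add: real_point_def inner_prod_def algebra_simps)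
  qed
  then show ?thesis using assms(4) by (auto simp: inner_prod_def)
qed

text \<open>Serves to enclose the polyhedron in an open half-plane together with the hull of the
  points of \<open>S\<close> on its boundary line, which identifies the face on that line.\<close>

lemma convex_above_union:
  fixes F :: "(real \<times> real) set"
  assumes "convex F" "F \<subseteq> {p. a * fst p + b * snd p = c}"
  shows "convex ({p. c < a * fst p + b * snd p} \<union> F)" (is "convex ?C")
proof (rule convexI)
  fix p q :: "real \<times> real" and u v :: real
  assume p: "p \<in> ?C" and q: "q \<in> ?C" and uv: "0 \<le> u" "0 \<le> v" "u + v = 1"
  let ?w = "\<lambda>p. a * fst p + b * snd p"
  have w: "?w (u *\<^sub>R p + v *\<^sub>R q) = u * ?w p + v * ?w q" by (simp add: algebra_simps)
  have ge: "c \<le> ?w p" "c \<le> ?w q" using p q assms(2) by auto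
  consider "u = 0" | "v = 0" | "p \<in> F" "q \<in> F" | "0 < u" "0 < v" "c < ?w p \<or> c < ?w q"
    using p q uv by fastforce
  then show "u *\<^sub>R p + v *\<^sub>R q \<in> ?C"
  proof cases
    case 4
    have "u * c + v * c < u * ?w p + v * ?w q"
      using 4(3)
    proof
      assume "c < ?w p"
      then show ?thesis using 4 ge by (intro add_less_le_mono mult_strict_left_mono mult_left_mono) auto
    next
      assume "c < ?w q"
      then show ?thesis using 4 ge by (intro add_le_less_mono mult_strict_left_mono mult_left_mono) auto
    qed
    moreover have "u * c + v * c = c" using uv(3) by (simp flip: distrib_right)
    ultimately show ?thesis using w by simp
  qed (use p q uv assms(1) in \<open>auto simp: convexD\<close>)
qed

text \<open>A linear form with positive coefficients cuts out a compact face, because on the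
  polyhedron it can attain its minimum only in the convex hull of points of \<open>S\<close>.\<close>

lemma newton_faces_functional:
  assumes ab: "0 < a" "0 < b" and ge: "\<And>z. z \<in> S \<Longrightarrow> c \<le> a * real (fst z) + b * real (snd z)"
    and ex: "z0 \<in> S" "a * real (fst z0) + b * real (snd z0) = c"
  shows "newton_polyhedron S \<inter> {p. a * fst p + b * snd p = c} \<in> newton_faces S"
proof -
  let ?P = "newton_polyhedron S" and ?w = "\<lambda>p::real \<times> real. a * fst p + b * snd p"
  let ?H = "convex hull (real_point ` {z \<in> S. a * real (fst z) + b * real (snd z) = c})"
  have inn: "inner (a, b) p = ?w p" for p by (simp add: inner_prod_def)
  have "(?P \<inter> {p. inner (a, b) p = c}) face_of ?P"
    by (rule face_of_Int_supporting_hyperplane_ge[OF newton_polyhedron_convex])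
       (use newton_polyhedron_halfspace[OF _ _ ge] ab in \<open>simp add: inn\<close>)
  then have face: "(?P \<inter> {p. ?w p = c}) face_of ?P" by (simp only: inn)
  have H: "?H \<subseteq> {p. ?w p = c}"
  proof (rule hull_minimal)
    show "convex {p. ?w p = c}" using convex_hyperplane[of "(a, b)" c] by (simp only: inn)
  qed (auto simp: real_point_def)
  have "?P \<subseteq> {p. c < ?w p} \<union> ?H"
  proof (rule newton_polyhedron_minimal[OF convex_above_union[OF _ H]])
    fix z s t assume z: "z \<in> S" "0 \<le> (s::real)" "0 \<le> (t::real)"
    show "real_point z + (s, t) \<in> {p. c < ?w p} \<union> ?H"
    proof (cases "s = 0 \<and> t = 0 \<and> a * real (fst z) + b * real (snd z) = c")
      case True
      then have "real_point z \<in> ?H" using z by (intro hull_inc) auto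
      then show ?thesis using True by (simp flip: zero_prod_def)
    next
      case False
      have "0 \<le> a * s" "0 \<le> b * t" "s \<noteq> 0 \<longrightarrow> 0 < a * s" "t \<noteq> 0 \<longrightarrow> 0 < b * t"
        using z ab by auto
      then have "c < a * real (fst z) + b * real (snd z) + a * s + b * t"
        using ge[OF z(1)] False by linarith
      then show ?thesis by (simp add: real_point_def algebra_simps)
    qed
  qed simp
  moreover have "?H \<subseteq> ?P"
    by (rule hull_minimal) (auto simp: newton_polyhedron_point newton_polyhedron_convex)
  ultimately have eq: "?P \<inter> {p. ?w p = c} = ?H" using H by auto
  have "finite {z \<in> S. a * real (fst z) + b * real (snd z) = c}"
  proof (rule finite_subset)
    show "{z \<in> S. a * real (fst z) + b * real (snd z) = c} \<subseteq> {..nat \<lceil>c / a\<rceil>} \<times> {..nat \<lceil>c / b\<rceil>}"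
    proof
      fix z assume "z \<in> {z \<in> S. a * real (fst z) + b * real (snd z) = c}"
      then have "a * real (fst z) \<le> c" "b * real (snd z) \<le> c" using ab
        by (auto simp: algebra_simps intro: add_increasing add_increasing2)
      then have "real (fst z) \<le> c / a" "real (snd z) \<le> c / b" using ab by (simp_all add: field_simps)
      then show "z \<in> {..nat \<lceil>c / a\<rceil>} \<times> {..nat \<lceil>c / b\<rceil>}" by (simp add: mem_Times_iff) linarith
    qed
  qed simp
  then have "compact ?H" by (intro finite_imp_compact_convex_hull) simp
  moreover have "z0 \<in> {z \<in> S. a * real (fst z) + b * real (snd z) = c}" using ex by simp
  then have "real_point z0 \<in> ?H" by (intro hull_inc imageI)
  then have "?H \<noteq> {}" by blast
  ultimately show ?thesis using face eq by (simp add: newton_faces_def)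
qed

section \<open>Chains of vertices\<close>

text \<open>Successive edges may be collinear: this changes neither the diagram nor the area, and
  chains for modified supports can be written down without merging edges.\<close>

locale newton_chain =
  fixes S :: "(nat \<times> nat) set" and k :: nat and vx vy :: "nat \<Rightarrow> nat"
  assumes k_pos: "0 < k" and vy_0: "vy 0 = 0" and vx_k: "vx k = 0"
    and vertex_mem: "\<And>i. i \<le> k \<Longrightarrow> (vx i, vy i) \<in> S"
    and vx_dec: "\<And>i. i < k \<Longrightarrow> vx (Suc i) < vx i" and vy_inc: "\<And>i. i < k \<Longrightarrow> vy i < vy (Suc i)"
    and above: "\<And>i z. i < k \<Longrightarrow> z \<in> S \<Longrightarrow>
      int (vx i) * int (vy (Suc i)) - int (vx (Suc i)) * int (vy i) \<le>
      (int (vy (Suc i)) - int (vy i)) * int (fst z) + (int (vx i) - int (vx (Suc i))) * int (snd z)"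
begin

definition "d i = real (vx i) * real (vy (Suc i)) - real (vx (Suc i)) * real (vy i)"
definition "L i p = (real (vy (Suc i)) - real (vy i)) * fst p + (real (vx i) - real (vx (Suc i))) * snd p"
definition "V i = (real (vx i), real (vy i))"

lemma V_real_point: "V i = real_point (vx i, vy i)"
  by (simp add: V_def real_point_def)

lemma L_ge: "i < k \<Longrightarrow> z \<in> S \<Longrightarrow> d i \<le> L i (real_point z)"
proof -
  assume "i < k" "z \<in> S"
  from above[OF this] have "of_int (int (vx i) * int (vy (Suc i)) - int (vx (Suc i)) * int (vy i)) \<le>
      (of_int ((int (vy (Suc i)) - int (vy i)) * int (fst z) + (int (vx i) - int (vx (Suc i))) * int (snd z)) :: real)"
    by (simp only: of_int_le_iff)
  then show ?thesis by (simp add: d_def L_def real_point_def)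
qed

lemma L_coeff_pos: "i < k \<Longrightarrow> 0 < real (vy (Suc i)) - real (vy i)" "i < k \<Longrightarrow> 0 < real (vx i) - real (vx (Suc i))"
  using vx_dec vy_inc by simp_all

lemma L_edge: "L i (V i) = d i" "L i (V (Suc i)) = d i"
  by (simp_all add: L_def V_def d_def algebra_simps)

lemma L_linear: "L i (a *\<^sub>R p + b *\<^sub>R q) = a * L i p + b * L i q" "L i (a *\<^sub>R p) = a * L i p"
  by (simp_all add: L_def algebra_simps)

lemma d_pos: "i < k \<Longrightarrow> 0 < d i"
proof -
  assume i: "i < k"
  have "vx (Suc i) * vy i < vx i * vy (Suc i)"
    using vx_dec[OF i] vy_inc[OF i] by (intro mult_strict_mono) auto
  then have "real (vx (Suc i) * vy i) < real (vx i * vy (Suc i))" by (simp only: of_nat_less_iff)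
  then show ?thesis by (simp add: d_def)
qed

lemma L_V_ge: "i < k \<Longrightarrow> j \<le> k \<Longrightarrow> d i \<le> L i (V j)"
  unfolding V_real_point by (intro L_ge vertex_mem)

lemma polyhedron_L_ge: "i < k \<Longrightarrow> p \<in> newton_polyhedron S \<Longrightarrow> d i \<le> L i p"
  unfolding L_def using L_coeff_pos[of i] L_ge[of i]
  by (intro newton_polyhedron_halfspace[of _ _ S]) (auto simp: L_def real_point_def)

lemma polyhedron_nonneg: "p \<in> newton_polyhedron S \<Longrightarrow> 0 \<le> fst p \<and> 0 \<le> snd p"
  using newton_polyhedron_halfspace[of 1 0 S 0 p] newton_polyhedron_halfspace[of 0 1 S 0 p] by simp

text \<open>In the first cone where the first coordinate is nonnegative the second one is
  nonnegative too, since its numerator is minus the numerator of the first coordinate in the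
  preceding cone.\<close>

lemma cone_ex:
  assumes p: "0 \<le> fst p" "0 \<le> (snd p :: real)"
  shows "\<exists>i<k. \<exists>a\<ge>0. \<exists>b\<ge>0. p = a *\<^sub>R V i + b *\<^sub>R V (Suc i)"
proof -
  let ?s = "\<lambda>i. fst p * real (vy (Suc i)) - real (vx (Suc i)) * snd p"
  let ?t = "\<lambda>i. real (vx i) * snd p - fst p * real (vy i)"
  have "\<exists>i<k. 0 \<le> ?s i" using k_pos vx_k p(1) by (intro exI[of _ "k - 1"]) simp
  then obtain i where i: "i < k" "0 \<le> ?s i" and least: "\<And>j. j < i \<Longrightarrow> \<not> (j < k \<and> 0 \<le> ?s j)"
    using exists_least_iff[of "\<lambda>i. i < k \<and> 0 \<le> ?s i"] by metis
  have t: "0 \<le> ?t i"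
  proof (cases i)
    case 0
    then show ?thesis using vy_0 p by simp
  next
    case (Suc j)
    then show ?thesis using least[of j] i by simp
  qed
  have "p = (?s i / d i) *\<^sub>R V i + (?t i / d i) *\<^sub>R V (Suc i)"
  proof -
    have "d i * fst p = ?s i * real (vx i) + ?t i * real (vx (Suc i))"
      "d i * snd p = ?s i * real (vy i) + ?t i * real (vy (Suc i))"
      by (simp_all add: d_def algebra_simps)
    then have "fst p = (?s i * real (vx i) + ?t i * real (vx (Suc i))) / d i"
      "snd p = (?s i * real (vy i) + ?t i * real (vy (Suc i))) / d i"
      using d_pos[OF i(1)] by (simp_all add: field_simps)
    then show ?thesis by (simp add: prod_eq_iff V_def add_divide_distrib)
  qed
  moreover have "0 \<le> ?s i / d i" "0 \<le> ?t i / d i" using i(2) t d_pos[OF i(1)] by simp_all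
  ultimately show ?thesis using i(1) by blast
qed

lemma mem_segment: "0 \<le> a \<Longrightarrow> 0 \<le> b \<Longrightarrow> a + b = 1 \<Longrightarrow> a *\<^sub>R V i + b *\<^sub>R V (Suc i) \<in> closed_segment (V i) (V (Suc i))"
proof -
  assume "0 \<le> a" "0 \<le> b" "a + b = 1"
  then have "a = 1 - b" "b \<le> 1" by auto
  then show ?thesis unfolding closed_segment_def mem_Collect_eq
    by (intro exI[of _ b]) (simp add: \<open>0 \<le> b\<close>)
qed

lemma segment_in_polyhedron: "i < k \<Longrightarrow> closed_segment (V i) (V (Suc i)) \<subseteq> newton_polyhedron S"
  using newton_polyhedron_convex[of S] newton_polyhedron_point[of _ S] vertex_mem
  unfolding V_real_point by (simp add: closed_segment_subset)

lemma L_segment: "p \<in> closed_segment (V i) (V (Suc i)) \<Longrightarrow> L i p = d i"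
  by (auto simp: closed_segment_def L_linear L_edge simp flip: distrib_right)

text \<open>A point of the polyhedron strictly above the chain has points of the polyhedron on both
  sides along its ray from the origin, so a face through it contains the outer part of the ray and
  is unbounded. Conversely, each edge lies in the compact face cut out by its linear form.\<close>

lemma newton_diagram_eq: "newton_diagram S = (\<Union>i<k. closed_segment (V i) (V (Suc i)))"
proof (intro equalityI subsetI)
  fix p assume "p \<in> (\<Union>i<k. closed_segment (V i) (V (Suc i)))"
  then obtain i where i: "i < k" "p \<in> closed_segment (V i) (V (Suc i))" by blast
  have "newton_polyhedron S \<inter> {p. (real (vy (Suc i)) - real (vy i)) * fst p + (real (vx i) - real (vx (Suc i))) * snd p = d i} \<in> newton_faces S"
  proof (rule newton_faces_functional)
    show "(vx i, vy i) \<in> S" using vertex_mem i by simp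
  qed (use L_coeff_pos[OF i(1)] L_ge[OF i(1)] in \<open>auto simp: L_def real_point_def d_def algebra_simps\<close>)
  moreover have "p \<in> newton_polyhedron S \<inter> {p. (real (vy (Suc i)) - real (vy i)) * fst p + (real (vx i) - real (vx (Suc i))) * snd p = d i}"
    using segment_in_polyhedron[OF i(1)] L_segment[OF i(2)] i(2) by (auto simp: L_def)
  ultimately show "p \<in> newton_diagram S" unfolding newton_diagram_def by blast
next
  fix p assume "p \<in> newton_diagram S"
  then obtain \<Delta> where face: "\<Delta> face_of newton_polyhedron S" and "compact \<Delta>" "p \<in> \<Delta>"
    by (auto simp: newton_diagram_def newton_faces_def)
  then have p: "p \<in> newton_polyhedron S" using face_of_imp_subset by blast
  have pn: "0 \<le> fst p" "0 \<le> snd p" using polyhedron_nonneg[OF p] by auto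
  obtain i a b where i: "i < k" and ab: "0 \<le> a" "0 \<le> b" and p_eq: "p = a *\<^sub>R V i + b *\<^sub>R V (Suc i)"
    using cone_ex[OF pn] by blast
  have "d i \<le> (a + b) * d i"
    using polyhedron_L_ge[OF i p] unfolding p_eq L_linear L_edge by (simp add: algebra_simps)
  then have "1 \<le> a + b" using d_pos[OF i] by simp
  show "p \<in> (\<Union>i<k. closed_segment (V i) (V (Suc i)))"
  proof (cases "a + b = 1")
    case True
    then have "p \<in> closed_segment (V i) (V (Suc i))"
      using mem_segment[of a b i] ab p_eq by simp
    then show ?thesis using i by blast
  next
    case False
    then have ab1: "1 < a + b" using \<open>1 \<le> a + b\<close> by simp
    define q where "q = (1 / (a + b)) *\<^sub>R p"
    have "q \<in> closed_segment (V i) (V (Suc i))"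
      using mem_segment[of "a / (a + b)" "b / (a + b)" i] ab ab1
      by (simp add: q_def p_eq scaleR_add_right flip: add_divide_distrib)
    then have q: "q \<in> newton_polyhedron S" using segment_in_polyhedron[OF i] by blast
    have "p \<noteq> 0"
    proof
      assume "p = 0"
      then have "L i p = 0" by (simp add: L_def)
      then show False using polyhedron_L_ge[OF i p] d_pos[OF i] by simp
    qed
    have "(1 + n) *\<^sub>R p \<in> \<Delta>" if n: "0 < n" for n :: real
    proof -
      have "p + (n * fst p, n * snd p) \<in> newton_polyhedron S"
        by (rule newton_polyhedron_upward[OF p]) (use n pn in auto)
      moreover have "p + (n * fst p, n * snd p) = (1 + n) *\<^sub>R p"
        by (simp add: prod_eq_iff algebra_simps)
      ultimately have q': "(1 + n) *\<^sub>R p \<in> newton_polyhedron S" by simp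
      define c where "c = 1 / (a + b)"
      have c: "0 < c" "c < 1" using ab1 by (auto simp: c_def)
      have "p \<in> open_segment q ((1 + n) *\<^sub>R p)"
      proof -
        \<comment> \<open>The solution of \<open>(1 - u) * c + u * (1 + n) = 1\<close>, because
          \<open>q\<close> is \<open>c\<close> times \<open>p\<close>.\<close>
        define u where "u = (1 - c) / (1 + n - c)"
        have u: "0 < u" "u < 1" using c n by (auto simp: u_def field_simps)
        have "(1 - u) * c + u * (1 + n) = c + u * (1 + n - c)" by (simp add: algebra_simps)
        also have "\<dots> = 1" using c n by (simp add: u_def)
        finally have "p = (1 - u) *\<^sub>R q + u *\<^sub>R ((1 + n) *\<^sub>R p)"
          by (simp add: q_def flip: c_def scaleR_add_left)
        moreover have "q \<noteq> (1 + n) *\<^sub>R p"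
        proof
          assume "q = (1 + n) *\<^sub>R p"
          then have "(1 + n - c) *\<^sub>R p = 0" unfolding q_def c_def[symmetric] scaleR_diff_left by (metis right_minus_eq)
          then show False using \<open>p \<noteq> 0\<close> c n by simp
        qed
        ultimately show ?thesis using u by (auto simp: in_segment)
      qed
      then show ?thesis using face_ofD[OF face _ q q' \<open>p \<in> \<Delta>\<close>] by blast
    qed
    moreover obtain B where B: "\<And>x. x \<in> \<Delta> \<Longrightarrow> norm x \<le> B"
      using compact_imp_bounded[OF \<open>compact \<Delta>\<close>] unfolding bounded_iff by blast
    moreover define n where "n = \<bar>B\<bar> / norm p + 1"
    have "0 < n" by (simp add: n_def add_nonneg_pos)
    ultimately have "norm ((1 + n) *\<^sub>R p) \<le> B" by blast
    then have "(1 + n) * norm p \<le> B" using \<open>0 < n\<close> by simp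
    moreover have "\<bar>B\<bar> < (1 + n) * norm p"
      using \<open>p \<noteq> 0\<close> by (simp add: n_def algebra_simps add_pos_pos)
    ultimately show ?thesis by linarith
  qed
qed

lemma L_ge_scaled:
  assumes ij: "i < k" "j < k" and ab: "0 \<le> a" "0 \<le> b"
  shows "(a + b) * d j \<le> L j (a *\<^sub>R V i + b *\<^sub>R V (Suc i))"
  unfolding L_linear distrib_right using ij ab by (intro add_mono mult_left_mono L_V_ge) auto

text \<open>The region above the chain is an intersection of half-planes, hence the existential
  quantifier. A point satisfying one of the inequalities has coordinates with
  \<open>a + b \<le> 1\<close> in its own cone, by \<open>L_ge_scaled\<close>.\<close>

lemma newton_below_eq: "newton_below S = {p. 0 \<le> fst p \<and> 0 \<le> snd p \<and> (\<exists>i<k. L i p \<le> d i)}"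
proof (intro equalityI subsetI)
  fix p assume "p \<in> newton_below S"
  then obtain i q u where i: "i < k" and q: "q \<in> closed_segment (V i) (V (Suc i))"
    and u: "0 \<le> u" "u \<le> 1" "p = u *\<^sub>R q"
  proof -
    obtain q where "q \<in> newton_diagram S" "p \<in> closed_segment 0 q"
      using \<open>p \<in> newton_below S\<close> unfolding newton_below_def by blast
    then obtain i where i: "i < k" "q \<in> closed_segment (V i) (V (Suc i))"
      unfolding newton_diagram_eq by blast
    obtain u where "0 \<le> u" "u \<le> 1" "p = u *\<^sub>R q"
      using \<open>p \<in> closed_segment 0 q\<close> unfolding in_segment by auto
    then show ?thesis by (rule that[OF i])
  qed
  have "0 \<le> fst q \<and> 0 \<le> snd q" using segment_in_polyhedron[OF i] q polyhedron_nonneg by blast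
  moreover have "L i p \<le> d i" using u d_pos[OF i] L_segment[OF q] by (simp add: L_linear mult_left_le_one_le)
  ultimately show "p \<in> {p. 0 \<le> fst p \<and> 0 \<le> snd p \<and> (\<exists>i<k. L i p \<le> d i)}" using u i by auto
next
  fix p assume "p \<in> {p. 0 \<le> fst p \<and> 0 \<le> snd p \<and> (\<exists>i<k. L i p \<le> d i)}"
  then obtain j where pn: "0 \<le> fst p" "0 \<le> snd p" and j: "j < k" "L j p \<le> d j" by blast
  obtain i a b where i: "i < k" and ab: "0 \<le> a" "0 \<le> b" and p_eq: "p = a *\<^sub>R V i + b *\<^sub>R V (Suc i)"
    using cone_ex[OF pn] by blast
  have "(a + b) * d j \<le> d j" using L_ge_scaled[OF i j(1) ab] j(2) p_eq by simp
  then have ab1: "a + b \<le> 1" using d_pos[OF j(1)] by simp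
  show "p \<in> newton_below S"
  proof (cases "a + b = 0")
    case True
    then have "p = 0" using ab p_eq by (simp add: add_nonneg_eq_0_iff)
    moreover have "V 0 \<in> newton_diagram S" unfolding newton_diagram_eq using k_pos by blast
    ultimately show ?thesis unfolding newton_below_def by (intro UN_I[of "V 0"]) auto
  next
    case False
    then have pos: "0 < a + b" using ab by simp
    define q where "q = (1 / (a + b)) *\<^sub>R p"
    have "q \<in> closed_segment (V i) (V (Suc i))"
      using mem_segment[of "a / (a + b)" "b / (a + b)" i] ab pos
      by (simp add: q_def p_eq scaleR_add_right flip: add_divide_distrib)
    then have "q \<in> newton_diagram S" using i newton_diagram_eq by blast
    moreover have "p = (a + b) *\<^sub>R q" using pos by (simp add: q_def)
    then have "p \<in> closed_segment 0 q" unfolding closed_segment_def using pos ab1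
      by (auto intro!: exI[of _ "a + b"])
    ultimately show ?thesis unfolding newton_below_def by blast
  qed
qed

end

section \<open>The area below a chain\<close>

text \<open>Open on the left so that adjacent strips are disjoint; Fubini reduces the area to the
  integral of an affine function.\<close>

lemma emeasure_trapezoid:
  fixes u v \<alpha> \<beta> :: real
  assumes uv: "u \<le> v" and nonneg: "\<And>x. u \<le> x \<Longrightarrow> x \<le> v \<Longrightarrow> 0 \<le> \<alpha> * x + \<beta>"
  defines "A \<equiv> {p. u < fst p \<and> fst p \<le> v \<and> 0 \<le> snd p \<and> snd p \<le> \<alpha> * fst p + \<beta>}"
  shows "A \<in> sets lborel" "emeasure lborel A = ennreal ((v - u) * (\<alpha> * (u + v) + 2 * \<beta>) / 2)"
proof -
  show A: "A \<in> sets lborel"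
  proof -
    have "closed {p. 0 \<le> snd p \<and> snd p \<le> \<alpha> * fst p + \<beta>}"
      by (intro closed_Collect_conj closed_Collect_le continuous_intros)
    moreover have "open {p :: real \<times> real. u < fst p}" "closed {p :: real \<times> real. fst p \<le> v}"
      by (intro open_Collect_less closed_Collect_le continuous_intros)+
    moreover have "A = {p. 0 \<le> snd p \<and> snd p \<le> \<alpha> * fst p + \<beta>} \<inter> ({p. u < fst p} \<inter> {p. fst p \<le> v})"
      by (auto simp: A_def)
    ultimately show ?thesis by (simp add: borel_closed borel_open sets.Int)
  qed
  have "A \<in> sets (lborel \<Otimes>\<^sub>M lborel)" unfolding lborel_prod by (rule A)
  from lborel.emeasure_pair_measure_alt[OF this]
  have "emeasure lborel A = (\<integral>\<^sup>+x. emeasure lborel (Pair x -` A) \<partial>lborel)"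
    unfolding lborel_prod .
  also have "\<dots> = (\<integral>\<^sup>+x. ennreal (\<alpha> * x + \<beta>) * indicator {u..v} x \<partial>lborel)"
  proof (rule nn_integral_cong_AE)
    have "AE x in lborel. x \<noteq> u" by (rule AE_lborel_singleton)
    then show "AE x in lborel. emeasure lborel (Pair x -` A) = ennreal (\<alpha> * x + \<beta>) * indicator {u..v} x"
    proof eventually_elim
      case (elim x)
      have "Pair x -` A = (if u < x \<and> x \<le> v then {0..\<alpha> * x + \<beta>} else {})" by (auto simp: A_def)
      then show ?case using elim nonneg[of x] by (auto simp: indicator_def)
    qed
  qed
  also have "\<dots> = ennreal ((\<alpha> * v\<^sup>2 / 2 + \<beta> * v) - (\<alpha> * u\<^sup>2 / 2 + \<beta> * u))"
    by (rule nn_integral_FTC_Icc[where F = "\<lambda>x. \<alpha> * x\<^sup>2 / 2 + \<beta> * x"])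
       (use uv nonneg in \<open>auto intro!: derivative_eq_intros\<close>)
  also have "(\<alpha> * v\<^sup>2 / 2 + \<beta> * v) - (\<alpha> * u\<^sup>2 / 2 + \<beta> * u) = (v - u) * (\<alpha> * (u + v) + 2 * \<beta>) / 2"
    by (simp add: power2_eq_square field_simps)
  finally show "emeasure lborel A = ennreal ((v - u) * (\<alpha> * (u + v) + 2 * \<beta>) / 2)" .
qed

context newton_chain
begin

lemma vx_antimono: "i \<le> j \<Longrightarrow> j \<le> k \<Longrightarrow> vx j \<le> vx i"
proof (induction j)
  case (Suc j)
  then show ?case using vx_dec[of j] by (cases "i = Suc j") auto
qed simp

definition "slope i = (real (vy (Suc i)) - real (vy i)) / (real (vx i) - real (vx (Suc i)))"
definition "strip i = {p. real (vx (Suc i)) < fst p \<and> fst p \<le> real (vx i) \<and> 0 \<le> snd p \<and>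
  snd p \<le> - slope i * fst p + (slope i * real (vx i) + real (vy i))}"

lemma slope_mult: "i < k \<Longrightarrow> slope i * (real (vx i) - real (vx (Suc i))) = real (vy (Suc i)) - real (vy i)"
  using L_coeff_pos(2)[of i] by (simp add: slope_def)

lemma L_le_iff:
  assumes "i < k"
  shows "L i p \<le> d i \<longleftrightarrow> snd p \<le> - slope i * fst p + (slope i * real (vx i) + real (vy i))"
proof -
  let ?b = "real (vx i) - real (vx (Suc i))"
  have b: "0 < ?b" using L_coeff_pos(2)[OF assms] .
  have "L i p - d i = ?b * (snd p - (- slope i * fst p + (slope i * real (vx i) + real (vy i))))"
  proof -
    have "?b * (snd p - (- slope i * fst p + (slope i * real (vx i) + real (vy i)))) =
        ?b * snd p + (slope i * ?b) * fst p - (slope i * ?b) * real (vx i) - ?b * real (vy i)"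
      by (simp add: algebra_simps)
    then show ?thesis unfolding slope_mult[OF assms] by (simp add: L_def d_def algebra_simps)
  qed
  moreover have "?b * y \<le> 0 \<longleftrightarrow> y \<le> 0" for y using b by (simp add: mult_le_0_iff)
  ultimately show ?thesis by (metis diff_le_0_iff_le)
qed

lemma strip_interval: "\<exists>i<k. real (vx (Suc i)) < x \<and> x \<le> real (vx i)" if "0 < x" "x \<le> real (vx 0)"
proof -
  have "\<exists>i. i < k \<and> real (vx (Suc i)) < x"
    using k_pos vx_k that(1) by (intro exI[of _ "k - 1"]) simp
  then obtain i where i: "i < k" "real (vx (Suc i)) < x"
    and least: "\<And>j. j < i \<Longrightarrow> \<not> (j < k \<and> real (vx (Suc j)) < x)"
    using exists_least_iff[of "\<lambda>i. i < k \<and> real (vx (Suc i)) < x"] by blast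
  have "x \<le> real (vx i)" using least[of "i - 1"] i that(2) by (cases i) auto
  then show ?thesis using i by blast
qed

text \<open>The region is cut into vertical strips, one under each edge; the segment on the y-axis
  is left over because strips are open on the left. A point above the edge of its strip lies above a
  point of that edge, where every \<open>L j\<close> is already at least \<open>d j\<close>.\<close>

lemma newton_below_strips: "newton_below S = {0} \<times> {0..real (vy k)} \<union> (\<Union>i<k. strip i)"
proof (intro equalityI subsetI)
  fix p assume "p \<in> newton_below S"
  then obtain j where p: "0 \<le> fst p" "0 \<le> snd p" and j: "j < k" "L j p \<le> d j"
    unfolding newton_below_eq by blast
  have x: "fst p \<le> real (vx 0)"
  proof (rule ccontr)
    assume "\<not> fst p \<le> real (vx 0)"
    then have "L j (V 0) < L j p"
      unfolding L_def using L_coeff_pos[OF j(1)] p(2) vy_0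
      by (intro add_less_le_mono mult_strict_left_mono mult_left_mono) (auto simp: V_def)
    then show False using L_V_ge[OF j(1), of 0] j(2) by simp
  qed
  show "p \<in> {0} \<times> {0..real (vy k)} \<union> (\<Union>i<k. strip i)"
  proof (cases "fst p = 0")
    case True
    have "snd p \<le> real (vy k)"
    proof (rule ccontr)
      assume "\<not> snd p \<le> real (vy k)"
      then have "L j (V k) < L j p"
        unfolding L_def using L_coeff_pos[OF j(1)] True vx_k
        by (intro add_le_less_mono mult_strict_left_mono mult_left_mono) (auto simp: V_def)
      then show False using L_V_ge[OF j(1), of k] j(2) by simp
    qed
    then show ?thesis using True p(2) by (auto simp: mem_Times_iff)
  next
    case False
    then obtain i where i: "i < k" "real (vx (Suc i)) < fst p" "fst p \<le> real (vx i)"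
      using strip_interval[of "fst p"] p(1) x by auto
    have "L i p \<le> d i"
    proof (rule ccontr)
      assume "\<not> L i p \<le> d i"
      define y where "y = - slope i * fst p + (slope i * real (vx i) + real (vy i))"
      have y: "y < snd p" using \<open>\<not> L i p \<le> d i\<close> L_le_iff[OF i(1), of p] by (simp add: y_def)
      define u where "u = (real (vx i) - fst p) / (real (vx i) - real (vx (Suc i)))"
      have b: "0 < real (vx i) - real (vx (Suc i))" by (rule L_coeff_pos(2)[OF i(1)])
      have u: "0 \<le> u" "0 \<le> 1 - u" using i b by (simp_all add: u_def)
      have ub: "u * (real (vx i) - real (vx (Suc i))) = real (vx i) - fst p" using b by (simp add: u_def)
      have "u * (real (vy (Suc i)) - real (vy i)) = slope i * (u * (real (vx i) - real (vx (Suc i))))"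
        by (simp flip: slope_mult[OF i(1)])
      also have "\<dots> = slope i * (real (vx i) - fst p)" unfolding ub ..
      finally have "(fst p, y) = (1 - u) *\<^sub>R V i + u *\<^sub>R V (Suc i)"
        using ub by (simp add: V_def y_def algebra_simps)
      then have "d j \<le> L j (fst p, y)"
        using L_ge_scaled[OF i(1) j(1) u(2,1)] by simp
      also have "\<dots> < L j p"
        unfolding L_def using L_coeff_pos[OF j(1)] y by simp
      finally show False using j(2) by simp
    qed
    then have "p \<in> strip i" using i p(2) L_le_iff[OF i(1), of p] by (simp add: strip_def)
    then show ?thesis using i(1) by blast
  qed
next
  fix p assume "p \<in> {0} \<times> {0..real (vy k)} \<union> (\<Union>i<k. strip i)"
  then show "p \<in> newton_below S"
  proof
    assume p: "p \<in> {0} \<times> {0..real (vy k)}"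
    obtain j where j: "k = Suc j" "j < k" using k_pos by (cases k) auto
    have "L j p \<le> L j (V k)"
      unfolding L_def using L_coeff_pos[OF j(2)] p vx_k
      by (intro add_mono mult_left_mono) (auto simp: V_def)
    then have "L j p \<le> d j" using L_edge(2)[of j] j(1) by simp
    then show ?thesis unfolding newton_below_eq using p j(2) by auto
  next
    assume "p \<in> (\<Union>i<k. strip i)"
    then obtain i where i: "i < k" "p \<in> strip i" by blast
    then have "L i p \<le> d i" using L_le_iff[OF i(1), of p] by (simp add: strip_def)
    moreover have "0 \<le> fst p" "0 \<le> snd p" using i(2) by (auto simp: strip_def)
    ultimately show ?thesis unfolding newton_below_eq using i(1) by blast
  qed
qed

lemma strip_measure:
  assumes i: "i < k"
  shows "strip i \<in> sets lborel"
    "emeasure lborel (strip i) = ennreal ((real (vx i) - real (vx (Suc i))) * (real (vy i) + real (vy (Suc i))) / 2)"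
proof -
  have b: "0 < real (vx i) - real (vx (Suc i))" by (rule L_coeff_pos(2)[OF i])
  have sl: "0 \<le> slope i" using L_coeff_pos[OF i] by (simp add: slope_def)
  have nn: "0 \<le> - slope i * x + (slope i * real (vx i) + real (vy i))" if "x \<le> real (vx i)" for x
    using mult_left_mono[OF that sl] by simp
  have "(- slope i) * (real (vx (Suc i)) + real (vx i)) + 2 * (slope i * real (vx i) + real (vy i)) =
      slope i * (real (vx i) - real (vx (Suc i))) + 2 * real (vy i)"
    by (simp add: algebra_simps)
  also have "\<dots> = real (vy i) + real (vy (Suc i))" unfolding slope_mult[OF i] by simp
  finally have "(- slope i) * (real (vx (Suc i)) + real (vx i)) + 2 * (slope i * real (vx i) + real (vy i)) =
      real (vy i) + real (vy (Suc i))" .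
  then show "emeasure lborel (strip i) = ennreal ((real (vx i) - real (vx (Suc i))) * (real (vy i) + real (vy (Suc i))) / 2)"
    "strip i \<in> sets lborel"
    using emeasure_trapezoid[of "real (vx (Suc i))" "real (vx i)" "- slope i" "slope i * real (vx i) + real (vy i)"] nn b
    unfolding strip_def by auto
qed

lemma newton_area_eq: "2 * newton_area S = (\<Sum>i<k. d i)"
proof -
  have disj: "disjoint_family_on strip {..<k}"
  proof -
    have "strip i \<inter> strip j = {}" if "i < j" "j < k" for i j
      using vx_antimono[of "Suc i" j] that by (force simp: strip_def)
    then show ?thesis unfolding disjoint_family_on_def by (metis Int_commute lessThan_iff linorder_neqE_nat)
  qed
  have sets: "strip ` {..<k} \<subseteq> sets lborel" using strip_measure(1) by blast
  have null: "{0::real} \<times> {0..real (vy k)} \<in> null_sets lborel"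
  proof -
    have "emeasure (lborel \<Otimes>\<^sub>M lborel) ({0::real} \<times> {0..real (vy k)}) =
        emeasure lborel {0::real} * emeasure lborel {0..real (vy k)}"
      by (rule lborel.emeasure_pair_measure_Times) auto
    then have "emeasure lborel ({0::real} \<times> {0..real (vy k)}) = 0" by (simp add: lborel_prod)
    moreover have "closed ({0::real} \<times> {0..real (vy k)})" by (intro closed_Times) auto
    ultimately show ?thesis by (simp add: null_sets_def borel_closed)
  qed
  have nn: "0 \<le> (real (vx i) - real (vx (Suc i))) * (real (vy i) + real (vy (Suc i))) / 2" if "i < k" for i
    using L_coeff_pos(2)[OF that] by simp
  have "emeasure lborel (newton_below S) = emeasure lborel (\<Union>i<k. strip i)"
    unfolding newton_below_strips using null sets
    by (subst Un_commute) (intro emeasure_Un_null_set, auto)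
  also have "\<dots> = (\<Sum>i<k. emeasure lborel (strip i))"
    by (rule sum_emeasure[symmetric]) (use sets disj in auto)
  also have "\<dots> = (\<Sum>i<k. ennreal ((real (vx i) - real (vx (Suc i))) * (real (vy i) + real (vy (Suc i))) / 2))"
    by (simp add: strip_measure(2))
  also have "\<dots> = ennreal (\<Sum>i<k. (real (vx i) - real (vx (Suc i))) * (real (vy i) + real (vy (Suc i))) / 2)"
    by (rule sum_ennreal) (use nn in auto)
  finally have "newton_area S = (\<Sum>i<k. (real (vx i) - real (vx (Suc i))) * (real (vy i) + real (vy (Suc i))) / 2)"
    unfolding newton_area_def measure_def
    by (simp only:) (intro enn2real_ennreal sum_nonneg, use nn in auto)
  then have "2 * newton_area S = (\<Sum>i<k. (real (vx i) - real (vx (Suc i))) * (real (vy i) + real (vy (Suc i))))"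
    by (simp flip: sum_divide_distrib)
  \<comment> \<open>Twice the trapezoid under an edge and \<open>d i\<close>, twice the triangle
    with the origin, differ by a term that telescopes to zero.\<close>
  also have "\<dots> = (\<Sum>i<k. d i + (real (vx i) * real (vy i) - real (vx (Suc i)) * real (vy (Suc i))))"
    by (rule sum.cong) (simp_all add: d_def algebra_simps)
  also have "\<dots> = (\<Sum>i<k. d i) + (real (vx 0) * real (vy 0) - real (vx k) * real (vy k))"
    unfolding sum.distrib using sum_lessThan_telescope'[of "\<lambda>i. real (vx i) * real (vy i)" k] by simp
  finally show ?thesis using vx_k vy_0 by simp
qed

lemma newton_axes_length_eq: "newton_axes_length S = real (vx 0) + real (vy k)"
proof -
  obtain j where j: "k = Suc j" "j < k" using k_pos by (cases k) auto
  have x: "{s. (s, 0) \<in> newton_below S} = {0..real (vx 0)}"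
  proof (intro equalityI subsetI)
    fix x assume "x \<in> {s. (s, 0) \<in> newton_below S}"
    then have x: "(x, 0) \<in> newton_below S" by simp
    have "0 \<le> x" using x unfolding newton_below_eq by simp
    moreover have "x \<le> real (vx 0)"
    proof (cases "x = 0")
      case False
      then obtain i where "i < k" "(x, 0) \<in> strip i" using x unfolding newton_below_strips by auto
      then have "x \<le> real (vx i)" "vx i \<le> vx 0" using vx_antimono[of 0 i] by (auto simp: strip_def)
      then show ?thesis by linarith
    qed simp
    ultimately show "x \<in> {0..real (vx 0)}" by simp
  next
    fix x assume x: "x \<in> {0..real (vx 0)}"
    have "L 0 (x, 0) \<le> L 0 (V 0)" unfolding L_def using L_coeff_pos[OF k_pos] x vy_0
      by (intro add_mono mult_left_mono) (auto simp: V_def)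
    then show "x \<in> {s. (s, 0) \<in> newton_below S}" using x k_pos unfolding newton_below_eq L_edge by auto
  qed
  have y: "{t. (0, t) \<in> newton_below S} = {0..real (vy k)}"
    unfolding newton_below_strips by (auto simp: strip_def)
  show ?thesis unfolding newton_axes_length_def x y by simp
qed

lemma convenient_newton_number_eq:
  "convenient_newton_number S = (\<Sum>i<k. d i) - real (vx 0) - real (vy k) + 1"
  by (simp add: convenient_newton_number_def newton_area_eq newton_axes_length_eq)

end

text \<open>Without a point of \<open>S\<close> on the x-axis the whole polyhedron lies in the
  half-plane y \<ge> 1, and likewise for the other axis.\<close>

lemma convenient_imp_axis_points:
  assumes "convenient S"
  obtains a b where "(a, 0) \<in> S" "(0, b) \<in> S"
proof -
  have mem: "p \<in> newton_polyhedron S" if "p \<in> newton_diagram S" for p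
    using that face_of_imp_subset unfolding newton_diagram_def newton_faces_def by blast
  obtain p q where p: "p \<in> newton_diagram S" "snd p = 0" and q: "q \<in> newton_diagram S" "fst q = 0"
    using assms unfolding convenient_def by blast
  have "\<exists>a. (a, 0) \<in> S"
  proof (rule ccontr)
    assume "\<nexists>a. (a, 0) \<in> S"
    then have "1 \<le> 0 * real (fst z) + 1 * real (snd z)" if "z \<in> S" for z
      using that by (cases z) (auto simp: Suc_le_eq intro: Nat.gr0I)
    from newton_polyhedron_halfspace[OF _ _ this mem[OF p(1)]] p(2) show False by simp
  qed
  moreover have "\<exists>b. (0, b) \<in> S"
  proof (rule ccontr)
    assume "\<nexists>b. (0, b) \<in> S"
    then have "1 \<le> 1 * real (fst z) + 0 * real (snd z)" if "z \<in> S" for z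
      using that by (cases z) (auto simp: Suc_le_eq intro: Nat.gr0I)
    from newton_polyhedron_halfspace[OF _ _ this mem[OF q(1)]] q(2) show False by simp
  qed
  ultimately show ?thesis using that by blast
qed

section \<open>Existence of vertex chains\<close>

text \<open>The last clause makes the edge maximal on its supporting line.\<close>

definition newton_edge :: "(nat \<times> nat) set \<Rightarrow> nat \<times> nat \<Rightarrow> nat \<times> nat \<Rightarrow> bool" where
  "newton_edge S v w \<longleftrightarrow> fst w < fst v \<and> snd v < snd w \<and>
     (\<forall>z\<in>S. int (fst v) * int (snd w) - int (fst w) * int (snd v) \<le>
        (int (snd w) - int (snd v)) * int (fst z) + (int (fst v) - int (fst w)) * int (snd z)) \<and>
     (\<forall>z\<in>S. int (fst v) * int (snd w) - int (fst w) * int (snd v) =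
        (int (snd w) - int (snd v)) * int (fst z) + (int (fst v) - int (fst w)) * int (snd z) \<longrightarrow>
        snd v \<le> snd z \<and> snd z \<le> snd w)"

lemma newton_edgeI:
  assumes vw: "fst w < fst v" "snd v < snd w"
    and m: "real (snd w) - real (snd v) = m * (real (fst v) - real (fst w))"
    and ge: "\<And>z. z \<in> S \<Longrightarrow> m * (real (fst v) - real (fst z)) \<le> real (snd z) - real (snd v)"
    and eq: "\<And>z. z \<in> S \<Longrightarrow> m * (real (fst v) - real (fst z)) = real (snd z) - real (snd v) \<Longrightarrow>
      fst w \<le> fst z \<and> fst z \<le> fst v"
  shows "newton_edge S v w"
proof -
  let ?c = "real (fst v) - real (fst w)"
  let ?l = "\<lambda>z. (int (snd w) - int (snd v)) * int (fst z) + (int (fst v) - int (fst w)) * int (snd z)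
    - (int (fst v) * int (snd w) - int (fst w) * int (snd v))"
  have c: "0 < ?c" using vw by simp
  have m0: "0 < m" using m vw by (simp add: zero_less_mult_pos2[of m ?c])
  have l: "of_int (?l z) = ?c * ((real (snd z) - real (snd v)) - m * (real (fst v) - real (fst z)))" for z
  proof -
    have "?c * ((real (snd z) - real (snd v)) - m * (real (fst v) - real (fst z))) =
        ?c * (real (snd z) - real (snd v)) - (m * ?c) * (real (fst v) - real (fst z))" by (simp add: algebra_simps)
    also have "\<dots> = of_int (?l z)" unfolding m[symmetric] by (simp add: algebra_simps)
    finally show ?thesis by simp
  qed
  have "0 \<le> ?l z" if "z \<in> S" for z
  proof -
    have "0 \<le> real_of_int (?l z)" unfolding l using c ge[OF that] by simp
    then show ?thesis by (simp only: of_int_0_le_iff)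
  qed
  moreover have "snd v \<le> snd z \<and> snd z \<le> snd w" if z: "z \<in> S" and 0: "?l z = 0" for z
  proof -
    have "?c * ((real (snd z) - real (snd v)) - m * (real (fst v) - real (fst z))) = 0"
      unfolding l[symmetric] 0 by simp
    then have e: "m * (real (fst v) - real (fst z)) = real (snd z) - real (snd v)" using c by simp
    then have f: "fst w \<le> fst z" "fst z \<le> fst v" using eq[OF z] by auto
    have "0 \<le> m * (real (fst v) - real (fst z))" using m0 f by simp
    moreover have "m * (real (fst v) - real (fst z)) \<le> m * ?c" using m0 f by simp
    ultimately show ?thesis using e m by simp
  qed
  ultimately show ?thesis unfolding newton_edge_def using vw by force
qed

text \<open>Gift wrapping towards the y-axis. \<open>\<sigma>\<close> is the absolute slope of the
  edge just traversed; all of \<open>S\<close> lies on or above its line, and strictly above it to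
  the left of the current vertex. The next edge takes the least slope towards points on the left,
  and the x-coordinate decreases.\<close>

lemma newton_chain_from:
  assumes "(c, d) \<in> S" "(0, b) \<in> S" "0 \<le> \<sigma>"
    and "\<And>z. z \<in> S \<Longrightarrow> \<sigma> * (real c - real (fst z)) \<le> real (snd z) - real d"
    and "\<And>z. z \<in> S \<Longrightarrow> fst z < c \<Longrightarrow> \<sigma> * (real c - real (fst z)) < real (snd z) - real d"
  shows "\<exists>k V. V 0 = (c, d) \<and> fst (V k) = 0 \<and> (\<forall>i\<le>k. V i \<in> S) \<and> (\<forall>i<k. newton_edge S (V i) (V (Suc i)))"
  using assms
proof (induction c arbitrary: d \<sigma> rule: less_induct)
  case (less c)
  show ?case
  proof (cases "c = 0")
    case True
    then show ?thesis using less.prems(1) by (intro exI[of _ 0] exI[of _ "\<lambda>_. (c, d)"]) simp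
  next
    case False
    define \<rho> where "\<rho> z = (real (snd z) - real d) / (real c - real (fst z))" for z :: "nat \<times> nat"
    define C where "C = {z \<in> S. fst z < c \<and> \<rho> z \<le> \<rho> (0, b)}"
    have \<rho>: "real (snd z) - real d = \<rho> z * (real c - real (fst z))" if "fst z < c" for z
      using that by (simp add: \<rho>_def)
    have \<rho>\<sigma>: "\<sigma> < \<rho> z" if "z \<in> S" "fst z < c" for z
      using less.prems(5)[OF that] that(2) by (simp add: \<rho>_def pos_less_divide_eq)
    have C0: "(0, b) \<in> C" using less.prems(2) False by (simp add: C_def)
    have "finite C"
    proof (rule finite_subset)
      show "C \<subseteq> {..c} \<times> {..nat \<lceil>real d + \<rho> (0, b) * real c\<rceil>}"
      proof
        fix z assume "z \<in> C"
        then have z: "z \<in> S" "fst z < c" "\<rho> z \<le> \<rho> (0, b)" by (auto simp: C_def)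
        have "0 \<le> \<rho> z" using \<rho>\<sigma>[OF z(1,2)] less.prems(3) by simp
        then have "\<rho> z * (real c - real (fst z)) \<le> \<rho> (0, b) * real c"
          using z by (intro mult_mono) auto
        then have "real (snd z) \<le> real d + \<rho> (0, b) * real c" using \<rho>[OF z(2)] by simp
        then have "snd z \<le> nat \<lceil>real d + \<rho> (0, b) * real c\<rceil>" by linarith
        then show "z \<in> {..c} \<times> {..nat \<lceil>real d + \<rho> (0, b) * real c\<rceil>}" using z(2) by (simp add: mem_Times_iff)
      qed
    qed simp
    define m where "m = Min (\<rho> ` C)"
    have "m \<in> \<rho> ` C" unfolding m_def using \<open>finite C\<close> C0 by (intro Min_in) auto
    then obtain z0 where "z0 \<in> C" "\<rho> z0 = m" by auto
    \<comment> \<open>Among the points of least slope the leftmost is taken; this gives the strict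
      inequality needed at the next vertex.\<close>
    then obtain w where w: "w \<in> C" "\<rho> w = m" and least: "\<And>z. z \<in> C \<Longrightarrow> \<rho> z = m \<Longrightarrow> fst w \<le> fst z"
      using ex_has_least_nat[of "\<lambda>z. z \<in> C \<and> \<rho> z = m" z0 fst] by blast
    have m_le: "m \<le> \<rho> z" if "z \<in> S" "fst z < c" for z
    proof (cases "z \<in> C")
      case True
      then show ?thesis unfolding m_def using \<open>finite C\<close> by simp
    next
      case False
      then have "\<rho> (0, b) \<le> \<rho> z" using that by (auto simp: C_def)
      moreover have "m \<le> \<rho> (0, b)" unfolding m_def using \<open>finite C\<close> C0 by simp
      ultimately show ?thesis by simp
    qed
    have wS: "w \<in> S" "fst w < c" using w(1) by (auto simp: C_def)
    have mm: "\<sigma> < m" using \<rho>\<sigma>[OF wS] w(2) by simp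
    then have m0: "0 < m" using less.prems(3) by simp
    have mw: "real (snd w) - real d = m * (real c - real (fst w))" using \<rho>[OF wS(2)] w(2) by simp
    have ge: "m * (real c - real (fst z)) \<le> real (snd z) - real d" if "z \<in> S" for z
    proof (cases "fst z < c")
      case True
      then show ?thesis unfolding \<rho>[OF True] using m_le[OF that True] by (intro mult_right_mono) auto
    next
      case False
      then have "m * (real c - real (fst z)) \<le> \<sigma> * (real c - real (fst z))"
        using mm by (intro mult_right_mono_neg) auto
      then show ?thesis using less.prems(4)[OF that] by simp
    qed
    have eq: "fst w \<le> fst z \<and> fst z \<le> c" if z: "z \<in> S" "m * (real c - real (fst z)) = real (snd z) - real d" for z
    proof
      show "fst z \<le> c"
      proof (rule ccontr)
        assume "\<not> fst z \<le> c"
        then have "m * (real c - real (fst z)) < \<sigma> * (real c - real (fst z))"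
          using mm by (intro mult_strict_right_mono_neg) auto
        then show False using less.prems(4)[OF z(1)] z(2) by simp
      qed
      show "fst w \<le> fst z"
      proof (cases "fst z < c")
        case True
        then have "\<rho> z = m" using z(2) unfolding \<rho>[OF True] by simp
        moreover have "m \<le> \<rho> (0, b)" unfolding m_def using \<open>finite C\<close> C0 by simp
        ultimately have "z \<in> C" using z(1) True by (simp add: C_def)
        then show ?thesis using least \<open>\<rho> z = m\<close> by simp
      next
        case False
        then show ?thesis using wS(2) by simp
      qed
    qed
    have "0 < m * (real c - real (fst w))" using m0 wS(2) by simp
    then have inc: "d < snd w" using mw by simp
    have edge: "newton_edge S (c, d) w"
      by (rule newton_edgeI[of _ _ m]) (use wS inc mw ge eq in auto)
    have "\<exists>k V. V 0 = (fst w, snd w) \<and> fst (V k) = 0 \<and> (\<forall>i\<le>k. V i \<in> S) \<and>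
        (\<forall>i<k. newton_edge S (V i) (V (Suc i)))"
    proof (rule less.IH[OF wS(2) _ less.prems(2), of _ m])
      show "(fst w, snd w) \<in> S" "0 \<le> m" using wS m0 by simp_all
      show 1: "m * (real (fst w) - real (fst z)) \<le> real (snd z) - real (snd w)" if "z \<in> S" for z
        using ge[OF that] mw by (simp add: algebra_simps)
      show "m * (real (fst w) - real (fst z)) < real (snd z) - real (snd w)" if "z \<in> S" "fst z < fst w" for z
      proof -
        have "m * (real c - real (fst z)) \<noteq> real (snd z) - real d" using eq[OF that(1)] that(2) by auto
        then show ?thesis using ge[OF that(1)] mw by (simp add: algebra_simps)
      qed
    qed
    then obtain k V where V: "V 0 = w" "fst (V k) = 0" "\<And>i. i \<le> k \<Longrightarrow> V i \<in> S"
      "\<And>i. i < k \<Longrightarrow> newton_edge S (V i) (V (Suc i))" by auto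
    define V' where "V' = case_nat (c, d) V"
    have "V' 0 = (c, d) \<and> fst (V' (Suc k)) = 0 \<and> (\<forall>i\<le>Suc k. V' i \<in> S) \<and>
        (\<forall>i<Suc k. newton_edge S (V' i) (V' (Suc i)))"
      using V edge less.prems(1) by (auto simp: V'_def split: nat.split)
    then show ?thesis by blast
  qed
qed

text \<open>Excludes collinear edges. Applied to the support it supplies \<open>supp_edge\<close>,
  and applied to the vertices it supplies \<open>vertex_eq\<close> of a fan.\<close>

locale strict_newton_chain = newton_chain +
  assumes strict: "\<And>i z. i < k \<Longrightarrow> z \<in> S \<Longrightarrow>
      int (vx i) * int (vy (Suc i)) - int (vx (Suc i)) * int (vy i) =
      (int (vy (Suc i)) - int (vy i)) * int (fst z) + (int (vx i) - int (vx (Suc i))) * int (snd z) \<Longrightarrow>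
      vy i \<le> snd z \<and> snd z \<le> vy (Suc i)"

lemma strict_newton_chain_ex:
  assumes "(a, 0) \<in> S" "(0, b) \<in> S" "(0, 0) \<notin> S"
  shows "\<exists>k vx vy. strict_newton_chain S k vx vy"
proof -
  define a0 where "a0 = (LEAST a. (a, 0) \<in> S)"
  have a0: "(a0, 0) \<in> S" unfolding a0_def using assms(1) by (rule LeastI)
  have least: "a0 \<le> x" if "(x, 0) \<in> S" for x unfolding a0_def using that by (rule Least_le)
  have "\<exists>k V. V 0 = (a0, 0) \<and> fst (V k) = 0 \<and> (\<forall>i\<le>k. V i \<in> S) \<and> (\<forall>i<k. newton_edge S (V i) (V (Suc i)))"
  \<comment> \<open>The leftmost point on the x-axis is a start with slope 0, since all points
    further left have positive height.\<close>
  proof (rule newton_chain_from[OF a0 assms(2), of 0])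
    fix z assume z: "z \<in> S" "fst z < a0"
    have "snd z \<noteq> 0" using least[of "fst z"] z by (metis leD prod.collapse)
    then show "0 * (real a0 - real (fst z)) < real (snd z) - real 0" by simp
  qed auto
  then obtain k V where V: "V 0 = (a0, 0)" "fst (V k) = 0" "\<And>i. i \<le> k \<Longrightarrow> V i \<in> S"
    "\<And>i. i < k \<Longrightarrow> newton_edge S (V i) (V (Suc i))" by blast
  have "k \<noteq> 0"
  proof
    assume "k = 0"
    then have "a0 = 0" using V(1,2) by simp
    then show False using a0 assms(3) by simp
  qed
  then have "strict_newton_chain S k (fst \<circ> V) (snd \<circ> V)"
    using V unfolding newton_edge_def by unfold_locales auto
  then show ?thesis by blast
qed

lemma newton_chain_ex:
  assumes "(a, 0) \<in> S" "(0, b) \<in> S" "(0, 0) \<notin> S"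
  shows "\<exists>k vx vy. newton_chain S k vx vy"
  using strict_newton_chain_ex[OF assms] strict_newton_chain.axioms(1) by blast

section \<open>Dependence of the Newton number on the points on the axes\<close>

context newton_chain
begin

abbreviation "D i \<equiv> int (vx i) * int (vy (Suc i)) - int (vx (Suc i)) * int (vy i)"
abbreviation "l i z \<equiv> (int (vy (Suc i)) - int (vy i)) * int (fst z) + (int (vx i) - int (vx (Suc i))) * int (snd z)"

lemma convenient_newton_number_int:
  "convenient_newton_number S = of_int ((\<Sum>i<k. D i) - int (vx 0) - int (vy k) + 1)"
  by (simp add: convenient_newton_number_eq d_def)

text \<open>The coefficients of \<open>l i\<close> are positive, so the old chain still supports the
  larger set.\<close>

lemma insert_dominated:
  assumes w: "w \<in> S" "fst w \<le> fst z" "snd w \<le> snd z"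
  shows "newton_chain (insert z S) k vx vy"
proof -
  have "D i \<le> l i z" if i: "i < k" for i
  proof -
    have "l i w \<le> l i z" using w vx_dec[OF i] vy_inc[OF i] by (intro add_mono mult_left_mono) auto
    then show ?thesis using above[OF i w(1)] by simp
  qed
  then show ?thesis
    by unfold_locales (use k_pos vy_0 vx_k vertex_mem vx_dec vy_inc above in auto)
qed

text \<open>The polygon below a chain shrinks when a point on the \<open>y\<close>-axis is added, and the part cut
  off contains the triangle spanned by the new point and the last edge.\<close>

lemma convenient_newton_number_insert_y:
  assumes n: "0 < n" "n < vy k" and c: "\<And>i. i < k \<Longrightarrow> c \<le> vx i"
  shows "convenient_newton_number (insert (0, n) S) + (real c - 1) * (real (vy k) - real n) \<le>
    convenient_newton_number S"
proof -
  \<comment> \<open>\<open>Q i\<close> says that the new point is not above the line of edge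
    \<open>i\<close>. By convexity this persists for later edges (\<open>Q_Suc\<close>), so the new
    chain keeps the vertices up to the first such edge and then goes straight to the new
    point.\<close>
  define Q where "Q i \<longleftrightarrow> (int (vx i) - int (vx (Suc i))) * int n \<le> D i" for i
  obtain j0 where j0: "k = Suc j0" "j0 < k" using k_pos by (cases k) auto
  have "Q j0" using n(2) vx_k j0 by (simp add: Q_def mult_left_mono)
  define j where "j = (LEAST j. j < k \<and> Q j)"
  have j: "j < k" "Q j" using LeastI[of "\<lambda>j. j < k \<and> Q j" j0] \<open>Q j0\<close> j0 by (auto simp: j_def)
  have notQ: "\<not> Q i" if "i < j" for i
    using not_less_Least[of i "\<lambda>j. j < k \<and> Q j"] that j(1) by (auto simp: j_def)
  have Q_Suc: "Q (Suc i)" if i: "Suc i < k" and Qi: "Q i" for i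
  proof -
    define u p where "u = int (vx i) - int (vx (Suc i))" and "p = int (vy (Suc i)) - int (vy i)"
    define u' p' where "u' = int (vx (Suc i)) - int (vx (Suc (Suc i)))"
      and "p' = int (vy (Suc (Suc i))) - int (vy (Suc i))"
    define x y where "x = int (vx (Suc i))" and "y = int (vy (Suc i))"
    have pos: "0 < u" "0 < u'" "0 \<le> x" using vx_dec[of i] vx_dec[of "Suc i"] i by (simp_all add: u_def u'_def x_def)
    have 1: "u * (int n - y) \<le> p * x"
      using Qi by (simp add: Q_def u_def p_def x_def y_def algebra_simps)
    have "D (Suc i) \<le> l (Suc i) (vx i, vy i)" using i by (intro above vertex_mem) auto
    then have 2: "u' * p \<le> p' * u" by (simp add: u_def u'_def p_def p'_def algebra_simps)
    have "u * (u' * (int n - y)) = u' * (u * (int n - y))" by simp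
    also have "\<dots> \<le> u' * (p * x)" using 1 pos by (intro mult_left_mono) auto
    also have "\<dots> = (u' * p) * x" by simp
    also have "\<dots> \<le> (p' * u) * x" using 2 pos by (intro mult_right_mono) auto
    also have "\<dots> = u * (p' * x)" by simp
    finally have "u' * (int n - y) \<le> p' * x" using pos by simp
    then show ?thesis by (simp add: Q_def u'_def p'_def x_def y_def algebra_simps)
  qed
  have Q: "Q i" if "j \<le> i" "i < k" for i
    using that
  proof (induction i rule: dec_induct)
    case base
    then show ?case using j by simp
  next
    case (step i)
    then show ?case using Q_Suc[of i] by simp
  qed
  have vxj: "0 < vx j" using vx_dec[OF j(1)] by simp
  have vyj: "vy j < n"
  proof (cases j)
    case 0
    then show ?thesis using n vy_0 by simp
  next
    case (Suc i)
    then have i: "i < k" using j by simp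
    have "\<not> Q i" using notQ[of i] Suc by simp
    then have "D i < (int (vx i) - int (vx j)) * int n" by (simp add: Q_def Suc)
    moreover have "(int (vx i) - int (vx j)) * int (vy j) \<le> D i"
    proof -
      have "int (vx j) * int (vy i) \<le> int (vx j) * int (vy j)"
        using vy_inc[OF i] Suc by (intro mult_left_mono) auto
      then show ?thesis by (simp add: Suc algebra_simps)
    qed
    ultimately have "(int (vx i) - int (vx j)) * int (vy j) < (int (vx i) - int (vx j)) * int n" by simp
    then show ?thesis using vx_dec[OF i] Suc by simp
  qed
  \<comment> \<open>The new edge supports \<open>S\<close>: for points not to the right of vertex
    \<open>j\<close> this follows from edge \<open>j\<close>, whose line does not pass below the new
    point, and for the others from the preceding edge, whose line passes below it.\<close>
  have last: "(int n - int (vy j)) * (int (vx j) - int (fst z)) \<le> int (vx j) * (int (snd z) - int (vy j))"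
    if z: "z \<in> S" for z
  proof (cases "fst z \<le> vx j")
    case True
    define u p where "u = int (vx j) - int (vx (Suc j))" and "p = int (vy (Suc j)) - int (vy j)"
    have u: "0 < u" using vx_dec[OF j(1)] by (simp add: u_def)
    have 1: "p * (int (vx j) - int (fst z)) \<le> u * (int (snd z) - int (vy j))"
      using above[OF j(1) z] by (simp add: u_def p_def algebra_simps)
    have 2: "u * (int n - int (vy j)) \<le> p * int (vx j)"
      using j(2) by (simp add: Q_def u_def p_def algebra_simps)
    have "u * ((int n - int (vy j)) * (int (vx j) - int (fst z))) =
        (u * (int n - int (vy j))) * (int (vx j) - int (fst z))" by simp
    also have "\<dots> \<le> (p * int (vx j)) * (int (vx j) - int (fst z))" using 2 True by (intro mult_right_mono) auto
    also have "\<dots> = int (vx j) * (p * (int (vx j) - int (fst z)))" by simp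
    also have "\<dots> \<le> int (vx j) * (u * (int (snd z) - int (vy j)))" using 1 by (intro mult_left_mono) auto
    also have "\<dots> = u * (int (vx j) * (int (snd z) - int (vy j)))" by simp
    finally show ?thesis using u by simp
  next
    case False
    show ?thesis
    proof (cases j)
      case 0
      have "(int n - int (vy j)) * (int (vx j) - int (fst z)) \<le> 0"
        using False vyj by (intro mult_nonneg_nonpos) auto
      also have "0 \<le> int (vx j) * (int (snd z) - int (vy j))" using 0 vy_0 by simp
      finally show ?thesis .
    next
      case (Suc i)
      then have i: "i < k" using j by simp
      define u p where "u = int (vx i) - int (vx j)" and "p = int (vy j) - int (vy i)"
      have u: "0 < u" using vx_dec[OF i] by (simp add: u_def Suc)
      have 1: "p * (int (vx j) - int (fst z)) \<le> u * (int (snd z) - int (vy j))"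
        using above[OF i z] by (simp add: u_def p_def Suc algebra_simps)
      have "\<not> Q i" using notQ[of i] Suc by simp
      then have 2: "p * int (vx j) \<le> u * (int n - int (vy j))"
        by (simp add: Q_def u_def p_def Suc algebra_simps)
      have "u * ((int n - int (vy j)) * (int (vx j) - int (fst z))) =
          (u * (int n - int (vy j))) * (int (vx j) - int (fst z))" by simp
      also have "\<dots> \<le> (p * int (vx j)) * (int (vx j) - int (fst z))"
        using 2 False by (intro mult_right_mono_neg) auto
      also have "\<dots> = int (vx j) * (p * (int (vx j) - int (fst z)))" by simp
      also have "\<dots> \<le> int (vx j) * (u * (int (snd z) - int (vy j)))" using 1 by (intro mult_left_mono) auto
      also have "\<dots> = u * (int (vx j) * (int (snd z) - int (vy j)))" by simp
      finally show ?thesis using u by simp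
    qed
  qed
  define vx' where "vx' i = (if i \<le> j then vx i else 0)" for i
  define vy' where "vy' i = (if i \<le> j then vy i else n)" for i
  interpret C: newton_chain "insert (0, n) S" "Suc j" vx' vy'
  proof
    fix i z assume i: "i < Suc j" and z: "z \<in> insert (0, n) S"
    show "int (vx' i) * int (vy' (Suc i)) - int (vx' (Suc i)) * int (vy' i) \<le>
        (int (vy' (Suc i)) - int (vy' i)) * int (fst z) + (int (vx' i) - int (vx' (Suc i))) * int (snd z)"
    proof (cases "i = j")
      case True
      then show ?thesis using last[of z] z by (auto simp: vx'_def vy'_def algebra_simps)
    next
      case False
      then have ij: "i < j" using i by simp
      have "D i \<le> l i z"
      proof (cases "z \<in> S")
        case True
        then show ?thesis using above[of i z] ij j(1) by simp
      next
        case False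
        then show ?thesis using notQ[OF ij] z by (simp add: Q_def)
      qed
      then show ?thesis using ij by (simp add: vx'_def vy'_def)
    qed
  next
    fix i assume i: "i < Suc j"
    show "vx' (Suc i) < vx' i" "vy' i < vy' (Suc i)"
      using vx_dec[of i] vy_inc[of i] j(1) vxj vyj i
      by (cases "i = j"; auto simp: vx'_def vy'_def)+
  qed (use j vertex_mem vy_0 in \<open>auto simp: vx'_def vy'_def\<close>)
  have "(\<Sum>i<Suc j. C.D i) = (\<Sum>i<j. D i) + int (vx j) * int n"
    by (simp add: vx'_def vy'_def)
  then have CNN': "convenient_newton_number (insert (0, n) S) =
      of_int ((\<Sum>i<j. D i) + int (vx j) * int n - int (vx 0) - int n + 1)"
    using C.convenient_newton_number_int by (simp add: vx'_def vy'_def)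
  \<comment> \<open>By \<open>Q\<close> each discarded determinant is at least \<open>n\<close>
    times the x-extent of its edge. The last edge is kept out of this estimate, since its
    determinant \<open>vx j0 * vy k\<close> provides the gain.\<close>
  have "(int (vx j) - int (vx j0)) * int n + (\<Sum>i<j. D i) \<le> (\<Sum>i<j0. D i)"
  proof -
    have "j \<le> j0" using j j0 by simp
    then have "(\<Sum>i<j0. D i) = (\<Sum>i<j. D i) + (\<Sum>i=j..<j0. D i)"
      using sum.atLeastLessThan_concat[of 0 j j0 D] by (simp add: atLeast0LessThan)
    moreover have "(\<Sum>i=j..<j0. (int (vx i) - int (vx (Suc i))) * int n) \<le> (\<Sum>i=j..<j0. D i)"
      by (rule sum_mono) (use Q j0 in \<open>auto simp: Q_def\<close>)
    moreover have "(\<Sum>i=j..<j0. (int (vx i) - int (vx (Suc i))) * int n) = (int (vx j) - int (vx j0)) * int n"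
      using sum_Suc_diff'[OF \<open>j \<le> j0\<close>, of "\<lambda>i. - int (vx i)"] by (simp flip: sum_distrib_right)
    ultimately show ?thesis by simp
  qed
  moreover have "(\<Sum>i<k. D i) = (\<Sum>i<j0. D i) + int (vx j0) * int (vy k)"
    using j0 vx_k by simp
  moreover have "int c * (int (vy k) - int n) \<le> int (vx j0) * (int (vy k) - int n)"
    using c[OF j0(2)] n by (intro mult_right_mono) auto
  ultimately have "((\<Sum>i<j. D i) + int (vx j) * int n - int (vx 0) - int n + 1) + (int c - 1) * (int (vy k) - int n) \<le>
      (\<Sum>i<k. D i) - int (vx 0) - int (vy k) + 1"
    by (simp add: algebra_simps)
  then have "real_of_int (((\<Sum>i<j. D i) + int (vx j) * int n - int (vx 0) - int n + 1) + (int c - 1) * (int (vy k) - int n)) \<le>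
      of_int ((\<Sum>i<k. D i) - int (vx 0) - int (vy k) + 1)"
    by (simp only: of_int_le_iff)
  then show ?thesis unfolding CNN' convenient_newton_number_int by simp
qed

lemma swap: "newton_chain (prod.swap ` S) k (\<lambda>i. vy (k - i)) (\<lambda>i. vx (k - i))"
proof
  fix i z assume i: "i < k" and z: "z \<in> prod.swap ` S"
  then have k: "k - i = Suc (k - Suc i)" "k - Suc i < k" by auto
  obtain w where w: "w \<in> S" "z = prod.swap w" using z by blast
  show "int (vy (k - i)) * int (vx (k - Suc i)) - int (vy (k - Suc i)) * int (vx (k - i))
       \<le> (int (vx (k - Suc i)) - int (vx (k - i))) * int (fst z) + (int (vy (k - i)) - int (vy (k - Suc i))) * int (snd z)"
    using above[OF k(2) w(1)] unfolding k(1) w(2) by (simp add: algebra_simps)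
next
  fix i assume i: "i < k"
  then have k: "k - i = Suc (k - Suc i)" "k - Suc i < k" by auto
  show "vy (k - Suc i) < vy (k - i)" "vx (k - i) < vx (k - Suc i)"
    using vx_dec[OF k(2)] vy_inc[OF k(2)] k(1) by simp_all
qed (use k_pos vy_0 vx_k vertex_mem in \<open>auto intro!: image_eqI[of _ _ "(vx (k - _), vy (k - _))"]\<close>)

lemma convenient_newton_number_swap:
  "convenient_newton_number (prod.swap ` S) = convenient_newton_number S"
proof -
  interpret C: newton_chain "prod.swap ` S" k "\<lambda>i. vy (k - i)" "\<lambda>i. vx (k - i)" by (rule swap)
  have "(\<Sum>i<k. C.D i) = (\<Sum>i<k. D (k - Suc i))"
  proof (rule sum.cong[OF refl])
    fix i assume "i \<in> {..<k}"
    then have "k - i = Suc (k - Suc i)" by auto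
    then show "C.D i = D (k - Suc i)" by (simp add: mult.commute)
  qed
  also have "\<dots> = (\<Sum>i<k. D i)" by (rule sum.nat_diff_reindex)
  finally show ?thesis
    unfolding convenient_newton_number_int C.convenient_newton_number_int by (simp add: vx_k vy_0)
qed

end

text \<open>For \<open>n > 2 * b\<close> the last edge joins (0, n) to the lowest point (1, b0) of
  the column x = 1. Its triangle with the origin contributes \<open>n\<close> to twice the area, and
  the length on the y-axis cancels this contribution.\<close>

lemma newton_number_insert_y_const:
  assumes x: "\<And>z. z \<in> T \<Longrightarrow> 0 < fst z" and b: "(1, b) \<in> T" and a: "(a, 0) \<in> T"
    and n: "2 * b < n" "n \<le> n'"
  shows "convenient_newton_number (insert (0, n') T) = convenient_newton_number (insert (0, n) T)"
proof -
  define b0 where "b0 = (LEAST b. (1, b) \<in> T)"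
  have b0: "(1, b0) \<in> T" unfolding b0_def using b by (rule LeastI)
  have least: "b0 \<le> y" if "(1, y) \<in> T" for y unfolding b0_def using that by (rule Least_le)
  have b0n: "2 * b0 < n" using least[OF b] n by simp
  have "(0, 0) \<notin> insert (0, n) T" using x[of "(0, 0)"] n by auto
  then obtain k vx vy where "newton_chain (insert (0, n) T) k vx vy"
    using newton_chain_ex[of a "insert (0, n) T" n] a by auto
  then interpret C: newton_chain "insert (0, n) T" k vx vy .
  obtain j where j: "k = Suc j" "j < k" using C.k_pos by (cases k) auto
  have "(vx k, vy k) \<in> insert (0, n) T" by (rule C.vertex_mem) simp
  then have vyk: "vy k = n" using x C.vx_k by force
  have vj0: "0 < vx j" using C.vx_dec[OF j(2)] by simp
  have "(vx j, vy j) \<in> insert (0, n) T" by (rule C.vertex_mem) (use j in simp)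
  then have vjT: "(vx j, vy j) \<in> T" using vj0 by auto
  have vyj: "vy j < n" using C.vy_inc[OF j(2)] vyk j(1) by simp
  have "C.D j \<le> C.l j (1, b0)" by (rule C.above[OF j(2)]) (use b0 in simp)
  then have le: "int (vx j) * (int n - int b0) \<le> int n - int (vy j)"
    using j(1) vyk C.vx_k by (simp add: algebra_simps)
  \<comment> \<open>An edge to (0, n) from further right would leave (1, b0) below it, as
    \<open>n > 2 * b0\<close>.\<close>
  have "vx j = 1"
  proof (rule ccontr)
    assume "vx j \<noteq> 1"
    then have "2 * (int n - int b0) \<le> int (vx j) * (int n - int b0)"
      using vj0 b0n by (intro mult_right_mono) auto
    then show False using le b0n by simp
  qed
  then have vyj': "vy j = b0" using le least vjT by force
  define vy' where "vy' i = (if i \<le> j then vy i else n')" for i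
  interpret C': newton_chain "insert (0, n') T" k vx vy'
  proof
    fix i z assume i: "i < k" and z: "z \<in> insert (0, n') T"
    show "int (vx i) * int (vy' (Suc i)) - int (vx (Suc i)) * int (vy' i) \<le>
        (int (vy' (Suc i)) - int (vy' i)) * int (fst z) + (int (vx i) - int (vx (Suc i))) * int (snd z)"
    proof (cases "i = j")
      case False
      then have ij: "i < j" using i j by simp
      have "C.D i \<le> C.l i z"
      proof (cases "z \<in> T")
        case True
        then show ?thesis using C.above[OF i, of z] by simp
      next
        case False
        then have "C.l i (0, n) \<le> C.l i z"
          using z n C.vx_dec[OF i] C.vy_inc[OF i] by (auto intro!: mult_left_mono)
        then show ?thesis using C.above[OF i, of "(0, n)"] by simp
      qed
      then show ?thesis using ij by (simp add: vy'_def)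
    next
      case True
      have "int n' \<le> (int n' - int b0) * int (fst z) + int (snd z)"
      proof (cases "z = (0, n')")
        case False
        then have zT: "z \<in> T" using z by simp
        show ?thesis
        proof (cases "fst z = 1")
          case True
          then show ?thesis using least[of "snd z"] zT by (cases z) auto
        next
          case False
          then have "(int n' - int b0) * 2 \<le> (int n' - int b0) * int (fst z)"
            using x[OF zT] b0n n by (intro mult_left_mono) auto
          then show ?thesis using b0n n by simp
        qed
      qed simp
      then show ?thesis using True j(1) \<open>vx j = 1\<close> vyj' C.vx_k by (simp add: vy'_def)
    qed
  next
    fix i assume "i < k"
    then show "vy' i < vy' (Suc i)" using C.vy_inc[of i] j(1) vyj n by (cases "i = j") (auto simp: vy'_def)
  next
    fix i assume i: "i \<le> k"
    show "(vx i, vy' i) \<in> insert (0, n') T"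
    proof (cases "i \<le> j")
      case True
      then have "0 < vx i" using C.vx_dec[of i] j by simp
      then show ?thesis using C.vertex_mem[OF i] True by (auto simp: vy'_def)
    next
      case False
      then show ?thesis using i j C.vx_k by (auto simp: vy'_def le_Suc_eq)
    qed
  qed (use C.k_pos C.vy_0 C.vx_k C.vx_dec in \<open>auto simp: vy'_def\<close>)
  have "(\<Sum>i<k. C'.D i) = (\<Sum>i<j. C.D i) + int n'"
    using j(1) \<open>vx j = 1\<close> C.vx_k by (simp add: vy'_def)
  moreover have "(\<Sum>i<k. C.D i) = (\<Sum>i<j. C.D i) + int n"
    using j(1) \<open>vx j = 1\<close> C.vx_k vyk by simp
  ultimately show ?thesis
    unfolding C.convenient_newton_number_int C'.convenient_newton_number_int using vyk j(1)
    by (simp add: vy'_def)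
qed

lemma convenient_newton_number_insert_dominated:
  assumes "newton_chain T k vx vy" "w \<in> T" "fst w \<le> fst z" "snd w \<le> snd z"
  shows "convenient_newton_number (insert z T) = convenient_newton_number T"
proof -
  interpret A: newton_chain T k vx vy by (rule assms(1))
  interpret B: newton_chain "insert z T" k vx vy by (rule A.insert_dominated[OF assms(2-4)])
  show ?thesis by (simp only: A.convenient_newton_number_int B.convenient_newton_number_int)
qed

section \<open>Adding a point on each axis\<close>

text \<open>The two exponents are independent, so that one axis can be varied alone and the other is
  reached by swapping coordinates; \<open>m = n\<close> is the support of f + x^m + y^m without
  cancellation.\<close>

definition augment :: "(nat \<times> nat) set \<Rightarrow> nat \<Rightarrow> nat \<Rightarrow> (nat \<times> nat) set" where
  "augment S m n = insert (m, 0) (insert (0, n) S)"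

context
  fixes S :: "(nat \<times> nat) set"
  assumes S0: "(0, 0) \<notin> S"
begin

lemma augment_chain:
  assumes "0 < m" "0 < n"
  obtains k vx vy where "newton_chain (augment S m n) k vx vy"
  using newton_chain_ex[of m "augment S m n" n] S0 assms by (auto simp: augment_def)

text \<open>Adding (0, n) to the set for \<open>n'\<close> gives the value of the set for
  \<open>n\<close>, because (0, n') is then dominated. Adding a point on the y-axis does not raise
  the value: this is \<open>convenient_newton_number_insert_y\<close> with
  \<open>c = 1\<close>.\<close>

lemma augment_mono_y:
  assumes m: "0 < m" and n: "0 < n" "n \<le> n'"
  shows "convenient_newton_number (augment S m n) \<le> convenient_newton_number (augment S m n')"
proof -
  obtain k vx vy where "newton_chain (augment S m n') k vx vy" using augment_chain[of m n'] m n by auto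
  then interpret C: newton_chain "augment S m n'" k vx vy .
  obtain k' vx' vy' where C': "newton_chain (augment S m n) k' vx' vy'" using augment_chain[OF m n(1)] .
  have "insert (0, n) (augment S m n') = insert (0, n') (augment S m n)" by (auto simp: augment_def)
  also have "convenient_newton_number \<dots> = convenient_newton_number (augment S m n)"
    by (rule convenient_newton_number_insert_dominated[OF C', of "(0, n)"]) (use n in \<open>auto simp: augment_def\<close>)
  finally have eq: "convenient_newton_number (insert (0, n) (augment S m n')) = convenient_newton_number (augment S m n)" .
  show ?thesis
  proof (cases "n < vy k")
    case True
    have "1 \<le> vx i" if "i < k" for i using C.vx_dec[OF that] by simp
    from C.convenient_newton_number_insert_y[OF n(1) True this] show ?thesis by (simp add: eq)
  next
    case False
    have "convenient_newton_number (insert (0, n) (augment S m n')) = convenient_newton_number (augment S m n')"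
    proof (rule convenient_newton_number_insert_dominated[OF C.newton_chain_axioms])
      show "(vx k, vy k) \<in> augment S m n'" by (rule C.vertex_mem) simp
    qed (use False C.vx_k in auto)
    then show ?thesis using eq by simp
  qed
qed

end

lemma augment_swap: "prod.swap ` augment S m n = augment (prod.swap ` S) n m"
  by (auto simp: augment_def)

lemma convenient_newton_number_augment_swap:
  assumes "(0, 0) \<notin> S" "0 < m" "0 < n"
  shows "convenient_newton_number (augment (prod.swap ` S) n m) = convenient_newton_number (augment S m n)"
proof -
  obtain k vx vy where "newton_chain (augment S m n) k vx vy" using augment_chain[OF assms] .
  from newton_chain.convenient_newton_number_swap[OF this] show ?thesis by (simp only: augment_swap)
qed

lemma swap_origin: "(0, 0) \<notin> S \<Longrightarrow> (0, 0) \<notin> prod.swap ` (S :: (nat \<times> nat) set)"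
  by auto

lemma augment_mono:
  assumes S0: "(0, 0) \<notin> S" and m: "0 < m" "m \<le> m'" and n: "0 < n" "n \<le> n'"
  shows "convenient_newton_number (augment S m n) \<le> convenient_newton_number (augment S m' n')"
proof -
  have "convenient_newton_number (augment S m n) \<le> convenient_newton_number (augment S m n')"
    by (rule augment_mono_y[OF S0 m(1) n])
  also have "\<dots> = convenient_newton_number (augment (prod.swap ` S) n' m)"
    using convenient_newton_number_augment_swap[OF S0, of m n'] m n by simp
  also have "\<dots> \<le> convenient_newton_number (augment (prod.swap ` S) n' m')"
    using augment_mono_y[OF swap_origin[OF S0], of n' m m'] m n by simp
  also have "\<dots> = convenient_newton_number (augment S m' n')"
    using convenient_newton_number_augment_swap[OF S0, of m' n'] m n by simp
  finally show ?thesis .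
qed

text \<open>By monotonicity it suffices to consider the single edge from (1, 0) to (0, 1), where the
  value is 1 - 1 - 1 + 1.\<close>

lemma augment_nonneg:
  assumes S0: "(0, 0) \<notin> S" and "0 < m" "0 < n"
  shows "0 \<le> convenient_newton_number (augment S m n)"
proof -
  interpret C: newton_chain "augment S 1 1" 1 "\<lambda>i. 1 - i" "\<lambda>i. i"
  proof
    fix i z assume "i < (1::nat)" and z: "z \<in> augment S 1 1"
    then have "1 \<le> fst z + snd z" using S0 by (cases z) (auto simp: augment_def Suc_le_eq intro: Nat.gr0I)
    then show "int (1 - i) * int (Suc i) - int (1 - Suc i) * int i
         \<le> (int (Suc i) - int i) * int (fst z) + (int (1 - i) - int (1 - Suc i)) * int (snd z)"
      using \<open>i < 1\<close> by simp
  next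
    fix i :: nat assume "i \<le> 1"
    then show "(1 - i, i) \<in> augment S 1 1" by (cases i) (auto simp: augment_def)
  qed auto
  have "convenient_newton_number (augment S 1 1) = 0"
    unfolding C.convenient_newton_number_int by simp
  then show ?thesis using augment_mono[OF S0, of 1 m 1 n] assms by simp
qed

text \<open>All vertices off the y-axis have abscissa at least 2, so adding (0, 1) lowers the value
  by at least \<open>n - 1\<close>, and the lowered value is still nonnegative.\<close>

lemma augment_unbounded:
  assumes S: "\<And>z. z \<in> S \<Longrightarrow> 2 \<le> fst z" and m: "2 \<le> m" and n: "0 < n"
  shows "real n - 1 \<le> convenient_newton_number (augment S m n)"
proof -
  have S0: "(0, 0) \<notin> S" using S[of "(0, 0)"] by auto
  have m0: "0 < m" using m by simp
  obtain k vx vy where "newton_chain (augment S m n) k vx vy" using augment_chain[OF S0 m0 n] .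
  then interpret C: newton_chain "augment S m n" k vx vy .
  have x: "z = (0, n) \<or> 2 \<le> fst z" if "z \<in> augment S m n" for z
    using that S[of z] m by (auto simp: augment_def)
  have "(vx k, vy k) \<in> augment S m n" by (rule C.vertex_mem) simp
  then have vyk: "vy k = n" using x[of "(vx k, vy k)"] C.vx_k by auto
  show ?thesis
  proof (cases "n = 1")
    case True
    then show ?thesis using augment_nonneg[OF S0 m0 n] by simp
  next
    case False
    have c: "2 \<le> vx i" if "i < k" for i
      using x[of "(vx i, vy i)"] C.vertex_mem[of i] that C.vx_dec[OF that] by auto
    have "convenient_newton_number (insert (0, 1) (augment S m n)) + (real 2 - 1) * (real (vy k) - real 1) \<le>
        convenient_newton_number (augment S m n)"
      by (rule C.convenient_newton_number_insert_y) (use False n vyk c in auto)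
    moreover have "0 \<le> convenient_newton_number (augment (insert (0, n) S) m 1)"
      by (rule augment_nonneg) (use S0 n m0 in auto)
    moreover have "insert (0, 1) (augment S m n) = augment (insert (0, n) S) m 1"
      by (auto simp: augment_def)
    ultimately show ?thesis using vyk by simp
  qed
qed

text \<open>The threshold \<open>n0\<close> is uniform in \<open>m\<close>; this lets
  \<open>augment_const\<close> treat the second axis by swapping.\<close>

lemma augment_const_y:
  assumes S0: "(0, 0) \<notin> S" and b: "(0, b) \<in> S \<or> (1, b) \<in> S"
  shows "\<exists>n0>0. \<forall>m>0. \<forall>n\<ge>n0. convenient_newton_number (augment S m n) = convenient_newton_number (augment S m n0)"
proof (cases "\<exists>b. (0, b) \<in> S")
  case True
  then obtain b where b: "(0, b) \<in> S" by blast
  have b0: "0 < b" using b S0 by (auto intro: Nat.gr0I)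
  have "convenient_newton_number (augment S m n) = convenient_newton_number (insert (m, 0) S)"
    if m: "0 < m" and n: "b \<le> n" for m n
  proof -
    obtain k vx vy where "newton_chain (insert (m, 0) S) k vx vy"
      using newton_chain_ex[of m "insert (m, 0) S" b] b S0 m by auto
    from convenient_newton_number_insert_dominated[OF this, of "(0, b)" "(0, n)"] b n
    show ?thesis by (simp add: augment_def insert_commute)
  qed
  then show ?thesis using b0 by (intro exI[of _ b]) simp
next
  case False
  then have b: "(1, b) \<in> S" using b by blast
  have x: "0 < fst z" if "z \<in> S" for z using that False by (cases z) (auto intro: Nat.gr0I)
  have eq: "convenient_newton_number (augment S m n) = convenient_newton_number (augment S m (2 * b + 1))"
    if m: "0 < m" and n: "2 * b + 1 \<le> n" for m n
  proof -
    have pos: "0 < fst z" if "z \<in> insert (m, 0) S" for z using that x[of z] m by auto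
    show ?thesis
      using newton_number_insert_y_const[of "insert (m, 0) S" b m "2 * b + 1" n] pos n b
      by (simp add: augment_def insert_commute)
  qed
  show ?thesis
  proof (rule exI[of _ "2 * b + 1"], intro conjI allI impI)
    show "0 < 2 * b + 1" by simp
  qed (rule eq)
qed

lemma augment_const:
  assumes S0: "(0, 0) \<notin> S" and b: "(0, b) \<in> S \<or> (1, b) \<in> S" and a: "(a, 0) \<in> S \<or> (a, 1) \<in> S"
  shows "\<exists>n0>0. \<forall>m\<ge>n0. \<forall>n\<ge>n0. convenient_newton_number (augment S m n) = convenient_newton_number (augment S n0 n0)"
proof -
  obtain n1 where n1: "0 < n1" "\<And>m n. 0 < m \<Longrightarrow> n1 \<le> n \<Longrightarrow>
      convenient_newton_number (augment S m n) = convenient_newton_number (augment S m n1)"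
    using augment_const_y[OF S0 b] by blast
  have "(0, a) \<in> prod.swap ` S \<or> (1, a) \<in> prod.swap ` S" using a by simp
  from augment_const_y[OF swap_origin[OF S0] this] obtain n2 where n2: "0 < n2" "\<And>m n. 0 < m \<Longrightarrow> n2 \<le> n \<Longrightarrow>
      convenient_newton_number (augment (prod.swap ` S) m n) = convenient_newton_number (augment (prod.swap ` S) m n2)"
    by blast
  have eq: "convenient_newton_number (augment S m n) = convenient_newton_number (augment S n2 n1)"
    if "n2 \<le> m" "n1 \<le> n" for m n
  proof -
    have m: "0 < m" using that n2(1) by simp
    have "convenient_newton_number (augment S m n) = convenient_newton_number (augment S m n1)"
      using n1(2)[OF m] that by blast
    also have "\<dots> = convenient_newton_number (augment (prod.swap ` S) n1 m)"
      by (rule convenient_newton_number_augment_swap[OF S0 m n1(1), symmetric])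
    also have "\<dots> = convenient_newton_number (augment (prod.swap ` S) n1 n2)"
      using n2(2)[OF n1(1)] that by blast
    also have "\<dots> = convenient_newton_number (augment S n2 n1)"
      by (rule convenient_newton_number_augment_swap[OF S0 n2(1) n1(1)])
    finally show ?thesis .
  qed
  have "convenient_newton_number (augment S m n) = convenient_newton_number (augment S (max n1 n2) (max n1 n2))"
    if "max n1 n2 \<le> m" "max n1 n2 \<le> n" for m n
  proof -
    have "convenient_newton_number (augment S m n) = convenient_newton_number (augment S n2 n1)"
      by (rule eq) (use that in auto)
    also have "\<dots> = convenient_newton_number (augment S (max n1 n2) (max n1 n2))"
      by (rule eq[symmetric]) auto
    finally show ?thesis .
  qed
  moreover have "0 < max n1 n2" using n1(1) by simp
  ultimately show ?thesis by blast
qed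

lemma augment_SUP:
  assumes S0: "(0, 0) \<notin> S" and n0: "0 < n0"
    and const: "\<And>m n. n0 \<le> m \<Longrightarrow> n0 \<le> n \<Longrightarrow>
      convenient_newton_number (augment S m n) = convenient_newton_number (augment S n0 n0)"
  shows "(SUP m\<in>{1::nat..}. ereal (convenient_newton_number (S \<union> {(m, 0), (0, m)}))) =
    ereal (convenient_newton_number (augment S n0 n0))"
proof -
  have aug: "S \<union> {(m, 0), (0, m)} = augment S m m" for m by (auto simp: augment_def)
  show ?thesis unfolding aug
  proof (rule antisym)
    show "(SUP m\<in>{1::nat..}. ereal (convenient_newton_number (augment S m m))) \<le>
        ereal (convenient_newton_number (augment S n0 n0))"
    proof (rule SUP_least)
      fix m :: nat assume "m \<in> {1..}"
      then have "convenient_newton_number (augment S m m) \<le> convenient_newton_number (augment S (max m n0) (max m n0))"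
        by (intro augment_mono[OF S0]) auto
      then show "ereal (convenient_newton_number (augment S m m)) \<le> ereal (convenient_newton_number (augment S n0 n0))"
        using const[of "max m n0" "max m n0"] by simp
    qed
    show "ereal (convenient_newton_number (augment S n0 n0)) \<le>
        (SUP m\<in>{1::nat..}. ereal (convenient_newton_number (augment S m m)))"
      by (rule SUP_upper) (use n0 in simp)
  qed
qed

lemma augment_SUP_infinite:
  assumes S0: "(0, 0) \<notin> S"
    and S: "(\<forall>z\<in>S. 2 \<le> fst z) \<or> (\<forall>z\<in>S. 2 \<le> snd z)"
  shows "(SUP m\<in>{1::nat..}. ereal (convenient_newton_number (S \<union> {(m, 0), (0, m)}))) = \<infinity>"
proof -
  have aug: "S \<union> {(m, 0), (0, m)} = augment S m m" for m by (auto simp: augment_def)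
  have ge: "real m - 1 \<le> convenient_newton_number (augment S m m)" if m: "2 \<le> m" for m
    using S
  proof
    assume "\<forall>z\<in>S. 2 \<le> fst z"
    then show ?thesis using augment_unbounded[of S m m] m by simp
  next
    assume "\<forall>z\<in>S. 2 \<le> snd z"
    then have "2 \<le> fst z" if "z \<in> prod.swap ` S" for z using that by (metis fst_swap imageE)
    then have "real m - 1 \<le> convenient_newton_number (augment (prod.swap ` S) m m)"
      using augment_unbounded[of "prod.swap ` S" m m] m by simp
    then show ?thesis using convenient_newton_number_augment_swap[OF S0, of m m] m by simp
  qed
  show ?thesis unfolding aug
  proof (rule SUP_PInfty)
    fix n :: nat
    have "real n \<le> convenient_newton_number (augment S (n + 2) (n + 2))" using ge[of "n + 2"] by simp
    then show "\<exists>m\<in>{1::nat..}. ereal (real n) \<le> ereal (convenient_newton_number (augment S m m))"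
      by (intro bexI[of _ "n + 2"]) auto
  qed
qed

section \<open>The fan of a vertex chain\<close>

context strict_newton_chain
begin

text \<open>The linear form \<open>l i\<close> takes the value \<open>Dn i\<close> on edge
  \<open>i\<close>. Multiplying it by the determinants of all other edges brings every edge to the
  common value \<open>height\<close>, the product of all determinants.\<close>

definition "Dn i = vx i * vy (Suc i) - vx (Suc i) * vy i"
definition "cofactor i = (\<Prod>j\<in>{..<k} - {i}. Dn j)"
definition "height = (\<Prod>j<k. Dn j)"
definition "wx i = (vy (Suc i) - vy i) * cofactor i"
definition "wy i = (vx i - vx (Suc i)) * cofactor i"

lemma Dn: "i < k \<Longrightarrow> int (Dn i) = D i" "i < k \<Longrightarrow> 0 < Dn i"
proof -
  assume i: "i < k"
  have "vx (Suc i) * vy i < vx i * vy (Suc i)"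
    using vx_dec[OF i] vy_inc[OF i] by (intro mult_strict_mono) auto
  then show "int (Dn i) = D i" "0 < Dn i" by (simp_all add: Dn_def of_nat_diff)
qed

lemma height_eq: "i < k \<Longrightarrow> height = cofactor i * Dn i"
  unfolding height_def cofactor_def by (subst prod.remove[of _ i]) (auto simp: mult.commute)

lemma cofactor_pos: "0 < cofactor i"
  unfolding cofactor_def by (rule prod_pos) (use Dn in auto)

lemma wt_eq: "i < k \<Longrightarrow> int (wt (wx i) (wy i) z) = int (cofactor i) * l i z"
proof -
  assume i: "i < k"
  have *: "int (wx i) = (int (vy (Suc i)) - int (vy i)) * int (cofactor i)"
    "int (wy i) = (int (vx i) - int (vx (Suc i))) * int (cofactor i)"
    using vx_dec[OF i] vy_inc[OF i] by (simp_all add: wx_def wy_def of_nat_diff)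
  show ?thesis unfolding wt_def of_nat_add of_nat_mult * by (simp add: algebra_simps)
qed

lemma wt_ge_iff: "i < k \<Longrightarrow> height \<le> wt (wx i) (wy i) z \<longleftrightarrow> D i \<le> l i z"
proof -
  assume i: "i < k"
  have "height \<le> wt (wx i) (wy i) z \<longleftrightarrow> int (cofactor i) * D i \<le> int (cofactor i) * l i z"
    unfolding wt_eq[OF i, symmetric] Dn(1)[OF i, symmetric] by (simp add: height_eq[OF i] flip: of_nat_mult)
  then show ?thesis using cofactor_pos[of i] by simp
qed

lemma wt_eq_iff: "i < k \<Longrightarrow> wt (wx i) (wy i) z = height \<longleftrightarrow> D i = l i z"
proof -
  assume i: "i < k"
  have "wt (wx i) (wy i) z = height \<longleftrightarrow> int (cofactor i) * D i = int (cofactor i) * l i z"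
    unfolding wt_eq[OF i, symmetric] Dn(1)[OF i, symmetric] by (auto simp: height_eq[OF i] simp flip: of_nat_mult)
  then show ?thesis using cofactor_pos[of i] by simp
qed

lemma w_pos: "i < k \<Longrightarrow> 0 < wx i" "i < k \<Longrightarrow> 0 < wy i"
  using vx_dec[of i] vy_inc[of i] cofactor_pos[of i] by (simp_all add: wx_def wy_def)

lemma wt_vertex: "i < k \<Longrightarrow> wt (wx i) (wy i) (vx i, vy i) = height"
  "i < k \<Longrightarrow> wt (wx i) (wy i) (vx (Suc i), vy (Suc i)) = height"
  by (simp_all add: wt_eq_iff algebra_simps)

lemma wt_ge: "i < k \<Longrightarrow> z \<in> S \<Longrightarrow> height \<le> wt (wx i) (wy i) z"
  using above wt_ge_iff by blast

lemma wt_strict: "i < k \<Longrightarrow> z \<in> S \<Longrightarrow> wt (wx i) (wy i) z = height \<Longrightarrow> vy i \<le> snd z \<and> snd z \<le> vy (Suc i)"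
  using strict wt_eq_iff by blast

lemma vy_strict_mono: "i < j \<Longrightarrow> j \<le> k \<Longrightarrow> vy i < vy j"
proof (induction j)
  case (Suc j)
  then show ?case using vy_inc[of j] by (cases "i = j") auto
qed simp

sublocale fan: newton_fan k vx vy wx wy height
proof
  fix i j assume i: "i < k" and j: "j \<le> k" and eq: "wt (wx i) (wy i) (vx j, vy j) = height"
  have "vy i \<le> vy j \<and> vy j \<le> vy (Suc i)" using wt_strict[OF i vertex_mem[OF j] eq] by simp
  then show "j = i \<or> j = Suc i"
    using vy_strict_mono[of j i] vy_strict_mono[of "Suc i" j] i j
    by (metis Suc_leI leD le_less_Suc_eq less_or_eq_imp_le not_less_eq linorder_neqE_nat)
qed (use k_pos vy_0 vx_k vx_dec vy_inc w_pos wt_vertex wt_ge vertex_mem in auto)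

text \<open>At an inner vertex the sum of the two adjacent edge forms works: equality makes both
  minimal, and by strictness the two edges share only the vertex. At the ends the single edge form
  is tilted by adding one coordinate.\<close>

lemma vertex_functional:
  assumes i: "i \<le> k"
  shows "\<exists>u>0. \<exists>v>0. \<exists>c. (\<forall>z\<in>S. c \<le> wt u v z) \<and> (\<forall>z\<in>S. wt u v z = c \<longleftrightarrow> z = (vx i, vy i))"
proof -
  have I: ?thesis if "0 < u" "0 < v" "\<And>z. z \<in> S \<Longrightarrow> c \<le> wt u v z"
    "\<And>z. z \<in> S \<Longrightarrow> wt u v z = c \<longleftrightarrow> z = (vx i, vy i)" for u v c
    using that by (metis (no_types, lifting))
  have inj: "z = (vx j, vy j)" if "m < k" "j = m \<or> j = Suc m" "wt (wx m) (wy m) z = height" "snd z = vy j" for z m j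
    using wt_eq_snd_inj[of "wx m" "wy m" z "(vx j, vy j)"] w_pos wt_vertex that by auto
  consider "i = 0" | "i = k" "0 < k" | j where "i = Suc j" "Suc j < k"
    using i k_pos by (cases i) (auto simp: le_eq_less_or_eq)
  then show ?thesis
  proof cases
    case 1
    have wt': "wt (wx 0) (wy 0 + 1) z = wt (wx 0) (wy 0) z + snd z" for z by (simp add: wt_def)
    have eq: "wt (wx 0) (wy 0 + 1) z = height \<longleftrightarrow> z = (vx i, vy i)" if "z \<in> S" for z
      unfolding wt' using wt_ge[OF k_pos that] inj[of 0 0 z] wt_vertex(1)[OF k_pos] k_pos vy_0 1 by auto
    have ge: "height \<le> wt (wx 0) (wy 0 + 1) z" if "z \<in> S" for z
      unfolding wt' using wt_ge[OF k_pos that] by simp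
    have pos: "0 < wx 0" "0 < wy 0 + 1" using w_pos[OF k_pos] by simp_all
    show ?thesis by (rule I[OF pos ge eq])
  next
    case 2
    then obtain j where j: "k = Suc j" "j < k" by (cases k) auto
    have wt': "wt (wx j + 1) (wy j) z = wt (wx j) (wy j) z + fst z" for z by (simp add: wt_def)
    have eq: "wt (wx j + 1) (wy j) z = height \<longleftrightarrow> z = (vx i, vy i)" if z: "z \<in> S" for z
    proof
      assume "wt (wx j + 1) (wy j) z = height"
      then have "wt (wx j) (wy j) z = height" "fst z = 0" unfolding wt' using wt_ge[OF j(2) z] by auto
      moreover have "wt (wx j) (wy j) (0, vy k) = height" using wt_vertex(2)[OF j(2)] vx_k j(1) by simp
      ultimately have "wy j * snd z = wy j * vy k" by (simp add: wt_def)
      then show "z = (vx i, vy i)" using w_pos(2)[OF j(2)] \<open>fst z = 0\<close> vx_k 2 by (simp add: prod_eq_iff)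
    next
      assume "z = (vx i, vy i)"
      then show "wt (wx j + 1) (wy j) z = height" unfolding wt' using wt_vertex(2)[OF j(2)] vx_k 2 j(1) by simp
    qed
    have ge: "height \<le> wt (wx j + 1) (wy j) z" if "z \<in> S" for z
      unfolding wt' using wt_ge[OF j(2) that] by simp
    have pos: "0 < wx j + 1" "0 < wy j" using w_pos[OF j(2)] by simp_all
    show ?thesis by (rule I[OF pos ge eq])
  next
    case (3 j)
    then have j: "j < k" "Suc j < k" by auto
    have wt': "wt (wx j + wx (Suc j)) (wy j + wy (Suc j)) z = wt (wx j) (wy j) z + wt (wx (Suc j)) (wy (Suc j)) z" for z
      by (simp add: wt_def algebra_simps)
    have eq: "wt (wx j + wx (Suc j)) (wy j + wy (Suc j)) z = height + height \<longleftrightarrow> z = (vx i, vy i)" if z: "z \<in> S" for z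
    proof
      assume "wt (wx j + wx (Suc j)) (wy j + wy (Suc j)) z = height + height"
      then have eq: "wt (wx j) (wy j) z = height" "wt (wx (Suc j)) (wy (Suc j)) z = height"
        unfolding wt' using wt_ge[OF j(1) z] wt_ge[OF j(2) z] by auto
      then have "snd z = vy (Suc j)" using wt_strict[OF j(1) z] wt_strict[OF j(2) z] by auto
      then show "z = (vx i, vy i)" using inj[of j "Suc j" z] eq j 3 by simp
    next
      assume "z = (vx i, vy i)"
      then show "wt (wx j + wx (Suc j)) (wy j + wy (Suc j)) z = height + height"
        unfolding wt' using wt_vertex(2)[OF j(1)] wt_vertex(1)[OF j(2)] 3 by simp
    qed
    have ge: "height + height \<le> wt (wx j + wx (Suc j)) (wy j + wy (Suc j)) z" if "z \<in> S" for z
      unfolding wt' using wt_ge[OF j(1) that] wt_ge[OF j(2) that] by simp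
    have pos: "0 < wx j + wx (Suc j)" "0 < wy j + wy (Suc j)" using w_pos[OF j(1)] by simp_all
    show ?thesis by (rule I[OF pos ge eq])
  qed
qed

end

section \<open>Nondegeneracy along supporting lines\<close>

text \<open>Nondegeneracy in terms of positive integral linear forms instead of faces. On the torus,
  multiplying the derivatives of an initial part by x and y does not change their common zeros, and
  in this form the condition is easy to follow when a monomial is added or the variables are
  swapped.\<close>

definition line_nondegenerate :: "'a::field fps fps \<Rightarrow> bool" where
  "line_nondegenerate f \<longleftrightarrow> (\<forall>u v c. 0 < u \<longrightarrow> 0 < v \<longrightarrow> (\<forall>z\<in>fps2_supp f. c \<le> wt u v z) \<longrightarrow>
     (\<exists>z\<in>fps2_supp f. wt u v z = c) \<longrightarrow> (\<forall>x y. x \<noteq> 0 \<longrightarrow> y \<noteq> 0 \<longrightarrow>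
       (\<Sum>z | wt u v z = c. fps2_coeff (fps2_xdx f) z * x ^ fst z * y ^ snd z) \<noteq> 0 \<or>
       (\<Sum>z | wt u v z = c. fps2_coeff (fps2_ydy f) z * x ^ fst z * y ^ snd z) \<noteq> 0))"

lemma line_nondegenerateD:
  assumes "line_nondegenerate f" "0 < u" "0 < v" "\<And>z. z \<in> fps2_supp f \<Longrightarrow> c \<le> wt u v z"
    "z0 \<in> fps2_supp f" "wt u v z0 = c" "x \<noteq> 0" "y \<noteq> 0"
  shows "(\<Sum>z | wt u v z = c. fps2_coeff (fps2_xdx f) z * x ^ fst z * y ^ snd z) \<noteq> 0 \<or>
       (\<Sum>z | wt u v z = c. fps2_coeff (fps2_ydy f) z * x ^ fst z * y ^ snd z) \<noteq> 0"
  using assms unfolding line_nondegenerate_def by blast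

lemma poly2_eval_monom: "poly2_eval (Polynomial.monom (Polynomial.monom c i) j) x y = c * x ^ i * y ^ j"
  by (simp add: poly2_eval_def poly_monom poly_power)

lemma poly2_eval_sum: "poly2_eval (\<Sum>z\<in>A. F z) x y = (\<Sum>z\<in>A. poly2_eval (F z) x y)"
  by (simp add: poly2_eval_def poly_sum)

lemma pderiv_sum: "pderiv (\<Sum>z\<in>A. F z) = (\<Sum>z\<in>A. pderiv (F z))"
  by (induction A rule: infinite_finite_induct) (simp_all add: pderiv_add)

lemma poly2_dx_sum: "poly2_dx (\<Sum>z\<in>A. F z) = (\<Sum>z\<in>A. poly2_dx (F z))"
  by (rule poly_eqI) (simp add: poly2_dx_def coeff_map_poly coeff_sum pderiv_sum)

lemma poly2_dx_monom: "poly2_dx (Polynomial.monom (Polynomial.monom c i) j) =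
    Polynomial.monom (Polynomial.monom (of_nat i * c) (i - 1)) j"
  by (rule poly_eqI) (simp add: poly2_dx_def coeff_map_poly pderiv_monom)

lemma poly2_dy_sum: "poly2_dy (\<Sum>z\<in>A. F z) = (\<Sum>z\<in>A. poly2_dy (F z))"
  by (simp add: poly2_dy_def pderiv_sum)

lemma poly2_dy_monom: "poly2_dy (Polynomial.monom (Polynomial.monom c i) j) =
    Polynomial.monom (Polynomial.monom (of_nat j * c) i) (j - 1)"
  by (simp add: poly2_dy_def pderiv_monom of_nat_poly mult_monom flip: monom_0)

text \<open>The supporting line cuts out a compact face and carries no coefficient of
  \<open>f\<close> outside it, so the sums over the line are x and y times the derivatives of the
  initial part.\<close>

lemma newton_nondegenerate_imp_line_nondegenerate:
  assumes "newton_nondegenerate f"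
  shows "line_nondegenerate f"
  unfolding line_nondegenerate_def
proof (intro allI impI)
  fix u v c and x y :: 'a
  assume uv: "0 < u" "0 < v" and ge: "\<forall>z\<in>fps2_supp f. c \<le> wt u v z"
    and ex: "\<exists>z\<in>fps2_supp f. wt u v z = c" and xy: "x \<noteq> 0" "y \<noteq> 0"
  let ?S = "fps2_supp f"
  define \<Delta> where "\<Delta> = newton_polyhedron ?S \<inter> {p. real u * fst p + real v * snd p = real c}"
  obtain z0 where z0: "z0 \<in> ?S" "wt u v z0 = c" using ex by blast
  have wt: "real (wt u v z) = real u * real (fst z) + real v * real (snd z)" for z by (simp add: wt_def)
  have "\<Delta> \<in> newton_faces ?S" unfolding \<Delta>_def
  proof (rule newton_faces_functional)
    show "real c \<le> real u * real (fst z) + real v * real (snd z)" if "z \<in> ?S" for z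
      unfolding wt[symmetric] using ge that by simp
    show "real u * real (fst z0) + real v * real (snd z0) = real c" unfolding wt[symmetric] z0(2) ..
  qed (use uv z0 in auto)
  then have nd: "poly2_eval (poly2_dx (initial_part \<Delta> f)) x y \<noteq> 0 \<or> poly2_eval (poly2_dy (initial_part \<Delta> f)) x y \<noteq> 0"
    using assms xy unfolding newton_nondegenerate_def by blast
  let ?A = "{z. real_point z \<in> \<Delta>}" and ?B = "{z. wt u v z = c}"
  have fin: "finite ?B" by (rule finite_wt_eq[OF uv])
  have sub: "?A \<subseteq> ?B"
  proof
    fix z assume "z \<in> ?A"
    then have "real (wt u v z) = real c" by (simp add: \<Delta>_def real_point_def wt)
    then show "z \<in> ?B" by simp
  qed
  have out: "fps2_coeff f z = 0" if z: "z \<in> ?B - ?A" for z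
  proof (rule ccontr)
    assume "fps2_coeff f z \<noteq> 0"
    then have "real_point z \<in> newton_polyhedron ?S" by (intro newton_polyhedron_point) (simp add: fps2_supp_def)
    moreover have "real u * real (fst z) + real v * real (snd z) = real c" unfolding wt[symmetric] using z by simp
    ultimately show False using z by (simp add: \<Delta>_def real_point_def)
  qed
  have "x * poly2_eval (poly2_dx (initial_part \<Delta> f)) x y =
      (\<Sum>z\<in>?A. fps2_coeff (fps2_xdx f) z * x ^ fst z * y ^ snd z)"
    unfolding initial_part_def poly2_dx_sum poly2_eval_sum poly2_dx_monom poly2_eval_monom sum_distrib_left
  proof (rule sum.cong[OF refl])
    fix z show "x * (of_nat (fst z) * fps2_coeff f z * x ^ (fst z - 1) * y ^ snd z) = fps2_coeff (fps2_xdx f) z * x ^ fst z * y ^ snd z"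
      by (cases "fst z") (simp_all add: fps2_coeff_xdx)
  qed
  also have "\<dots> = (\<Sum>z\<in>?B. fps2_coeff (fps2_xdx f) z * x ^ fst z * y ^ snd z)"
    by (rule sum.mono_neutral_left[OF fin sub]) (use out in \<open>auto simp: fps2_coeff_xdx\<close>)
  finally have 1: "x * poly2_eval (poly2_dx (initial_part \<Delta> f)) x y = (\<Sum>z\<in>?B. fps2_coeff (fps2_xdx f) z * x ^ fst z * y ^ snd z)" .
  have "y * poly2_eval (poly2_dy (initial_part \<Delta> f)) x y =
      (\<Sum>z\<in>?A. fps2_coeff (fps2_ydy f) z * x ^ fst z * y ^ snd z)"
    unfolding initial_part_def poly2_dy_sum poly2_eval_sum poly2_dy_monom poly2_eval_monom sum_distrib_left
  proof (rule sum.cong[OF refl])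
    fix z show "y * (of_nat (snd z) * fps2_coeff f z * x ^ fst z * y ^ (snd z - 1)) = fps2_coeff (fps2_ydy f) z * x ^ fst z * y ^ snd z"
      by (cases "snd z") (simp_all add: fps2_coeff_ydy)
  qed
  also have "\<dots> = (\<Sum>z\<in>?B. fps2_coeff (fps2_ydy f) z * x ^ fst z * y ^ snd z)"
    by (rule sum.mono_neutral_left[OF fin sub]) (use out in \<open>auto simp: fps2_coeff_ydy\<close>)
  finally have 2: "y * poly2_eval (poly2_dy (initial_part \<Delta> f)) x y = (\<Sum>z\<in>?B. fps2_coeff (fps2_ydy f) z * x ^ fst z * y ^ snd z)" .
  show "(\<Sum>z\<in>?B. fps2_coeff (fps2_xdx f) z * x ^ fst z * y ^ snd z) \<noteq> 0 \<or>
      (\<Sum>z\<in>?B. fps2_coeff (fps2_ydy f) z * x ^ fst z * y ^ snd z) \<noteq> 0"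
    unfolding 1[symmetric] 2[symmetric] using nd xy by simp
qed

theorem milnor_number_of_convenient:
  fixes f :: "'k::alg_closed_field fps fps"
  assumes nd: "line_nondegenerate f" and a: "(a, 0) \<in> fps2_supp f" and b: "(0, b) \<in> fps2_supp f"
    and 0: "(0, 0) \<notin> fps2_supp f"
  shows "\<exists>n. milnor_number f = enat n \<and> convenient_newton_number (fps2_supp f) = real n"
proof -
  obtain k vx vy where "strict_newton_chain (fps2_supp f) k vx vy"
    using strict_newton_chain_ex[OF a b 0] by blast
  then interpret C: strict_newton_chain "fps2_supp f" k vx vy .
  interpret K: kouchnirenko k vx vy C.wx C.wy C.height f
  proof
    fix i z assume z: "fps2_coeff f z \<noteq> 0" and i: "i < k"
    then have zS: "z \<in> fps2_supp f" by (simp add: fps2_supp_def)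
    show "C.height \<le> C.fan.W i z" unfolding C.fan.W_def by (rule C.wt_ge[OF i zS])
    show "vy i \<le> snd z \<and> snd z \<le> vy (Suc i)" if "C.fan.W i z = C.height"
      using C.wt_strict[OF i zS] that unfolding C.fan.W_def .
  next
    fix i and x :: 'k assume i: "i < k" and x: "x \<noteq> 0"
    have "(vx i, vy i) \<in> fps2_supp f" using C.vertex_mem i by simp
    from line_nondegenerateD[OF nd C.w_pos[OF i] C.wt_ge[OF i] this C.wt_vertex(1)[OF i] one_neq_zero x]
    have "(\<Sum>z | wt (C.wx i) (C.wy i) z = C.height. fps2_coeff (fps2_xdx f) z * 1 ^ fst z * x ^ snd z) \<noteq> 0 \<or>
       (\<Sum>z | wt (C.wx i) (C.wy i) z = C.height. fps2_coeff (fps2_ydy f) z * 1 ^ fst z * x ^ snd z) \<noteq> 0" .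
    then show "poly (edge_poly (C.wx i) (C.wy i) C.height (fps2_xdx f)) x \<noteq> 0 \<or>
        poly (edge_poly (C.wx i) (C.wy i) C.height (fps2_ydy f)) x \<noteq> 0"
      by (simp add: poly_edge_poly[OF C.w_pos[OF i]])
  next
    fix i assume i: "i \<le> k"
    \<comment> \<open>A form that is minimal only at the vertex reduces both sums to a single
      term.\<close>
    obtain u v c where uv: "0 < u" "0 < v" and c: "\<forall>z\<in>fps2_supp f. c \<le> wt u v z"
      "\<forall>z\<in>fps2_supp f. wt u v z = c \<longleftrightarrow> z = (vx i, vy i)"
      using C.vertex_functional[OF i] by blast
    have V: "(vx i, vy i) \<in> fps2_supp f" by (rule C.vertex_mem[OF i])
    have sum: "(\<Sum>z | wt u v z = c. F z) = F (vx i, vy i)"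
      if "\<And>z. z \<notin> fps2_supp f \<Longrightarrow> F z = 0" for F :: "_ \<Rightarrow> 'k"
    proof -
      have "(\<Sum>z | wt u v z = c. F z) = (\<Sum>z\<in>{(vx i, vy i)}. F z)"
        by (rule sum.mono_neutral_right) (use finite_wt_eq[OF uv] V c that in auto)
      then show ?thesis by simp
    qed
    have "(\<Sum>z | wt u v z = c. fps2_coeff (fps2_xdx f) z * 1 ^ fst z * 1 ^ snd z) \<noteq> 0 \<or>
       (\<Sum>z | wt u v z = c. fps2_coeff (fps2_ydy f) z * 1 ^ fst z * 1 ^ snd z) \<noteq> 0"
      by (rule line_nondegenerateD[OF nd uv _ V]) (use c V in auto)
    then show "fps2_coeff (fps2_xdx f) (vx i, vy i) \<noteq> 0 \<or> fps2_coeff (fps2_ydy f) (vx i, vy i) \<noteq> 0"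
      using sum[of "fps2_coeff (fps2_xdx f)"] sum[of "fps2_coeff (fps2_ydy f)"]
      by (simp add: fps2_supp_def fps2_coeff_xdx fps2_coeff_ydy)
  qed
  let ?n = "card K.T - (card K.U1 + card K.U2)"
  have "milnor_number f = enat ?n" and le: "card K.U1 + card K.U2 \<le> card K.T"
    using K.milnor_number_eq_card by auto
  moreover have "int ?n = (\<Sum>i<k. C.D i) - int (vx 0) - int (vy k) + 1"
    using C.fan.card_newton_number le unfolding K.T_def K.U1_def K.U2_def C.fan.D_def by (simp add: of_nat_diff)
  then have "real_of_int (int ?n) = of_int ((\<Sum>i<k. C.D i) - int (vx 0) - int (vy k) + 1)"
    by (simp only:)
  then have "convenient_newton_number (fps2_supp f) = real ?n"
    by (simp only: C.convenient_newton_number_int of_int_of_nat_eq)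
  ultimately show ?thesis by blast
qed

section \<open>Completing a series to a convenient one\<close>

lemma fps2_supp_add_monom:
  assumes "z \<notin> fps2_supp f"
  shows "fps2_supp (f + fps2_monom z :: 'a::comm_ring_1 fps fps) = insert z (fps2_supp f)"
  using assms by (auto simp: fps2_supp_def fps2_coeff_monom)

text \<open>For \<open>n > 2b\<close> the only new edge joins \<open>(0, n)\<close> to a point \<open>(1, b')\<close>, and the form
  \<open>c x y^b' + y^n\<close> on it has a nonvanishing derivative with respect to \<open>x\<close> on the torus.\<close>

lemma line_nondegenerate_add_y:
  fixes f :: "'a::field fps fps"
  assumes nd: "line_nondegenerate f" and x: "\<And>z. z \<in> fps2_supp f \<Longrightarrow> 0 < fst z"
    and b: "(1, b) \<in> fps2_supp f" and n: "2 * b < n" "of_nat n \<noteq> (0 :: 'a)"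
  shows "line_nondegenerate (f + fps2_monom (0, n))"
  unfolding line_nondegenerate_def
proof (intro allI impI)
  fix u v c and \<xi> \<eta> :: 'a
  let ?f = "f + fps2_monom (0, n)" and ?S = "fps2_supp f"
  have n0: "(0, n) \<notin> ?S" using x[of "(0, n)"] by auto
  have supp: "fps2_supp ?f = insert (0, n) ?S" using fps2_supp_add_monom[OF n0] .
  assume uv: "0 < u" "0 < v" and ge: "\<forall>z\<in>fps2_supp ?f. c \<le> wt u v z"
    and ex: "\<exists>z\<in>fps2_supp ?f. wt u v z = c" and xy: "\<xi> \<noteq> 0" "\<eta> \<noteq> 0"
  have fin: "finite {z. wt u v z = c}" by (rule finite_wt_eq[OF uv])
  have cx: "fps2_coeff (fps2_xdx ?f) z = fps2_coeff (fps2_xdx f) z" for z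
    by (auto simp: fps2_coeff_xdx fps2_coeff_monom)
  have cy: "fps2_coeff (fps2_ydy ?f) z = (if z = (0, n) then of_nat n else fps2_coeff (fps2_ydy f) z)" for z
    using n0 by (auto simp: fps2_coeff_ydy fps2_coeff_monom fps2_supp_def)
  show "(\<Sum>z | wt u v z = c. fps2_coeff (fps2_xdx ?f) z * \<xi> ^ fst z * \<eta> ^ snd z) \<noteq> 0 \<or>
     (\<Sum>z | wt u v z = c. fps2_coeff (fps2_ydy ?f) z * \<xi> ^ fst z * \<eta> ^ snd z) \<noteq> 0"
  proof (cases "wt u v (0, n) = c")
    case False
    then obtain z0 where z0: "z0 \<in> ?S" "wt u v z0 = c" using ex supp by auto
    have ge': "c \<le> wt u v z" if "z \<in> ?S" for z using ge supp that by auto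
    have "(\<Sum>z | wt u v z = c. fps2_coeff (fps2_ydy ?f) z * \<xi> ^ fst z * \<eta> ^ snd z) =
        (\<Sum>z | wt u v z = c. fps2_coeff (fps2_ydy f) z * \<xi> ^ fst z * \<eta> ^ snd z)"
      by (rule sum.cong) (use False in \<open>auto simp: cy\<close>)
    then show ?thesis
      using line_nondegenerateD[OF nd uv ge' z0 xy] by (simp add: cx)
  next
    case True
    show ?thesis
    proof (cases "\<exists>z\<in>?S. wt u v z = c")
      \<comment> \<open>Only the new monomial lies on the line; its y-derivative survives because
        \<open>n\<close> is nonzero in the field.\<close>
      case False
      have "(\<Sum>z | wt u v z = c. fps2_coeff (fps2_ydy ?f) z * \<xi> ^ fst z * \<eta> ^ snd z) =
          (\<Sum>z\<in>{(0, n)}. fps2_coeff (fps2_ydy ?f) z * \<xi> ^ fst z * \<eta> ^ snd z)"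
      proof (rule sum.mono_neutral_right[OF fin])
        show "\<forall>z\<in>{z. wt u v z = c} - {(0, n)}. fps2_coeff (fps2_ydy ?f) z * \<xi> ^ fst z * \<eta> ^ snd z = 0"
          using False unfolding cy by (auto simp: fps2_coeff_ydy fps2_supp_def)
      qed (use True in auto)
      also have "\<dots> = of_nat n * \<eta> ^ n" by (simp add: cy)
      finally show ?thesis using n(2) xy by simp
    next
      case ex1: True
      \<comment> \<open>A point of abscissa at least 2 on the line gives 2 u \<le> v n, and (1, b),
        not lying below the line, gives v n \<le> u + v b; for n > 2 b these are
        incompatible.\<close>
      have one: "fst z = 1" if z: "z \<in> ?S" "wt u v z = c" for z
      proof (rule ccontr)
        assume "fst z \<noteq> 1"
        then have "2 \<le> fst z" using x[OF z(1)] by simp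
        then have "u * 2 \<le> u * fst z" by simp
        also have "\<dots> \<le> v * n" using z(2) True by (simp add: wt_def)
        finally have "u * 2 \<le> v * n" .
        moreover have "v * n \<le> u + v * b" using ge supp b True by (auto simp: wt_def)
        moreover have "v * (2 * b) < v * n" by (rule mult_strict_left_mono[OF n(1) uv(2)])
        moreover have "v * (2 * b) = 2 * (v * b)" by simp
        ultimately show False by linarith
      qed
      obtain z1 where z1: "z1 \<in> ?S" "wt u v z1 = c" using ex1 by blast
      have uniq: "z = z1" if "z \<in> ?S" "wt u v z = c" for z
      proof -
        have "v * snd z = v * snd z1"
          using that(2) z1(2) unfolding wt_def one[OF that] one[OF z1] by linarith
        then show ?thesis using uv(2) one[OF that] one[OF z1] by (simp add: prod_eq_iff)
      qed
      have "(\<Sum>z | wt u v z = c. fps2_coeff (fps2_xdx ?f) z * \<xi> ^ fst z * \<eta> ^ snd z) =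
          (\<Sum>z\<in>{z1}. fps2_coeff (fps2_xdx ?f) z * \<xi> ^ fst z * \<eta> ^ snd z)"
      proof (rule sum.mono_neutral_right[OF fin])
        show "\<forall>z\<in>{z. wt u v z = c} - {z1}. fps2_coeff (fps2_xdx ?f) z * \<xi> ^ fst z * \<eta> ^ snd z = 0"
        proof
          fix z assume "z \<in> {z. wt u v z = c} - {z1}"
          then have "z \<notin> ?S" using uniq[of z] by auto
          then show "fps2_coeff (fps2_xdx ?f) z * \<xi> ^ fst z * \<eta> ^ snd z = 0"
            unfolding cx by (simp add: fps2_coeff_xdx fps2_supp_def)
        qed
      qed (use z1 in auto)
      also have "\<dots> \<noteq> 0"
        using z1(1) one[OF z1] xy unfolding cx by (simp add: fps2_coeff_xdx fps2_supp_def)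
      finally show ?thesis by blast
    qed
  qed
qed

definition fps2_swap :: "'a::zero fps fps \<Rightarrow> 'a fps fps" where
  "fps2_swap f = Abs_fps2 (\<lambda>z. fps2_coeff f (prod.swap z))"

lemma fps2_coeff_swap: "fps2_coeff (fps2_swap f) z = fps2_coeff f (prod.swap z)"
  by (simp add: fps2_swap_def)

lemma fps2_supp_swap: "fps2_supp (fps2_swap f) = prod.swap ` fps2_supp f"
  by (force simp: fps2_supp_def fps2_coeff_swap intro: image_eqI[of _ _ "prod.swap _"])

lemma line_nondegenerate_swap:
  fixes f :: "'a::field fps fps"
  assumes nd: "line_nondegenerate f"
  shows "line_nondegenerate (fps2_swap f)"
  unfolding line_nondegenerate_def
proof (intro allI impI)
  fix u v c and x y :: 'a
  assume uv: "0 < u" "0 < v" and ge: "\<forall>z\<in>fps2_supp (fps2_swap f). c \<le> wt u v z"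
    and ex: "\<exists>z\<in>fps2_supp (fps2_swap f). wt u v z = c" and xy: "x \<noteq> 0" "y \<noteq> 0"
  have wt: "wt u v (prod.swap z) = wt v u z" for z by (simp add: wt_def)
  obtain z0 where z0: "z0 \<in> fps2_supp f" "wt v u z0 = c" using ex wt unfolding fps2_supp_swap by auto
  have ge': "c \<le> wt v u z" if "z \<in> fps2_supp f" for z
    using ge that unfolding fps2_supp_swap wt[symmetric] by blast
  have bij: "bij_betw prod.swap {z. wt v u z = c} {z. wt u v z = c}"
    by (rule bij_betwI[where g = prod.swap]) (auto simp: wt_def)
  have "(\<Sum>z | wt u v z = c. F z) = (\<Sum>z | wt v u z = c. F (prod.swap z))" for F :: "_ \<Rightarrow> 'a"
    using sum.reindex_bij_betw[OF bij, of F] by simp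
  then show "(\<Sum>z | wt u v z = c. fps2_coeff (fps2_xdx (fps2_swap f)) z * x ^ fst z * y ^ snd z) \<noteq> 0 \<or>
      (\<Sum>z | wt u v z = c. fps2_coeff (fps2_ydy (fps2_swap f)) z * x ^ fst z * y ^ snd z) \<noteq> 0"
    using line_nondegenerateD[OF nd uv(2,1) ge' z0 xy(2,1)]
    by (auto simp: fps2_coeff_xdx fps2_coeff_ydy fps2_coeff_swap mult_ac)
qed

lemma line_nondegenerate_add_x:
  fixes f :: "'a::field fps fps"
  assumes nd: "line_nondegenerate f" and y: "\<And>z. z \<in> fps2_supp f \<Longrightarrow> 0 < snd z"
    and a: "(a, 1) \<in> fps2_supp f" and n: "2 * a < n" "of_nat n \<noteq> (0 :: 'a)"
  shows "line_nondegenerate (f + fps2_monom (n, 0))"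
proof -
  have "line_nondegenerate (fps2_swap (fps2_swap f + fps2_monom (0, n)))"
  proof (intro line_nondegenerate_swap line_nondegenerate_add_y[of _ a])
    show "0 < fst z" if "z \<in> fps2_supp (fps2_swap f)" for z
      using that y unfolding fps2_supp_swap by auto
  qed (use nd a n in \<open>auto simp: fps2_supp_swap line_nondegenerate_swap\<close>)
  moreover have "fps2_swap (fps2_swap f + fps2_monom (0, n)) = f + fps2_monom (n, 0)"
    by (rule fps2_eqI) (auto simp: fps2_coeff_swap fps2_coeff_monom prod_eq_iff)
  ultimately show ?thesis by simp
qed

lemma fps2_dx_add_y: "fps2_dx (f + fps2_monom (0, n) :: 'a::comm_ring_1 fps fps) = fps2_dx f"
  by (rule fps2_eqI) (simp add: fps2_coeff_dx fps2_coeff_monom)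

lemma fps2_dy_add_y: "fps2_dy (f + fps2_monom (0, n) :: 'a::comm_ring_1 fps fps) =
    fps2_dy f + fps2_const (of_nat n) * fps2_monom (0, 1) ^ (n - 1)"
  by (rule fps2_eqI) (cases n, auto simp: fps2_coeff_dy fps2_monom_power fps2_coeff_monom prod_eq_iff distrib_left fps2_const_hom(3))

lemma fps2_dy_add_x: "fps2_dy (f + fps2_monom (n, 0) :: 'a::comm_ring_1 fps fps) = fps2_dy f"
  by (rule fps2_eqI) (simp add: fps2_coeff_dy fps2_coeff_monom)

lemma fps2_dx_add_x: "fps2_dx (f + fps2_monom (n, 0) :: 'a::comm_ring_1 fps fps) =
    fps2_dx f + fps2_const (of_nat n) * fps2_monom (1, 0) ^ (n - 1)"
  by (rule fps2_eqI) (cases n, auto simp: fps2_coeff_dx fps2_monom_power fps2_coeff_monom prod_eq_iff distrib_left fps2_const_hom(3))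

text \<open>The added power changes the derivative by a multiple of y^(n - 1), so
  \<open>N < n - 1\<close> is the margin that \<open>fps2_ideal_perturb\<close> asks for.\<close>

lemma milnor_number_add_y:
  fixes f :: "'a::field fps fps"
  assumes "milnor_number (f + fps2_monom (0, n)) = enat N" "N < n - 1"
  shows "milnor_number f = enat N"
proof -
  have "fps2_ideal {fps2_dx f, fps2_dy f} =
      fps2_ideal {fps2_dx f, fps2_dy f + fps2_const (of_nat n) * fps2_monom (0, 1) ^ (n - 1)}"
    by (rule fps2_ideal_perturb[where n = N])
       (use assms in \<open>auto simp: milnor_number_def fps2_dx_add_y fps2_dy_add_y\<close>)
  then show ?thesis using assms(1) by (simp add: milnor_number_def fps2_dx_add_y fps2_dy_add_y)
qed

lemma milnor_number_add_x:
  fixes f :: "'a::field fps fps"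
  assumes "milnor_number (f + fps2_monom (n, 0)) = enat N" "N < n - 1"
  shows "milnor_number f = enat N"
proof -
  have "fps2_ideal {fps2_dy f, fps2_dx f} =
      fps2_ideal {fps2_dy f, fps2_dx f + fps2_const (of_nat n) * fps2_monom (1, 0) ^ (n - 1)}"
    by (rule fps2_ideal_perturb[where n = N])
       (use assms in \<open>auto simp: milnor_number_def fps2_dx_add_x fps2_dy_add_x insert_commute\<close>)
  then show ?thesis using assms(1)
    by (simp add: milnor_number_def fps2_dx_add_x fps2_dy_add_x insert_commute)
qed

text \<open>Stated for arbitrary supports, convenient or not, so that a support and its completion
  by a point on an axis are compared through one notion.\<close>

definition eventual_newton_number :: "(nat \<times> nat) set \<Rightarrow> real \<Rightarrow> bool" where
  "eventual_newton_number S v \<longleftrightarrow>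
     (\<exists>n0>0. \<forall>m\<ge>n0. \<forall>n\<ge>n0. convenient_newton_number (augment S m n) = v)"

lemma eventual_newton_number_ex:
  assumes "(0, 0) \<notin> S" "(0, b) \<in> S \<or> (1, b) \<in> S" "(a, 0) \<in> S \<or> (a, 1) \<in> S"
  shows "\<exists>v. eventual_newton_number S v"
  using augment_const[OF assms] unfolding eventual_newton_number_def by blast

lemma eventual_newton_number_convenient:
  assumes S0: "(0, 0) \<notin> S" and a: "(a, 0) \<in> S" and b: "(0, b) \<in> S"
  shows "eventual_newton_number S (convenient_newton_number S)"
proof -
  have "convenient_newton_number (augment S m n) = convenient_newton_number S"
    if mn: "max 1 (max a b) \<le> m" "max 1 (max a b) \<le> n" for m n
  proof -
    obtain k vx vy where C: "newton_chain S k vx vy" using newton_chain_ex[OF a b S0] by blast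
    have 1: "convenient_newton_number (insert (0, n) S) = convenient_newton_number S"
      by (rule convenient_newton_number_insert_dominated[OF C b]) (use mn in auto)
    have C': "newton_chain (insert (0, n) S) k vx vy"
      by (rule newton_chain.insert_dominated[OF C b]) (use mn in auto)
    have "convenient_newton_number (insert (m, 0) (insert (0, n) S)) = convenient_newton_number (insert (0, n) S)"
      by (rule convenient_newton_number_insert_dominated[OF C', of "(a, 0)"]) (use mn a in auto)
    then show ?thesis unfolding augment_def 1 .
  qed
  moreover have "0 < max 1 (max a b)" by simp
  ultimately show ?thesis unfolding eventual_newton_number_def by blast
qed

text \<open>For \<open>n\<close> past the threshold all higher points on the y-axis are dominated by
  (0, n), so the completed support keeps the value already reached.\<close>

lemma eventual_newton_number_insert_y:
  assumes S0: "(0, 0) \<notin> S" and ev: "eventual_newton_number S v"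
  shows "\<exists>n1. \<forall>n\<ge>n1. \<forall>w. eventual_newton_number (insert (0, n) S) w \<longrightarrow> w = v"
proof -
  obtain n0 where n0: "0 < n0" "\<And>m n. n0 \<le> m \<Longrightarrow> n0 \<le> n \<Longrightarrow> convenient_newton_number (augment S m n) = v"
    using ev unfolding eventual_newton_number_def by blast
  have "w = v" if n: "n0 \<le> n" and w: "eventual_newton_number (insert (0, n) S) w" for n w
  proof -
    obtain n2 where n2: "\<And>m' n'. n2 \<le> m' \<Longrightarrow> n2 \<le> n' \<Longrightarrow> convenient_newton_number (augment (insert (0, n) S) m' n') = w"
      using w unfolding eventual_newton_number_def by blast
    define m where "m = max n0 n2"
    define n' where "n' = max n n2"
    have pos: "0 < m" "0 < n" using n0(1) n by (simp_all add: m_def)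
    obtain k vx vy where C: "newton_chain (augment S m n) k vx vy" using augment_chain[OF S0 pos] .
    have "augment (insert (0, n) S) m n' = insert (0, n') (augment S m n)" by (auto simp: augment_def)
    moreover have "convenient_newton_number (insert (0, n') (augment S m n)) = convenient_newton_number (augment S m n)"
      by (rule convenient_newton_number_insert_dominated[OF C, of "(0, n)"]) (auto simp: augment_def n'_def)
    ultimately show ?thesis using n2[of m n'] n0(2)[of m n] n by (simp add: m_def n'_def)
  qed
  then show ?thesis by blast
qed

lemma eventual_newton_number_swap:
  assumes S0: "(0, 0) \<notin> S" and ev: "eventual_newton_number S v"
  shows "eventual_newton_number (prod.swap ` S) v"
proof -
  obtain n0 where n0: "0 < n0" "\<And>m n. n0 \<le> m \<Longrightarrow> n0 \<le> n \<Longrightarrow> convenient_newton_number (augment S m n) = v"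
    using ev unfolding eventual_newton_number_def by blast
  have "convenient_newton_number (augment (prod.swap ` S) n m) = v" if "n0 \<le> m" "n0 \<le> n" for m n
    using convenient_newton_number_augment_swap[OF S0, of m n] n0(1) n0(2)[OF that] that by simp
  then show ?thesis using n0(1) unfolding eventual_newton_number_def by blast
qed

lemma eventual_newton_number_insert_x:
  assumes S0: "(0, 0) \<notin> S" and ev: "eventual_newton_number S v"
  shows "\<exists>n1. \<forall>n\<ge>n1. \<forall>w. eventual_newton_number (insert (n, 0) S) w \<longrightarrow> w = v"
proof -
  obtain n1 where n1: "\<And>n w. n1 \<le> n \<Longrightarrow> eventual_newton_number (insert (0, n) (prod.swap ` S)) w \<Longrightarrow> w = v"
    using eventual_newton_number_insert_y[OF swap_origin[OF S0] eventual_newton_number_swap[OF S0 ev]] by blast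
  have "w = v" if n: "max 1 n1 \<le> n" and w: "eventual_newton_number (insert (n, 0) S) w" for n w
  proof -
    have "(0, 0) \<notin> insert (n, 0) S" using S0 n by auto
    from eventual_newton_number_swap[OF this w] show ?thesis using n1[of n w] n by simp
  qed
  then show ?thesis by blast
qed

text \<open>Two consecutive integers cannot both vanish in the ring; this supplies exponents prime
  to the characteristic.\<close>

lemma ex_large_of_nat_nonzero: "\<exists>n\<ge>N. of_nat n \<noteq> (0 :: 'a::comm_ring_1)"
proof (cases "of_nat N = (0 :: 'a)")
  case True
  then have "of_nat (Suc N) \<noteq> (0 :: 'a)" by simp
  then show ?thesis by (intro exI[of _ "Suc N"]) simp
qed blast

theorem milnor_number_eventual_convenient:
  fixes f :: "'k::alg_closed_field fps fps"
  assumes nd: "line_nondegenerate f" and S0: "(0, 0) \<notin> fps2_supp f"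
    and a: "(a, 0) \<in> fps2_supp f" and b: "(0, b) \<in> fps2_supp f \<or> (1, b) \<in> fps2_supp f"
  shows "\<exists>N. milnor_number f = enat N \<and> eventual_newton_number (fps2_supp f) (real N)"
proof (cases "\<exists>b. (0, b) \<in> fps2_supp f")
  case True
  then obtain b where b: "(0, b) \<in> fps2_supp f" by blast
  obtain N where "milnor_number f = enat N" "convenient_newton_number (fps2_supp f) = real N"
    using milnor_number_of_convenient[OF nd a b S0] by blast
  then show ?thesis using eventual_newton_number_convenient[OF S0 a b] by auto
next
  case False
  then have b: "(1, b) \<in> fps2_supp f" and x: "\<And>z. z \<in> fps2_supp f \<Longrightarrow> 0 < fst z"
    using b by (force, metis not_gr_zero prod.collapse)
  obtain v where v: "eventual_newton_number (fps2_supp f) v"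
    using eventual_newton_number_ex[OF S0, of b a] a b by blast
  obtain n1 where n1: "\<And>n w. n1 \<le> n \<Longrightarrow> eventual_newton_number (insert (0, n) (fps2_supp f)) w \<Longrightarrow> w = v"
    using eventual_newton_number_insert_y[OF S0 v] by blast
  \<comment> \<open>\<open>v\<close> is fixed before \<open>n\<close> is chosen, so
    \<open>n - 1\<close> can be made to exceed the Milnor number that the completed series turns out
    to have.\<close>
  obtain n where n: "max n1 (max (2 * b + 1) (nat \<lceil>v\<rceil> + 2)) \<le> n" "of_nat n \<noteq> (0 :: 'k)"
    using ex_large_of_nat_nonzero by blast
  let ?f = "f + fps2_monom (0, n)"
  have supp: "fps2_supp ?f = insert (0, n) (fps2_supp f)"
    by (rule fps2_supp_add_monom) (use False in auto)
  have nd': "line_nondegenerate ?f"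
    by (rule line_nondegenerate_add_y[OF nd x b]) (use n in auto)
  have S0': "(0, 0) \<notin> fps2_supp ?f" using S0 n unfolding supp by auto
  have a': "(a, 0) \<in> fps2_supp ?f" and n': "(0, n) \<in> fps2_supp ?f" using a unfolding supp by auto
  obtain N where N: "milnor_number ?f = enat N" "convenient_newton_number (fps2_supp ?f) = real N"
    using milnor_number_of_convenient[OF nd' a' n' S0'] by blast
  have "real N = v"
    using n1[of n "real N"] eventual_newton_number_convenient[OF S0' a' n'] N(2) n(1) unfolding supp by simp
  then have "N < n - 1" using n(1) by simp linarith
  then have "milnor_number f = enat N" using milnor_number_add_y N(1) by blast
  then show ?thesis using v \<open>real N = v\<close> by auto
qed

text \<open>The x-axis is completed first, if necessary; the completed series then falls under
  \<open>milnor_number_eventual_convenient\<close>, which takes care of the y-axis.\<close>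

theorem milnor_number_eventual:
  fixes f :: "'k::alg_closed_field fps fps"
  assumes nd: "line_nondegenerate f" and S0: "(0, 0) \<notin> fps2_supp f"
    and a: "(a, 0) \<in> fps2_supp f \<or> (a, 1) \<in> fps2_supp f"
    and b: "(0, b) \<in> fps2_supp f \<or> (1, b) \<in> fps2_supp f"
  shows "\<exists>N. milnor_number f = enat N \<and> eventual_newton_number (fps2_supp f) (real N)"
proof (cases "\<exists>a. (a, 0) \<in> fps2_supp f")
  case True
  then show ?thesis using milnor_number_eventual_convenient[OF nd S0 _ b] by blast
next
  case False
  then have a: "(a, 1) \<in> fps2_supp f" and y: "\<And>z. z \<in> fps2_supp f \<Longrightarrow> 0 < snd z"
    using a by (force, metis not_gr_zero prod.collapse)
  obtain v where v: "eventual_newton_number (fps2_supp f) v"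
    using eventual_newton_number_ex[OF S0, of b a] a b by blast
  obtain n1 where n1: "\<And>n w. n1 \<le> n \<Longrightarrow> eventual_newton_number (insert (n, 0) (fps2_supp f)) w \<Longrightarrow> w = v"
    using eventual_newton_number_insert_x[OF S0 v] by blast
  obtain n where n: "max n1 (max (2 * a + 1) (nat \<lceil>v\<rceil> + 2)) \<le> n" "of_nat n \<noteq> (0 :: 'k)"
    using ex_large_of_nat_nonzero by blast
  let ?f = "f + fps2_monom (n, 0)"
  have supp: "fps2_supp ?f = insert (n, 0) (fps2_supp f)"
    by (rule fps2_supp_add_monom) (use False in auto)
  have nd': "line_nondegenerate ?f"
    by (rule line_nondegenerate_add_x[OF nd y a]) (use n in auto)
  have S0': "(0, 0) \<notin> fps2_supp ?f" using S0 n unfolding supp by auto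
  have a': "(n, 0) \<in> fps2_supp ?f" and b': "(0, b) \<in> fps2_supp ?f \<or> (1, b) \<in> fps2_supp ?f"
    using b unfolding supp by auto
  obtain N where N: "milnor_number ?f = enat N" "eventual_newton_number (fps2_supp ?f) (real N)"
    using milnor_number_eventual_convenient[OF nd' S0' a' b'] by blast
  have "real N = v" using n1[of n "real N"] N(2) n(1) unfolding supp by simp
  then have "N < n - 1" using n(1) by simp linarith
  then have "milnor_number f = enat N" using milnor_number_add_x N(1) by blast
  then show ?thesis using v \<open>real N = v\<close> by auto
qed

section \<open>Series divisible by the square of a variable\<close>

text \<open>If x^2 divides \<open>f\<close>, both partial derivatives are divisible by x, so no
  power of y lies in the ideal, whereas finite codimension would put one there.\<close>

lemma milnor_number_infinite:
  fixes f :: "'a::field fps fps"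
  assumes S: "(\<forall>z\<in>fps2_supp f. 2 \<le> fst z) \<or> (\<forall>z\<in>fps2_supp f. 2 \<le> snd z)"
  shows "milnor_number f = \<infinity>"
proof (cases "milnor_number f")
  case (enat n)
  let ?J = "fps2_ideal {fps2_dx f, fps2_dy f}"
  have cod: "fps2_codim ?J = enat n" using enat by (simp add: milnor_number_def)
  have dx: "fps2_coeff f (fst y + 1, snd y) \<noteq> 0" if "fps2_coeff (fps2_dx f) y \<noteq> 0" for y
    using that by (auto simp: fps2_coeff_dx)
  have dy: "fps2_coeff f (fst y, snd y + 1) \<noteq> 0" if "fps2_coeff (fps2_dy f) y \<noteq> 0" for y
    using that by (auto simp: fps2_coeff_dy)
  have False if a: "(a, b) = (0, 1) \<and> (\<forall>z\<in>fps2_supp f. 2 \<le> fst z) \<or>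
      (a, b) = (1, 0) \<and> (\<forall>z\<in>fps2_supp f. 2 \<le> snd z)" for a b :: nat
  proof -
    have "(a, b) \<noteq> (0, 0)" using a by auto
    from power_mem_ideal_of_codim[OF ideal_fps2_ideal cod this]
    obtain u v where uv: "fps2_monom (n * a, n * b) = u * fps2_dx f + v * fps2_dy f"
      unfolding fps2_ideal_pair fps2_monom_power by blast
    have "fps2_coeff (u * fps2_dx f + v * fps2_dy f) (n * a, n * b) = 1"
      unfolding uv[symmetric] by (simp add: fps2_coeff_monom)
    then have "fps2_coeff (u * fps2_dx f) (n * a, n * b) \<noteq> 0 \<or> fps2_coeff (v * fps2_dy f) (n * a, n * b) \<noteq> 0"
      by auto
    then obtain x y where xy: "(n * a, n * b) = x + y"
      and nz: "fps2_coeff (fps2_dx f) y \<noteq> 0 \<or> fps2_coeff (fps2_dy f) y \<noteq> 0"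
      by (elim disjE; elim fps2_coeff_mult_nonzero; blast)
    have "(fst y + 1, snd y) \<in> fps2_supp f \<or> (fst y, snd y + 1) \<in> fps2_supp f"
      using nz dx[of y] dy[of y] by (auto simp: fps2_supp_def)
    moreover have "n * a = fst x + fst y" "n * b = snd x + snd y" using xy by (auto simp: prod_eq_iff)
    ultimately show False using a by fastforce
  qed
  then show ?thesis using S by blast
qed simp

theorem proposition4p5:
  fixes f :: "'k::alg_closed_field fps fps"
  assumes "f \<noteq> 0"
    and "f \<in> fps2_ideal {fps2_X, fps2_Y}"
    and "newton_nondegenerate f"
  shows "ereal_of_enat (milnor_number f) = newton_number f"
proof -
  let ?S = "fps2_supp f"
  obtain u v where "f = u * fps2_X + v * fps2_Y" using assms(2) unfolding fps2_ideal_pair by blast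
  then have "fps2_coeff f (0, 0) = 0"
    by (simp add: fps2_coeff_mult_0 fps2_X_eq_monom fps2_Y_eq_monom fps2_coeff_monom)
  then have S0: "(0, 0) \<notin> ?S" by (simp add: fps2_supp_def)
  have nd: "line_nondegenerate f" by (rule newton_nondegenerate_imp_line_nondegenerate[OF assms(3)])
  show ?thesis
  proof (cases "convenient ?S")
    case True
    then obtain a b where "(a, 0) \<in> ?S" "(0, b) \<in> ?S" by (rule convenient_imp_axis_points)
    from milnor_number_of_convenient[OF nd this S0] show ?thesis using True by (auto simp: newton_number_def)
  next
    case conv: False
    show ?thesis
    proof (cases "(\<exists>b. (0, b) \<in> ?S \<or> (1, b) \<in> ?S) \<and> (\<exists>a. (a, 0) \<in> ?S \<or> (a, 1) \<in> ?S)")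
      case True
      then obtain N where N: "milnor_number f = enat N" "eventual_newton_number ?S (real N)"
        using milnor_number_eventual[OF nd S0] by blast
      obtain n0 where n0: "0 < n0" "\<And>m n. n0 \<le> m \<Longrightarrow> n0 \<le> n \<Longrightarrow> convenient_newton_number (augment ?S m n) = real N"
        using N(2) unfolding eventual_newton_number_def by blast
      have "newton_number f = ereal (convenient_newton_number (augment ?S n0 n0))"
        unfolding newton_number_def if_not_P[OF conv] by (rule augment_SUP[OF S0 n0(1)]) (simp add: n0(2))
      then show ?thesis using N(1) n0(2)[of n0 n0] by simp
    next
      case False
      \<comment> \<open>One of the two alternatives fails for every point of the support, so x^2 or
        y^2 divides \<open>f\<close>.\<close>
      have "2 \<le> n" if "n \<noteq> 0" "n \<noteq> 1" for n :: nat using that by simp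
      then have inf: "(\<forall>z\<in>?S. 2 \<le> fst z) \<or> (\<forall>z\<in>?S. 2 \<le> snd z)"
        using False by (metis prod.collapse)
      show ?thesis unfolding newton_number_def if_not_P[OF conv] augment_SUP_infinite[OF S0 inf]
        by (simp add: milnor_number_infinite[OF inf])
    qed
  qed
qed

end
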